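(* Let $C^n\subset\mathbb R^{n+1}$, $n\ge2$, be a cone whose regular part is two-sided and minimal. Let $G$ be a smooth homogeneous defining function of degree $\ell$ on a conical neighborhood of $C_{\rm reg}\setminus\{0\}$, with $\nabla G\ne0$ there. Set $$w=|\nabla G|^{-1}\big|_C>0,\qquad V_G=-\frac{J_Cw}{w}=r^{-2}\beta_G(\theta).$$ For every $u\in C_c^\infty(C_{\rm reg}\setminus\{0\})$, $$Q_C(u)=\int_Cw^2\left|\nabla_C\left(\frac uw\right)\right|^2+\int_CV_Gu^2 .$$ If $\beta_G\ge\beta_0$ on the regular link for a finite constant $\beta_0$, then $$Q_C(u)\ge\left[\left(\ell-\frac n2\right)^2+\beta_0\right]\int_Cr^{-2}u^2 .$$ If $G=aF$, where $F,a$ are smooth with $a>0$, $\nabla F\neq 0$ on $\{F=0\}=C_{\rm reg}\setminus\{0\}$ (within the neighborhood), then $$V_G=\left.\frac{\mathcal K_F(a)}{a^3|\nabla F|^2}\right|_C=\left.\partial_{\nu_C}\operatorname{div}\left(\frac{\nabla G}{|\nabla G|}\right)\right|_C .$$ Consequently a nonnegative Jacobi boundary defect ($\mathcal K_F(a)|_C\ge0$) implies stability; if also $\ell\ne n/2$, it implies strict stability with constant at least $(\ell-n/2)^2$.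
   Context: $r=|x|$, and $(r,\theta)$ are polar coordinates on the cone, $\theta$ ranging over the regular link $C_{\rm reg}\cap S^n$. A defining function has zero set equal to $C_{\rm reg}\setminus\{0\}$ in its domain; $\nu_C=\nabla G/|\nabla G|$ on $C_{\rm reg}$. $J_C=\Delta_{C_{\rm reg}}+|A_C|^2$ with $A_C$ the second fundamental form and $\int u\Delta u=-\int|\nabla u|^2$. $Q_C(u)=\int_{C_{\rm reg}}(|\nabla_Cu|^2-|A_C|^2u^2)$. $C$ is stable if $Q_C(u)\ge0$ for all $u\in C_c^\infty(C_{\rm reg}\setminus\{0\})$, and strictly stable with constant $\delta>0$ if $Q_C(u)\ge\delta\int_{C_{\rm reg}}r^{-2}u^2$ for all such $u$. For smooth $G$, $\mathcal L(G)=|\nabla G|^2\Delta G-\frac12\langle\nabla|\nabla G|^2,\nabla G\rangle$, and $\mathcal K_F(a)$ is the smooth extension of $\mathcal L(aF)/F$ across $\{F=0\}$, which exists because the hypersurface is minimal. *)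

theory Defs
  imports "HOL-Analysis.Analysis"
begin

section \<open>Smooth functions and operators in the ambient space\<close>

primrec Ck_on :: "nat \<Rightarrow> 'a::euclidean_space set \<Rightarrow> ('a \<Rightarrow> real) \<Rightarrow> bool" where
  "Ck_on 0 U f \<longleftrightarrow> continuous_on U f"
| "Ck_on (Suc k) U f \<longleftrightarrow> (\<forall>x\<in>U. f differentiable (at x)) \<and>
     (\<forall>b\<in>Basis. Ck_on k U (\<lambda>x. frechet_derivative f (at x) b))"

text \<open>Meant for open \<open>U\<close>, as the derivatives are taken in the ambient space.\<close>

definition smooth_on :: "'a::euclidean_space set \<Rightarrow> ('a \<Rightarrow> real) \<Rightarrow> bool" where
  "smooth_on U f \<longleftrightarrow> (\<forall>k. Ck_on k U f)"

definition grad :: "('a::euclidean_space \<Rightarrow> real) \<Rightarrow> 'a \<Rightarrow> 'a" where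
  "grad f x = (\<Sum>b\<in>Basis. frechet_derivative f (at x) b *\<^sub>R b)"

definition divergence :: "('a::euclidean_space \<Rightarrow> 'a) \<Rightarrow> 'a \<Rightarrow> real" where
  "divergence X x = (\<Sum>b\<in>Basis. frechet_derivative X (at x) b \<bullet> b)"

definition laplacian :: "('a::euclidean_space \<Rightarrow> real) \<Rightarrow> 'a \<Rightarrow> real" where
  "laplacian f x = divergence (grad f) x"

definition unit_grad :: "('a::euclidean_space \<Rightarrow> real) \<Rightarrow> 'a \<Rightarrow> 'a" where
  "unit_grad G x = grad G x /\<^sub>R norm (grad G x)"

definition level_op :: "('a::euclidean_space \<Rightarrow> real) \<Rightarrow> 'a \<Rightarrow> real" where
  "level_op G x = (norm (grad G x))\<^sup>2 * laplacian G x
     - 1/2 * (grad (\<lambda>y. (norm (grad G y))\<^sup>2) x \<bullet> grad G x)"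

section \<open>Hausdorff measure\<close>

definition hausdorff_content :: "nat \<Rightarrow> real \<Rightarrow> 'a::metric_space set \<Rightarrow> ennreal" where
  "hausdorff_content n \<delta> A =
     (INF E \<in> {E :: nat \<Rightarrow> 'a set. A \<subseteq> (\<Union>i. E i) \<and> (\<forall>i. bounded (E i) \<and> diameter (E i) \<le> \<delta>)}.
        \<Sum>i. if E i = {} then 0 else ennreal (unit_ball_vol (real n) * (diameter (E i) / 2) ^ n))"

definition hausdorff_outer :: "nat \<Rightarrow> 'a::metric_space set \<Rightarrow> ennreal" where
  "hausdorff_outer n A = (SUP \<delta>\<in>{0<..}. hausdorff_content n \<delta> A)"

text \<open>The \<open>n\<close>-dimensional Hausdorff measure, restricted to the Borel sets, which are
  measurable by Caratheodory's criterion for metric outer measures.  On an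
  \<open>n\<close>-dimensional embedded submanifold it is the Riemannian volume measure.\<close>

definition hausdorff_measure :: "nat \<Rightarrow> 'a::metric_space measure" where
  "hausdorff_measure n = measure_of UNIV (sets borel) (hausdorff_outer n)"

section \<open>Embedded hypersurfaces\<close>

text \<open>\<open>f\<close> is a local defining function, on the open neighbourhood \<open>W\<close> of \<open>x\<close>, of \<open>S\<close>.\<close>

definition local_defining :: "'a::euclidean_space set \<Rightarrow> 'a \<Rightarrow> 'a set \<Rightarrow> ('a \<Rightarrow> real) \<Rightarrow> bool" where
  "local_defining S x W f \<longleftrightarrow> open W \<and> x \<in> W \<and> smooth_on W f \<and>
     (\<forall>y\<in>W. grad f y \<noteq> 0) \<and> S \<inter> W = {y\<in>W. f y = 0}"

definition regular_part :: "'a::euclidean_space set \<Rightarrow> 'a set" where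
  "regular_part C = {x\<in>C. \<exists>W f. local_defining C x W f}"

text \<open>In the remaining definitions of this section \<open>S\<close> is an embedded hypersurface
  and \<open>x\<close> a point of \<open>S\<close>.  The tangent space is the kernel of the differential of a local
  defining function, all of which have the same kernel.\<close>

definition tangent_space :: "'a::euclidean_space set \<Rightarrow> 'a \<Rightarrow> 'a set" where
  "tangent_space S x = {v. \<forall>W f. local_defining S x W f \<longrightarrow> grad f x \<bullet> v = 0}"

definition tangent_proj :: "'a::euclidean_space set \<Rightarrow> 'a \<Rightarrow> 'a \<Rightarrow> 'a" where
  "tangent_proj S x v = (THE p. p \<in> tangent_space S x \<and> (\<forall>t\<in>tangent_space S x. (v - p) \<bullet> t = 0))"

text \<open>The derivative of a map on \<open>S\<close> is its derivative within \<open>S\<close>.  The latter is determined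
  only on tangent vectors, which is why it is always composed with \<^const>\<open>tangent_proj\<close>;
  the sums over \<open>Basis\<close> then are the usual expressions in an orthonormal tangent frame.\<close>

definition tangent_deriv ::
  "'a::euclidean_space set \<Rightarrow> ('a \<Rightarrow> 'b::real_normed_vector) \<Rightarrow> 'a \<Rightarrow> 'a \<Rightarrow> 'b" where
  "tangent_deriv S f x v = frechet_derivative f (at x within S) (tangent_proj S x v)"

definition surface_grad :: "'a::euclidean_space set \<Rightarrow> ('a \<Rightarrow> real) \<Rightarrow> 'a \<Rightarrow> 'a" where
  "surface_grad S u x = (\<Sum>b\<in>Basis. tangent_deriv S u x b *\<^sub>R b)"

definition surface_div :: "'a::euclidean_space set \<Rightarrow> ('a \<Rightarrow> 'a) \<Rightarrow> 'a \<Rightarrow> real" where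
  "surface_div S X x = (\<Sum>b\<in>Basis. tangent_deriv S X x b \<bullet> tangent_proj S x b)"

definition surface_laplacian :: "'a::euclidean_space set \<Rightarrow> ('a \<Rightarrow> real) \<Rightarrow> 'a \<Rightarrow> real" where
  "surface_laplacian S u x = surface_div S (surface_grad S u) x"

definition unit_normal_field :: "'a::euclidean_space set \<Rightarrow> 'a set \<Rightarrow> ('a \<Rightarrow> 'a) \<Rightarrow> bool" where
  "unit_normal_field S T N \<longleftrightarrow> continuous_on T N \<and>
     (\<forall>y\<in>T. norm (N y) = 1 \<and> (\<forall>v\<in>tangent_space S y. N y \<bullet> v = 0))"

definition two_sided :: "'a::euclidean_space set \<Rightarrow> bool" where
  "two_sided S \<longleftrightarrow> (\<exists>N. unit_normal_field S S N)"

text \<open>The second fundamental form with respect to some unit normal field near \<open>x\<close>.  Its sign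
  depends on that choice, but minimality and \<open>|A|\<^sup>2\<close> do not.\<close>

definition second_fundamental_form :: "'a::euclidean_space set \<Rightarrow> 'a \<Rightarrow> 'a \<Rightarrow> 'a \<Rightarrow> real" where
  "second_fundamental_form S x v w =
     tangent_deriv S (SOME N. \<exists>W. open W \<and> x \<in> W \<and> unit_normal_field S (S \<inter> W) N) x v
       \<bullet> tangent_proj S x w"

definition mean_curvature :: "'a::euclidean_space set \<Rightarrow> 'a \<Rightarrow> real" where
  "mean_curvature S x = (\<Sum>b\<in>Basis. second_fundamental_form S x b b)"

definition sff_norm_sq :: "'a::euclidean_space set \<Rightarrow> 'a \<Rightarrow> real" where
  "sff_norm_sq S x = (\<Sum>b\<in>Basis. \<Sum>c\<in>Basis. (second_fundamental_form S x b c)\<^sup>2)"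

definition minimal_surface :: "'a::euclidean_space set \<Rightarrow> bool" where
  "minimal_surface S \<longleftrightarrow> (\<forall>x\<in>S. mean_curvature S x = 0)"

definition jacobi_op :: "'a::euclidean_space set \<Rightarrow> ('a \<Rightarrow> real) \<Rightarrow> 'a \<Rightarrow> real" where
  "jacobi_op S u x = surface_laplacian S u x + sff_norm_sq S x * u x"

definition smooth_on_surface :: "'a::euclidean_space set \<Rightarrow> ('a \<Rightarrow> real) \<Rightarrow> bool" where
  "smooth_on_surface S u \<longleftrightarrow>
     (\<forall>x\<in>S. \<exists>W f. open W \<and> x \<in> W \<and> smooth_on W f \<and> (\<forall>y\<in>S \<inter> W. u y = f y))"

text \<open>\<open>C\<^sub>c\<^sup>\<infinity>(S)\<close>; its elements are extended by zero.\<close>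

definition test_functions :: "'a::euclidean_space set \<Rightarrow> ('a \<Rightarrow> real) set" where
  "test_functions S =
     {u. smooth_on_surface S u \<and> (\<exists>K. compact K \<and> K \<subseteq> S \<and> (\<forall>x. x \<notin> K \<longrightarrow> u x = 0))}"

section \<open>Hypercones\<close>

text \<open>Integration over the regular part of a hypercone \<open>C\<close>.\<close>

definition cone_integral :: "'a::euclidean_space set \<Rightarrow> ('a \<Rightarrow> real) \<Rightarrow> real" where
  "cone_integral C f = (LINT x:regular_part C|hausdorff_measure (DIM('a) - 1). f x)"

definition Q_form :: "'a::euclidean_space set \<Rightarrow> ('a \<Rightarrow> real) \<Rightarrow> real" where
  "Q_form C u = cone_integral C (\<lambda>x. (norm (surface_grad (regular_part C) u x))\<^sup>2
                                     - sff_norm_sq (regular_part C) x * (u x)\<^sup>2)"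

definition stable_cone :: "'a::euclidean_space set \<Rightarrow> bool" where
  "stable_cone C \<longleftrightarrow> (\<forall>u \<in> test_functions (regular_part C - {0}). Q_form C u \<ge> 0)"

definition strictly_stable_cone :: "'a::euclidean_space set \<Rightarrow> real \<Rightarrow> bool" where
  "strictly_stable_cone C \<delta> \<longleftrightarrow> \<delta> > 0 \<and>
     (\<forall>u \<in> test_functions (regular_part C - {0}).
        Q_form C u \<ge> \<delta> * cone_integral C (\<lambda>x. (u x)\<^sup>2 / (norm x)\<^sup>2))"

definition regular_link :: "'a::euclidean_space set \<Rightarrow> 'a set" where
  "regular_link C = regular_part C \<inter> sphere 0 1"

definition conical_nbhd :: "'a::euclidean_space set \<Rightarrow> 'a set \<Rightarrow> bool" where
  "conical_nbhd C U \<longleftrightarrow> open U \<and> regular_part C - {0} \<subseteq> U \<and> (\<forall>x\<in>U. \<forall>t>0. t *\<^sub>R x \<in> U)"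

definition defining_function :: "'a::euclidean_space set \<Rightarrow> 'a set \<Rightarrow> ('a \<Rightarrow> real) \<Rightarrow> bool" where
  "defining_function C U G \<longleftrightarrow> smooth_on U G \<and> {x\<in>U. G x = 0} = regular_part C - {0}
     \<and> (\<forall>x \<in> regular_part C - {0}. grad G x \<noteq> 0)"

definition homogeneous_on :: "'a::euclidean_space set \<Rightarrow> real \<Rightarrow> ('a \<Rightarrow> real) \<Rightarrow> bool" where
  "homogeneous_on U l G \<longleftrightarrow> (\<forall>x\<in>U. \<forall>t>0. G (t *\<^sub>R x) = t powr l * G x)"

definition weight :: "('a::euclidean_space \<Rightarrow> real) \<Rightarrow> 'a \<Rightarrow> real" where
  "weight G x = inverse (norm (grad G x))"

definition potential :: "'a::euclidean_space set \<Rightarrow> ('a \<Rightarrow> real) \<Rightarrow> 'a \<Rightarrow> real" where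
  "potential C G x = - jacobi_op (regular_part C) (weight G) x / weight G x"

text \<open>The factor \<open>\<beta>\<close> in \<open>V = r\<^sup>-\<^sup>2 \<beta>(\<theta>)\<close>: the values of \<open>V\<close> on the link, where \<open>r = 1\<close>.\<close>

definition angular_potential :: "'a::euclidean_space set \<Rightarrow> ('a \<Rightarrow> real) \<Rightarrow> 'a \<Rightarrow> real" where
  "angular_potential C G \<theta> = (if \<theta> \<in> regular_link C then potential C G \<theta> else 0)"

text \<open>The smooth extension of \<open>\<L>(aF)/F\<close> across \<open>{F = 0}\<close>.  It is unique on \<open>U\<close> if
  \<open>grad F\<close> has no zero on \<open>{F = 0}\<close>.\<close>

definition boundary_defect ::
  "'a::euclidean_space set \<Rightarrow> ('a \<Rightarrow> real) \<Rightarrow> ('a \<Rightarrow> real) \<Rightarrow> 'a \<Rightarrow> real" where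
  "boundary_defect U F a = (SOME K. smooth_on U K \<and>
     (\<forall>x\<in>U. F x \<noteq> 0 \<longrightarrow> K x = level_op (\<lambda>y. a y * F y) x / F x))"

end

theory Submission
  imports Defs
begin

text \<open>
  Everything comes down to one pointwise computation and one integration by parts.  Let \<open>\<nu> = \<nabla>G / |\<nabla>G|\<close> be
  the unit normal of the level sets of \<open>G\<close>, \<open>w = 1 / |\<nabla>G|\<close> the weight, and \<open>Z = \<nabla>\<^sub>\<nu>\<nu>\<close>.  Since the Hessian of
  \<open>G\<close> is symmetric, \<open>Z\<close> is minus the tangential gradient of \<open>log w\<close>.  Hence \<open>\<Delta>\<^sub>Cw = - w div Z\<close>, while
  commuting derivatives gives \<open>\<partial>\<^sub>\<nu> div \<nu> = div Z - |A|\<^sup>2\<close>; together these say that the potential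
  \<open>V = - J w / w\<close> is \<open>\<partial>\<^sub>\<nu> div \<nu>\<close> (\<open>jacobi_weight_eq_normal_derivative\<close>).  Its homogeneity of degree \<open>-2\<close>
  follows from that of \<open>\<nu>\<close>.  As the level operator is \<open>|\<nabla>G|\<^sup>3 div \<nu>\<close> and vanishes on a minimal cone, its
  normal derivative there is \<open>|\<nabla>G|\<^sup>3 V\<close>; comparing with \<open>\<L>(aF) = F K\<close> expresses \<open>V\<close> by the boundary
  defect \<open>K\<close> (\<open>potential_boundary_defect\<close>).  That \<open>\<L>(aF)\<close> is smoothly divisible by \<open>F\<close> is Hadamard's lemma
  (\<open>smooth_quotient_exists\<close>).

  For a test function \<open>u = w v\<close>, the integrand of \<open>Q\<close> differs from \<open>w\<^sup>2 |\<nabla>v|\<^sup>2 + V u\<^sup>2\<close> by the divergence of the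
  tangential field \<open>- u\<^sup>2 Z\<close> (\<open>ground_state_identity\<close>).  With \<open>\<alpha> = l - n/2\<close>, the weighted term
  \<open>w\<^sup>2 |\<nabla>v|\<^sup>2\<close> exceeds \<open>\<alpha>\<^sup>2 u\<^sup>2 / r\<^sup>2\<close> by a square and \<open>\<alpha>\<close> times the divergence of \<open>u\<^sup>2 x / r\<^sup>2\<close>
  (\<open>hardy_identity\<close>); here Euler's relations for \<open>G\<close> and \<open>w\<close> enter.  Integrating both identities proves
  the formula for \<open>Q\<close>, the lower bounds and the statements on stability.

  The integration rests on the divergence theorem for compactly supported tangential fields on a
  hypersurface with respect to Hausdorff measure (\<open>surface_divergence_theorem\<close>).  Locally the hypersurface
  is a graph along some direction \<open>e\<close>, and the divergence on it, times the area element, is the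
  divergence in space of a field constant along \<open>e\<close>, cut off at finite height.  What relates Hausdorff
  measure to Lebesgue measure of slabs over the graph is the area formula (\<open>area_formula\<close>).  On hyperplanes
  it follows from translation and rotation invariance, as in the uniqueness of Haar measure; on a graph,
  the projections to tangent planes are nearly isometric on small pieces.  The normalization of Hausdorff
  measure is never determined: the formula holds up to a universal constant, which suffices for
  integrals that vanish.
\<close>

section \<open>Calculus of smooth functions and fields\<close>

definition Ck_field :: "nat \<Rightarrow> 'a::euclidean_space set \<Rightarrow> ('a \<Rightarrow> 'b::euclidean_space) \<Rightarrow> bool" where
  "Ck_field k U X \<longleftrightarrow> (\<forall>b\<in>Basis. Ck_on k U (\<lambda>x. X x \<bullet> b))"

lemma has_derivative_frechet:
  "f differentiable (at x) \<Longrightarrow> (f has_derivative frechet_derivative f (at x)) (at x)"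
  by (simp add: frechet_derivative_works)

lemma frechet_derivative_eq:
  "(f has_derivative D) (at x) \<Longrightarrow> frechet_derivative f (at x) = D"
  by (metis frechet_derivative_at)

lemma Ck_on_cong:
  assumes "open U" "\<forall>x\<in>U. f x = g x" "Ck_on k U f"
  shows "Ck_on k U g"
  using assms(2,3)
proof (induction k arbitrary: f g)
  case 0
  then show ?case by (auto cong: continuous_on_cong)
next
  case (Suc k)
  have *: "(g has_derivative frechet_derivative f (at x)) (at x)" if "x \<in> U" for x
    using has_derivative_transform_within_open[OF has_derivative_frechet \<open>open U\<close> that]
      Suc.prems that by auto
  show ?case unfolding Ck_on.simps
  proof (intro conjI ballI)
    show "g differentiable (at x)" if "x \<in> U" for x
      using *[OF that] by (auto simp: differentiable_def)
    show "Ck_on k U (\<lambda>x. frechet_derivative g (at x) b)" if "b \<in> Basis" for b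
      by (rule Suc.IH[where f = "\<lambda>x. frechet_derivative f (at x) b"])
        (use Suc.prems that frechet_derivative_eq[OF *] in auto)
  qed
qed

lemma Ck_on_SucI:
  assumes der: "\<And>x. x \<in> U \<Longrightarrow> (f has_derivative f' x) (at x)" and "open U"
    and "\<And>b. b \<in> Basis \<Longrightarrow> Ck_on k U (\<lambda>x. f' x b)"
  shows "Ck_on (Suc k) U f"
  unfolding Ck_on.simps
proof (intro conjI ballI)
  show "f differentiable (at x)" if "x \<in> U" for x
    using der[OF that] by (auto simp: differentiable_def)
  show "Ck_on k U (\<lambda>x. frechet_derivative f (at x) b)" if "b \<in> Basis" for b
    by (rule Ck_on_cong[OF \<open>open U\<close> _ assms(3)[OF that]]) (simp add: frechet_derivative_eq[OF der])
qed

lemma Ck_on_Suc_D: "Ck_on (Suc k) U f \<Longrightarrow> Ck_on k U f"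
proof (induction k arbitrary: f)
  case 0
  then show ?case
    by (auto intro!: continuous_at_imp_continuous_on differentiable_imp_continuous_within)
qed auto

lemma Ck_on_mono: "Ck_on k U f \<Longrightarrow> j \<le> k \<Longrightarrow> Ck_on j U f"
  by (induction k) (auto simp: le_Suc_eq simp del: Ck_on.simps(2) dest: Ck_on_Suc_D)

lemma Ck_on_subset: "Ck_on k U f \<Longrightarrow> V \<subseteq> U \<Longrightarrow> Ck_on k V f"
  by (induction k arbitrary: f) (auto intro: continuous_on_subset)

lemma Ck_on_continuous: "Ck_on k U f \<Longrightarrow> continuous_on U f"
  using Ck_on_mono[of k U f 0] by simp

lemma Ck_on_local:
  assumes "\<And>x. x \<in> U \<Longrightarrow> \<exists>W. open W \<and> x \<in> W \<and> Ck_on k W f"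
  shows "Ck_on k U f"
  using assms
proof (induction k arbitrary: f)
  case 0
  then show ?case
    by (auto intro!: continuous_at_imp_continuous_on) (metis continuous_on_eq_continuous_at)
next
  case (Suc k)
  show ?case unfolding Ck_on.simps
  proof (intro conjI ballI)
    show "f differentiable at x" if "x \<in> U" for x using Suc.prems[OF that] by auto
    show "Ck_on k U (\<lambda>x. frechet_derivative f (at x) b)" if "b \<in> Basis" for b
      using Suc.prems that by (intro Suc.IH) (fastforce)
  qed
qed

lemma Ck_on_const [simp]: "Ck_on k U (\<lambda>x. c)"
  by (induction k arbitrary: c) (auto simp: frechet_derivative_const)

lemma Ck_on_inner_const: "open U \<Longrightarrow> Ck_on k U (\<lambda>x. x \<bullet> c)"
proof (cases k)
  case (Suc m)
  assume "open U"
  show ?thesis unfolding Suc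
    by (rule Ck_on_SucI[where f' = "\<lambda>x h. h \<bullet> c"])
      (auto intro!: derivative_eq_intros \<open>open U\<close>)
qed (auto intro!: continuous_intros)

text \<open>The closure properties go by induction on the order, for all functions at once: the derivative of the
  compound function is built from its constituents and their derivatives, which have the order of the
  induction hypothesis.\<close>

lemma Ck_on_add:
  assumes "open U" "Ck_on k U f" "Ck_on k U g"
  shows "Ck_on k U (\<lambda>x. f x + g x)"
  using assms(2,3)
proof (induction k arbitrary: f g)
  case (Suc k)
  show ?case
    by (rule Ck_on_SucI[where f' = "\<lambda>x h. frechet_derivative f (at x) h + frechet_derivative g (at x) h"])
      (use Suc assms(1) in \<open>auto intro!: has_derivative_add has_derivative_frechet\<close>)
qed (auto intro: continuous_intros)

lemma Ck_on_mult:
  assumes "open U" "Ck_on k U f" "Ck_on k U g"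
  shows "Ck_on k U (\<lambda>x. f x * g x)"
  using assms(2,3)
proof (induction k arbitrary: f g)
  case (Suc k)
  note lower = Suc.prems[THEN Ck_on_Suc_D]
  show ?case
    by (rule Ck_on_SucI[where f' = "\<lambda>x h. f x * frechet_derivative g (at x) h + frechet_derivative f (at x) h * g x"])
      (use Suc lower assms(1) in \<open>auto intro!: has_derivative_mult has_derivative_frechet Ck_on_add\<close>)
qed (auto intro: continuous_intros)

lemma Ck_on_minus: "open U \<Longrightarrow> Ck_on k U f \<Longrightarrow> Ck_on k U (\<lambda>x. - f x)"
  using Ck_on_mult[of U k "\<lambda>x. -1" f] by simp

lemma Ck_on_diff: "open U \<Longrightarrow> Ck_on k U f \<Longrightarrow> Ck_on k U g \<Longrightarrow> Ck_on k U (\<lambda>x. f x - g x)"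
  using Ck_on_add[of U k f "\<lambda>x. - g x"] Ck_on_minus by auto

lemma Ck_on_sum:
  "open U \<Longrightarrow> (\<And>i. i \<in> I \<Longrightarrow> Ck_on k U (f i)) \<Longrightarrow> Ck_on k U (\<lambda>x. \<Sum>i\<in>I. f i x)"
  by (induction I rule: infinite_finite_induct) (auto intro: Ck_on_add)

lemma Ck_on_power: "open U \<Longrightarrow> Ck_on k U f \<Longrightarrow> Ck_on k U (\<lambda>x. f x ^ m)"
  by (induction m) (auto intro: Ck_on_mult)

lemma Ck_on_inverse:
  assumes "open U" "Ck_on k U f" "\<And>x. x \<in> U \<Longrightarrow> f x \<noteq> 0"
  shows "Ck_on k U (\<lambda>x. inverse (f x))"
  using assms(2)
proof (induction k)
  case (Suc k)
  note lower = Suc.IH[OF Suc.prems[THEN Ck_on_Suc_D]]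
  show ?case
    by (rule Ck_on_SucI[where f' = "\<lambda>x h. - (inverse (f x) * frechet_derivative f (at x) h * inverse (f x))"])
      (use Suc lower assms in \<open>auto intro!: Deriv.has_derivative_inverse has_derivative_frechet Ck_on_minus Ck_on_mult\<close>)
qed (use assms in \<open>auto intro!: continuous_intros\<close>)

lemma Ck_on_divide:
  "open U \<Longrightarrow> Ck_on k U f \<Longrightarrow> Ck_on k U g \<Longrightarrow> (\<And>x. x \<in> U \<Longrightarrow> g x \<noteq> 0) \<Longrightarrow> Ck_on k U (\<lambda>x. f x / g x)"
  using Ck_on_mult[of U k f "\<lambda>x. inverse (g x)"] Ck_on_inverse by (auto simp: divide_inverse)

lemma Ck_on_sqrt:
  assumes "open U" "Ck_on k U f" "\<And>x. x \<in> U \<Longrightarrow> f x > 0"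
  shows "Ck_on k U (\<lambda>x. sqrt (f x))"
  using assms(2)
proof (induction k)
  case (Suc k)
  note lower = Suc.IH[OF Suc.prems[THEN Ck_on_Suc_D]]
  have "Ck_on k U (\<lambda>x. inverse (sqrt (f x)))"
    using assms by (intro Ck_on_inverse lower) (auto dest: order_less_imp_not_eq2)
  then have *: "Ck_on k U (\<lambda>x. frechet_derivative f (at x) b * (inverse (sqrt (f x)) / 2))"
    if "b \<in> Basis" for b
    using Suc.prems assms(1) that
    by (intro Ck_on_mult Ck_on_divide) auto
  show ?case
    by (rule Ck_on_SucI[where f' = "\<lambda>x h. frechet_derivative f (at x) h * (inverse (sqrt (f x)) / 2)"])
      (use Suc.prems assms * in \<open>auto intro!: derivative_eq_intros has_derivative_frechet simp: field_simps\<close>)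
qed (use assms in \<open>auto intro!: continuous_intros\<close>)

lemma linear_Basis_sum:
  fixes L :: "'a::euclidean_space \<Rightarrow> 'b::real_vector"
  assumes "linear L"
  shows "L h = (\<Sum>b\<in>Basis. (h \<bullet> b) *\<^sub>R L b)"
  using linear_sum[OF assms, of "\<lambda>b. (h \<bullet> b) *\<^sub>R b" Basis] linear_scale[OF assms]
  by (simp add: euclidean_representation)

lemma Ck_field_differentiable:
  assumes "Ck_field (Suc k) U X" "x \<in> U"
  shows "X differentiable (at x)"
  using assms unfolding Ck_field_def by (subst differentiable_componentwise_within) auto

lemma Ck_field_continuous: "Ck_field k U X \<Longrightarrow> continuous_on U X"
  unfolding Ck_field_def by (subst continuous_on_componentwise) (auto intro: Ck_on_continuous)

lemma frechet_derivative_inner: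
  assumes "X differentiable (at x)"
  shows "frechet_derivative (\<lambda>y. X y \<bullet> c) (at x) h = frechet_derivative X (at x) h \<bullet> c"
  using frechet_derivative_eq[OF has_derivative_inner_left[OF has_derivative_frechet[OF assms], of c]]
  by simp

lemma Ck_field_deriv:
  assumes "Ck_field (Suc k) U X" "open U" "h \<in> Basis"
  shows "Ck_field k U (\<lambda>x. frechet_derivative X (at x) h)"
  unfolding Ck_field_def
proof
  fix b :: 'b assume b: "b \<in> Basis"
  have "Ck_on k U (\<lambda>x. frechet_derivative (\<lambda>y. X y \<bullet> b) (at x) h)"
    using assms b unfolding Ck_field_def by auto
  then show "Ck_on k U (\<lambda>x. frechet_derivative X (at x) h \<bullet> b)"
    by (rule Ck_on_cong[OF assms(2), rotated])
      (simp add: frechet_derivative_inner Ck_field_differentiable[OF assms(1)])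
qed

lemma Ck_field_subset: "Ck_field k U X \<Longrightarrow> V \<subseteq> U \<Longrightarrow> Ck_field k V X"
  unfolding Ck_field_def by (auto intro: Ck_on_subset)

lemma Ck_field_mono: "Ck_field k U X \<Longrightarrow> j \<le> k \<Longrightarrow> Ck_field j U X"
  unfolding Ck_field_def by (auto intro: Ck_on_mono)

lemma Ck_field_cong: "open U \<Longrightarrow> \<forall>x\<in>U. X x = Y x \<Longrightarrow> Ck_field k U X \<Longrightarrow> Ck_field k U Y"
  unfolding Ck_field_def by (auto intro: Ck_on_cong[where f = "\<lambda>x. X x \<bullet> _"])

lemma Ck_field_const [simp]: "Ck_field k U (\<lambda>x. c)"
  unfolding Ck_field_def by simp

lemma Ck_field_id: "open U \<Longrightarrow> Ck_field k U (\<lambda>x. x)"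
  unfolding Ck_field_def by (auto intro: Ck_on_inner_const)

lemma Ck_field_add: "open U \<Longrightarrow> Ck_field k U X \<Longrightarrow> Ck_field k U Y \<Longrightarrow> Ck_field k U (\<lambda>x. X x + Y x)"
  unfolding Ck_field_def by (auto simp: inner_add_left intro!: Ck_on_add)

lemma Ck_field_diff: "open U \<Longrightarrow> Ck_field k U X \<Longrightarrow> Ck_field k U Y \<Longrightarrow> Ck_field k U (\<lambda>x. X x - Y x)"
  unfolding Ck_field_def by (auto simp: inner_diff_left intro!: Ck_on_diff)

lemma Ck_field_scaleR: "open U \<Longrightarrow> Ck_on k U f \<Longrightarrow> Ck_field k U X \<Longrightarrow> Ck_field k U (\<lambda>x. f x *\<^sub>R X x)"
  unfolding Ck_field_def by (auto intro!: Ck_on_mult)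

lemma Ck_on_inner:
  assumes "open U" "Ck_field k U X" "Ck_field k U Y"
  shows "Ck_on k U (\<lambda>x. X x \<bullet> Y x)"
  using assms unfolding Ck_field_def
  by (subst euclidean_inner) (auto intro!: Ck_on_sum Ck_on_mult)

lemma Ck_on_norm:
  assumes "open U" "Ck_field k U X" "\<And>x. x \<in> U \<Longrightarrow> X x \<noteq> 0"
  shows "Ck_on k U (\<lambda>x. norm (X x))"
  unfolding norm_eq_sqrt_inner using assms by (auto intro!: Ck_on_sqrt Ck_on_inner)

lemma Ck_on_compose:
  assumes "open U" "open V" "Ck_on k V f" "Ck_field k U \<phi>" "\<And>x. x \<in> U \<Longrightarrow> \<phi> x \<in> V"
  shows "Ck_on k U (\<lambda>x. f (\<phi> x))"
  using assms(3,4)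
proof (induction k arbitrary: f)
  case 0
  then show ?case
    using assms(5) by (auto intro!: continuous_on_compose2[of V f U \<phi>] dest: Ck_field_continuous)
next
  case (Suc k)
  let ?D = "\<lambda>x h. frechet_derivative f (at (\<phi> x)) (frechet_derivative \<phi> (at x) h)"
  have der: "((\<lambda>x. f (\<phi> x)) has_derivative ?D x) (at x)" if "x \<in> U" for x
    using Suc.prems assms(5)[OF that] Ck_field_differentiable[OF Suc.prems(2) that]
      diff_chain_at[of \<phi> "frechet_derivative \<phi> (at x)" x f "frechet_derivative f (at (\<phi> x))"]
    by (auto simp: o_def intro: has_derivative_frechet)
  show ?case
  proof (rule Ck_on_SucI[OF der \<open>open U\<close>])
    fix b :: 'a assume b: "b \<in> Basis"
    have *: "Ck_on k U (\<lambda>x. \<Sum>c\<in>Basis. (frechet_derivative \<phi> (at x) b \<bullet> c) * frechet_derivative f (at (\<phi> x)) c)"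
    proof (intro Ck_on_sum Ck_on_mult \<open>open U\<close>)
      fix c :: 'b assume c: "c \<in> Basis"
      show "Ck_on k U (\<lambda>x. frechet_derivative \<phi> (at x) b \<bullet> c)"
        using Ck_field_deriv[OF Suc.prems(2) \<open>open U\<close> b] c by (auto simp: Ck_field_def)
      show "Ck_on k U (\<lambda>x. frechet_derivative f (at (\<phi> x)) c)"
        using Suc.prems c by (intro Suc.IH) (auto intro: Ck_field_mono)
    qed
    have "(\<Sum>c\<in>Basis. (frechet_derivative \<phi> (at x) b \<bullet> c) * frechet_derivative f (at (\<phi> x)) c) = ?D x b"
      if "x \<in> U" for x
    proof -
      have "linear (frechet_derivative f (at (\<phi> x)))"
        using Suc.prems assms(5)[OF that] by (auto intro: linear_frechet_derivative)
      then show ?thesis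
        using linear_Basis_sum[of "frechet_derivative f (at (\<phi> x))" "frechet_derivative \<phi> (at x) b"]
        by simp
    qed
    then show "Ck_on k U (\<lambda>x. ?D x b)"
      by (intro Ck_on_cong[OF \<open>open U\<close> _ *]) auto
  qed
qed

lemma Ck_field_compose:
  assumes "open U" "open V" "Ck_field k V X" "Ck_field k U \<phi>" "\<And>x. x \<in> U \<Longrightarrow> \<phi> x \<in> V"
  shows "Ck_field k U (\<lambda>x. X (\<phi> x))"
  using assms unfolding Ck_field_def[of k V] Ck_field_def[of k U "\<lambda>x. X (\<phi> x)"]
  by (auto intro!: Ck_on_compose[OF assms(1,2) _ assms(4,5)])

lemma grad_inner_Basis: "b \<in> Basis \<Longrightarrow> grad f x \<bullet> b = frechet_derivative f (at x) b"
  unfolding grad_def by (simp add: inner_sum_left inner_Basis if_distrib sum.delta cong: if_cong)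

lemma frechet_derivative_grad:
  assumes "f differentiable (at x)"
  shows "frechet_derivative f (at x) h = grad f x \<bullet> h"
proof -
  have "linear (frechet_derivative f (at x))" using assms by (rule linear_frechet_derivative)
  then show ?thesis
    using linear_Basis_sum[of "frechet_derivative f (at x)" h]
    unfolding grad_def by (simp add: inner_sum_left inner_sum_right mult.commute inner_commute)
qed

lemma has_derivative_grad:
  assumes "f differentiable (at x)"
  shows "(f has_derivative (\<lambda>h. grad f x \<bullet> h)) (at x)"
proof -
  have "frechet_derivative f (at x) = (\<lambda>h. grad f x \<bullet> h)"
    using frechet_derivative_grad[OF assms] by blast
  then show ?thesis using has_derivative_frechet[OF assms] by simp
qed

lemma gradI: "(f has_derivative (\<lambda>h. v \<bullet> h)) (at x) \<Longrightarrow> grad f x = v"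
  by (simp add: grad_def frechet_derivative_eq euclidean_representation)

lemma Ck_field_grad: "Ck_on (Suc k) U f \<Longrightarrow> Ck_field k U (grad f)"
  unfolding Ck_field_def by (auto simp: grad_inner_Basis)

lemma Ck_on_divergence:
  assumes "Ck_field (Suc k) U X" "open U"
  shows "Ck_on k U (divergence X)"
  unfolding divergence_def
  using Ck_field_deriv[OF assms] by (auto simp: Ck_field_def intro!: Ck_on_sum assms)

lemma smooth_on_differentiable: "smooth_on U f \<Longrightarrow> x \<in> U \<Longrightarrow> f differentiable (at x)"
  unfolding smooth_on_def by (metis Ck_on.simps(2))

lemma Ck_field_unit_grad:
  assumes "open U" "Ck_on (Suc k) U f" "\<And>x. x \<in> U \<Longrightarrow> grad f x \<noteq> 0"
  shows "Ck_field k U (unit_grad f)"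
  unfolding unit_grad_def using assms
  by (auto intro!: Ck_field_scaleR Ck_on_inverse Ck_on_norm Ck_field_grad)

lemma Ck_on_weight:
  assumes "open U" "Ck_on (Suc k) U f" "\<And>x. x \<in> U \<Longrightarrow> grad f x \<noteq> 0"
  shows "Ck_on k U (weight f)"
  unfolding weight_def using assms
  by (auto intro!: Ck_on_inverse Ck_on_norm Ck_field_grad)

lemma Ck_on_level_op:
  assumes "open U" "smooth_on U f"
  shows "Ck_on k U (level_op f)"
proof -
  have g: "Ck_field (Suc (Suc k)) U (grad f)" and g': "Ck_field k U (grad f)"
    using assms by (auto intro!: Ck_field_grad simp: smooth_on_def simp del: Ck_on.simps)
  then have "Ck_on k U (\<lambda>x. laplacian f x)"
    unfolding laplacian_def by (intro Ck_on_divergence assms Ck_field_mono[OF g]) auto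
  moreover have "Ck_field k U (grad (\<lambda>y. grad f y \<bullet> grad f y))"
    by (intro Ck_field_grad Ck_on_inner assms Ck_field_mono[OF g]) auto
  ultimately show ?thesis
    unfolding level_op_def power2_norm_eq_inner using assms g'
    by (intro Ck_on_mult Ck_on_inner Ck_on_diff) auto
qed

section \<open>Graph charts\<close>

text \<open>A hypersurface is locally a graph over the hyperplane orthogonal to a direction \<open>e\<close>.  The
  graph is kept in the ambient space, as the zero set of a height function \<open>t\<close> with
  \<open>t (z + s e) = t z + s\<close>, so that functions on it extend to functions on the cylinder \<open>D\<close> that are
  constant along \<open>e\<close>, and no coordinate space of lower dimension is needed.\<close>

locale graph_chart =
  fixes e :: "'a::euclidean_space" and D :: "'a set" and t :: "'a \<Rightarrow> real"
  assumes norm_e: "norm e = 1"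
    and open_D: "open D"
    and shift_D: "\<And>z s. z \<in> D \<Longrightarrow> z + s *\<^sub>R e \<in> D"
    and t_shift: "\<And>z s. z \<in> D \<Longrightarrow> t (z + s *\<^sub>R e) = t z + s"
    and t_smooth: "smooth_on D t"
begin

definition pr :: "'a \<Rightarrow> 'a" where "pr z = z - t z *\<^sub>R e"
definition graph :: "'a set" where "graph = {z \<in> D. t z = 0}"

lemma e_e [simp]: "e \<bullet> e = 1"
  using norm_e by (simp add: dot_square_norm)

lemma pr_in_D: "z \<in> D \<Longrightarrow> pr z \<in> D"
  using shift_D[of z "- t z"] by (simp add: pr_def)

lemma t_pr [simp]: "z \<in> D \<Longrightarrow> t (pr z) = 0"
  using t_shift[of z "- t z"] by (simp add: pr_def)

lemma pr_in_graph: "z \<in> D \<Longrightarrow> pr z \<in> graph"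
  by (simp add: graph_def pr_in_D)

lemma pr_graph [simp]: "z \<in> graph \<Longrightarrow> pr z = z"
  by (simp add: graph_def pr_def)

lemma pr_shift: "z \<in> D \<Longrightarrow> pr (z + s *\<^sub>R e) = pr z"
  by (simp add: pr_def t_shift algebra_simps)

lemma graph_subset: "graph \<subseteq> D"
  by (auto simp: graph_def)

lemma t_differentiable: "z \<in> D \<Longrightarrow> t differentiable (at z)"
  using t_smooth smooth_on_differentiable by blast

lemma t_has_derivative: "z \<in> D \<Longrightarrow> (t has_derivative (\<lambda>h. grad t z \<bullet> h)) (at z)"
  by (rule has_derivative_grad[OF t_differentiable])

lemma Ck_pr: "Ck_field k D pr"
  using t_smooth unfolding pr_def smooth_on_def
  by (auto intro!: Ck_field_diff Ck_field_scaleR Ck_field_id open_D)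

lemma pr_has_derivative: "z \<in> D \<Longrightarrow> (pr has_derivative (\<lambda>h. h - (grad t z \<bullet> h) *\<^sub>R e)) (at z)"
  unfolding pr_def by (auto intro!: derivative_eq_intros t_has_derivative)

text \<open>The constant \<open>c\<close> covers both functions constant along \<open>e\<close> and the height function.\<close>

lemma deriv_shift:
  assumes "z \<in> D" "(f has_derivative F) (at z)" "\<And>z. z \<in> D \<Longrightarrow> f (z + s *\<^sub>R e) = f z + c"
  shows "(f has_derivative F) (at (z + s *\<^sub>R e))"
proof -
  let ?y = "z + s *\<^sub>R e"
  have "((\<lambda>y. y - s *\<^sub>R e) has_derivative (\<lambda>h. h)) (at ?y)" by (auto intro!: derivative_eq_intros)
  moreover have "(f has_derivative F) (at (?y - s *\<^sub>R e))" using assms by simp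
  ultimately have *: "((\<lambda>y. f (y - s *\<^sub>R e) + c) has_derivative F) (at ?y)"
    using diff_chain_at[of "\<lambda>y. y - s *\<^sub>R e" "\<lambda>h. h" ?y f F] by (auto simp: o_def intro!: derivative_eq_intros)
  have "f (y - s *\<^sub>R e) + c = f y" if "y \<in> D" for y
    using assms(3)[of "y - s *\<^sub>R e"] shift_D[OF that, of "- s"] by simp
  then show ?thesis
    by (rule has_derivative_transform_within_open[OF * open_D shift_D[OF assms(1)]])
qed

lemma grad_t_shift: "z \<in> D \<Longrightarrow> grad t (z + s *\<^sub>R e) = grad t z"
  by (rule gradI, rule deriv_shift) (auto intro: t_has_derivative t_shift)

lemma grad_t_pr: "z \<in> D \<Longrightarrow> grad t (pr z) = grad t z"
  using grad_t_shift[of z "- t z"] by (simp add: pr_def)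

lemma deriv_along_e:
  fixes f :: "'a \<Rightarrow> 'b::euclidean_space"
  assumes "z \<in> D" "(f has_derivative F) (at z)" "\<And>s. f (z + s *\<^sub>R e) = f z + s *\<^sub>R c"
  shows "F e = c"
proof -
  have "((\<lambda>s. z + s *\<^sub>R e) has_derivative (\<lambda>s. s *\<^sub>R e)) (at 0)"
    by (auto intro!: derivative_eq_intros)
  then have "((\<lambda>s. f (z + s *\<^sub>R e)) has_derivative (\<lambda>s. F (s *\<^sub>R e))) (at 0)"
    using diff_chain_at[of "\<lambda>s. z + s *\<^sub>R e" "\<lambda>s. s *\<^sub>R e" 0 f F] assms by (simp add: o_def)
  moreover have "((\<lambda>s. f (z + s *\<^sub>R e)) has_derivative (\<lambda>s. s *\<^sub>R c)) (at 0)"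
    unfolding assms(3) by (auto intro!: derivative_eq_intros)
  ultimately have "(\<lambda>s. F (s *\<^sub>R e)) = (\<lambda>s. s *\<^sub>R c)" by (rule has_derivative_unique)
  from fun_cong[OF this, of 1] show ?thesis by simp
qed

lemma grad_t_e [simp]: "z \<in> D \<Longrightarrow> grad t z \<bullet> e = 1"
  using deriv_along_e[OF _ t_has_derivative, of z 1] t_shift by simp

lemma grad_t_nonzero: "z \<in> D \<Longrightarrow> grad t z \<noteq> 0"
  by (metis grad_t_e inner_zero_left zero_neq_one)

end

text \<open>The inverse function theorem is applied to the map that replaces the coordinate along
  \<open>e\<close> by \<open>f\<close>.  The height function is then as smooth as \<open>f\<close> because its gradient is
  \<open>\<nabla>f / \<partial>\<^sub>ef\<close> at the foot point, which lets the order of differentiability be raised step by step.\<close>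

lemma graph_chart_exists:
  fixes f :: "'a::euclidean_space \<Rightarrow> real"
  assumes ld: "local_defining S p W f" and p: "p \<in> S"
  obtains e D t W1 where "graph_chart e D t" "open W1" "p \<in> W1" "W1 \<subseteq> W" "p \<in> graph_chart.graph D t"
    "graph_chart.graph D t = S \<inter> W1" "\<And>y. y \<in> W1 \<Longrightarrow> grad f y \<bullet> e > 0"
    "\<And>z. z \<in> D \<Longrightarrow> grad t z = grad f (graph_chart.pr e t z) /\<^sub>R (grad f (graph_chart.pr e t z) \<bullet> e)"
proof -
  have W: "open W" "p \<in> W" "smooth_on W f" "\<And>y. y \<in> W \<Longrightarrow> grad f y \<noteq> 0" "S \<inter> W = {y\<in>W. f y = 0}"
    using ld by (auto simp: local_defining_def)
  define e where "e = unit_grad f p"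
  have ge: "grad f p \<bullet> e > 0" and norm_e: "norm e = 1"
    using W(2,4) by (auto simp: e_def unit_grad_def dot_square_norm power2_eq_square)
  have e_e: "e \<bullet> e = 1" using norm_e by (simp add: dot_square_norm)
  have cont_grad: "continuous_on W (grad f)"
    using W(3) by (intro Ck_field_continuous[of 0] Ck_field_grad) (simp add: smooth_on_def del: Ck_on.simps)
  have "continuous_on W (\<lambda>y. grad f y \<bullet> e)" using cont_grad by (auto intro!: continuous_intros)
  from continuous_open_preimage[OF this W(1), of "{0<..}"]
  have open_W0: "open {y\<in>W. grad f y \<bullet> e > 0}" by (simp add: vimage_def Int_def)
  define W0 where "W0 = {y\<in>W. grad f y \<bullet> e > 0}"
  have W0: "open W0" "p \<in> W0" "W0 \<subseteq> W"
    using open_W0 W(2) ge by (auto simp: W0_def)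
  have derf: "(f has_derivative (\<lambda>h. grad f y \<bullet> h)) (at y)" if "y \<in> W0" for y
    using that W(3) W0 by (intro has_derivative_grad smooth_on_differentiable[of W]) auto
  define \<Psi> where "\<Psi> z = z + (f z - z \<bullet> e) *\<^sub>R e" for z
  define \<Psi>' where "\<Psi>' x = id_blinfun + (blinfun_scaleR_left e o\<^sub>L blinfun_inner_right (grad f x - e))" for x
  have \<Psi>'_apply: "blinfun_apply (\<Psi>' x) h = h + (grad f x \<bullet> h - e \<bullet> h) *\<^sub>R e" for x h
    by (simp add: \<Psi>'_def blinfun.add_left blinfun.diff_left blinfun_compose.rep_eq inner_diff_left)
  have der\<Psi>: "(\<Psi> has_derivative blinfun_apply (\<Psi>' x)) (at x)" if "x \<in> W0" for x
    unfolding \<Psi>_def \<Psi>'_apply using derf[OF that]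
    by (auto intro!: derivative_eq_intros simp: inner_commute)
  have cont\<Psi>: "continuous_on W0 \<Psi>'"
    unfolding \<Psi>'_def
    using continuous_on_subset[OF cont_grad W0(3)]
    by (intro continuous_intros continuous_on_compose2[OF bounded_linear.continuous_on[OF bounded_linear_blinfun_inner_right continuous_on_id]]
         bounded_linear.continuous_on[OF bounded_linear_blinfun_inner_right]
         bounded_bilinear.continuous_on[OF bounded_bilinear_blinfun_compose]) auto
  define inv\<Psi> where "inv\<Psi> = id_blinfun + (blinfun_scaleR_left e o\<^sub>L blinfun_inner_right ((e - grad f p) /\<^sub>R (grad f p \<bullet> e)))"
  have inv: "inv\<Psi> o\<^sub>L \<Psi>' p = id_blinfun"
  proof (rule blinfun_eqI)
    fix h
    have 0: "(e \<bullet> h - grad f p \<bullet> h) + (grad f p \<bullet> h - e \<bullet> h) * (1 - grad f p \<bullet> e) = (e \<bullet> h - grad f p \<bullet> h) * (grad f p \<bullet> e)"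
      by (simp add: algebra_simps)
    then have "(grad f p \<bullet> h - e \<bullet> h) + inverse (grad f p \<bullet> e) * (e \<bullet> h - grad f p \<bullet> h + (grad f p \<bullet> h - e \<bullet> h) * (1 - grad f p \<bullet> e)) = 0"
      unfolding 0 using ge by (simp only: mult.commute[of "inverse _"] mult.assoc) simp
    then show "blinfun_apply (inv\<Psi> o\<^sub>L \<Psi>' p) h = blinfun_apply id_blinfun h"
      by (simp add: inv\<Psi>_def blinfun.add_left blinfun_compose.rep_eq \<Psi>'_apply inner_diff_left inner_add_right e_e
          flip: scaleR_add_left) (simp add: algebra_simps)
  qed
  obtain W1 V \<Theta> \<Theta>' where *: "open W1" "W1 \<subseteq> W0" "p \<in> W1" "open V" "\<Psi> p \<in> V" "homeomorphism W1 V \<Psi> \<Theta>"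
    "\<And>y. y \<in> V \<Longrightarrow> (\<Theta> has_derivative (\<Theta>' y)) (at y)"
    using inverse_function_theorem[OF W0(1) der\<Psi> cont\<Psi> W0(2) inv] by metis
  define proj where "proj z = z - (z \<bullet> e) *\<^sub>R e" for z
  define D where "D = proj -` V"
  define t where "t z = (z - \<Theta> (proj z)) \<bullet> e" for z
  have proj_lin: "(proj has_derivative proj) (at z)" for z
    unfolding proj_def by (auto intro!: derivative_eq_intros)
  have openD: "open D"
    unfolding D_def using *(4) by (intro open_vimage) (auto simp: proj_def intro!: continuous_intros)
  have proj_shift: "proj (z + s *\<^sub>R e) = proj z" for z s
    by (simp add: proj_def inner_add_left e_e algebra_simps)
  have \<Psi>\<Theta>: "\<Theta> y \<in> W1" "\<Psi> (\<Theta> y) = y" if "y \<in> V" for y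
    using *(6) that by (auto simp: homeomorphism_def)
  have \<Psi>e: "\<Psi> y \<bullet> e = f y" for y by (simp add: \<Psi>_def inner_add_left e_e)
  have proj\<Psi>: "proj (\<Psi> y) = proj y" for y unfolding \<Psi>_def by (rule proj_shift)
  have proje: "proj z \<bullet> e = 0" for z by (simp add: proj_def inner_diff_left e_e)
  \<comment> \<open>\<open>\<Psi>\<close> preserves the component orthogonal to \<open>e\<close>, so the point of the surface below \<open>z\<close> lies on
    the line through \<open>z\<close> in direction \<open>e\<close>.\<close>
  have foot: "\<Theta> (proj z) = z - t z *\<^sub>R e" if "z \<in> D" for z
  proof -
    have "proj (\<Theta> (proj z)) = proj z"
      using \<Psi>\<Theta>[of "proj z"] proj\<Psi>[of "\<Theta> (proj z)"] that proj_shift[of z "- (z \<bullet> e)"]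
      by (auto simp: D_def proj_def)
    then have "\<Theta> (proj z) - (\<Theta> (proj z) \<bullet> e) *\<^sub>R e = z - (z \<bullet> e) *\<^sub>R e" by (simp add: proj_def)
    then show ?thesis by (simp add: t_def inner_diff_left algebra_simps)
  qed
  have foot_in: "z - t z *\<^sub>R e \<in> W1" "f (z - t z *\<^sub>R e) = 0" if "z \<in> D" for z
    using \<Psi>\<Theta>[of "proj z"] that \<Psi>e[of "\<Theta> (proj z)"] proje foot[OF that] by (auto simp: D_def)
  have dert: "(t has_derivative (\<lambda>h. (grad f (z - t z *\<^sub>R e) /\<^sub>R (grad f (z - t z *\<^sub>R e) \<bullet> e)) \<bullet> h)) (at z)"
    if z: "z \<in> D" for z
  proof -
    have "((\<lambda>z. \<Theta> (proj z)) has_derivative (\<lambda>h. \<Theta>' (proj z) (proj h))) (at z)"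
      using diff_chain_at[OF proj_lin *(7)[of "proj z"]] z by (auto simp: D_def o_def)
    then have "(t has_derivative (\<lambda>h. (h - \<Theta>' (proj z) (proj h)) \<bullet> e)) (at z)"
      unfolding t_def by (intro has_derivative_inner_left has_derivative_diff has_derivative_ident)
    then have dift: "t differentiable (at z)" unfolding differentiable_def by blast
    have dt: "(t has_derivative (\<lambda>h. grad t z \<bullet> h)) (at z)"
      by (rule has_derivative_grad[OF dift])
    let ?g = "grad f (z - t z *\<^sub>R e)"
    have "((\<lambda>z. z - t z *\<^sub>R e) has_derivative (\<lambda>h. h - (grad t z \<bullet> h) *\<^sub>R e)) (at z)"
      by (intro has_derivative_diff has_derivative_ident has_derivative_scaleR_left dt)
    then have d1: "((\<lambda>z. f (z - t z *\<^sub>R e)) has_derivative (\<lambda>h. ?g \<bullet> (h - (grad t z \<bullet> h) *\<^sub>R e))) (at z)"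
      by (rule has_derivative_compose[OF _ derf]) (use foot_in(1)[OF z] *(2) in blast)
    have d2: "((\<lambda>z. f (z - t z *\<^sub>R e)) has_derivative (\<lambda>h. 0)) (at z)"
      by (rule has_derivative_transform_within_open[OF has_derivative_const[of 0] openD z]) (simp only: foot_in(2))
    have 0: "?g \<bullet> h = (grad t z \<bullet> h) * (?g \<bullet> e)" for h
      using fun_cong[OF has_derivative_unique[OF d1 d2], of h]
      by (simp only: inner_diff_right inner_scaleR_right right_minus_eq)
    have "?g \<bullet> e > 0" using foot_in(1)[OF z] *(2) by (auto simp: W0_def)
    then have "grad t z \<bullet> h = (?g /\<^sub>R (?g \<bullet> e)) \<bullet> h" for h
      unfolding inner_scaleR_left 0[of h] by simp
    then show ?thesis using dt by simp
  qed
  have Ckt: "Ck_on k D t" for k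
  proof (induction k)
    case 0
    show ?case using dert by (auto intro!: continuous_at_imp_continuous_on has_derivative_continuous)
  next
    case (Suc k)
    have foot_Ck: "Ck_field k D (\<lambda>z. z - t z *\<^sub>R e)"
      using Suc by (intro Ck_field_diff Ck_field_scaleR Ck_field_id openD) auto
    have "Ck_field k W0 (grad f)"
      using W(3) W0(3) by (intro Ck_field_grad) (auto simp: smooth_on_def simp del: Ck_on.simps intro: Ck_on_subset)
    then have g: "Ck_field k D (\<lambda>z. grad f (z - t z *\<^sub>R e))"
      using foot_in(1) *(2) by (intro Ck_field_compose[OF openD W0(1) _ foot_Ck]) auto
    have pos: "grad f (z - t z *\<^sub>R e) \<bullet> e \<noteq> 0" if "z \<in> D" for z
      using foot_in(1)[OF that] *(2) by (auto simp: W0_def)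
    show ?case
    proof (rule Ck_on_SucI[OF dert openD])
      fix b :: 'a
      show "Ck_on k D (\<lambda>z. (grad f (z - t z *\<^sub>R e) /\<^sub>R (grad f (z - t z *\<^sub>R e) \<bullet> e)) \<bullet> b)"
        using pos g by (intro Ck_on_inner Ck_field_scaleR Ck_on_inverse openD) auto
    qed
  qed
  have chart: "graph_chart e D t"
  proof
    show "z + s *\<^sub>R e \<in> D" if "z \<in> D" for z s
      using that by (simp add: D_def proj_shift)
    show "t (z + s *\<^sub>R e) = t z + s" if "z \<in> D" for z s
      by (simp add: t_def proj_shift inner_diff_left inner_add_left e_e)
  qed (use openD norm_e Ckt in \<open>auto simp: smooth_on_def\<close>)
  then interpret graph_chart e D t .
  have graph: "graph = S \<inter> W1"
  proof (intro equalityI subsetI)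
    fix z assume z: "z \<in> graph"
    then show "z \<in> S \<inter> W1" using foot_in[of z] W(5) *(2) W0(3) by (auto simp: graph_def)
  next
    fix y assume y: "y \<in> S \<inter> W1"
    then have "f y = 0" using W(5) *(2) W0(3) by auto
    then have "\<Psi> y = proj y" by (simp add: \<Psi>_def proj_def)
    moreover have "\<Psi> y \<in> V" "\<Theta> (\<Psi> y) = y" using *(6) y by (auto simp: homeomorphism_def)
    ultimately show "y \<in> graph" unfolding graph_def by (simp add: D_def t_def)
  qed
  show ?thesis
  proof (rule that[OF chart *(1,3)])
    show "grad t z = grad f (pr z) /\<^sub>R (grad f (pr z) \<bullet> e)" if "z \<in> D" for z
      using gradI[OF dert[OF that]] by (simp add: pr_def)
  qed (use graph *(1-3) W0 p in \<open>auto simp: W0_def\<close>)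
qed

section \<open>Calculus on a hypersurface in terms of ambient extensions\<close>

text \<open>Moving \<open>p + s v\<close> along \<open>e\<close> back to the graph gives a curve in \<open>S\<close>; its velocity is \<open>v\<close> because \<open>v\<close> is
  orthogonal to the gradient of the height function.\<close>

lemma tangent_curve:
  assumes ld: "local_defining S p W f" and p: "p \<in> S" and v: "grad f p \<bullet> v = 0"
  obtains \<gamma> :: "real \<Rightarrow> 'a::euclidean_space" and T where "open T" "0 \<in> T" "\<gamma> 0 = p" "\<gamma> ` T \<subseteq> S"
    "(\<gamma> has_derivative (\<lambda>s. s *\<^sub>R v)) (at 0)"
proof -
  obtain e D t W1 where c: "graph_chart e D t" "open W1" "p \<in> W1" "W1 \<subseteq> W" "p \<in> graph_chart.graph D t"
    "graph_chart.graph D t = S \<inter> W1" "\<And>y. y \<in> W1 \<Longrightarrow> grad f y \<bullet> e > 0"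
    "\<And>z. z \<in> D \<Longrightarrow> grad t z = grad f (graph_chart.pr e t z) /\<^sub>R (grad f (graph_chart.pr e t z) \<bullet> e)"
    using graph_chart_exists[OF ld p] by metis
  interpret graph_chart e D t by fact
  define T where "T = (\<lambda>s. p + s *\<^sub>R v) -` D"
  have pD: "p \<in> D" using c(5) by (simp add: graph_def)
  have "grad t p \<bullet> v = 0" using c(8)[OF pD] v c(5) by simp
  have "((\<lambda>s. p + s *\<^sub>R v) has_derivative (\<lambda>s. s *\<^sub>R v)) (at 0)"
    by (auto intro!: derivative_eq_intros)
  from has_derivative_compose[OF this, of pr "\<lambda>h. h - (grad t p \<bullet> h) *\<^sub>R e"]
  have "((\<lambda>s. pr (p + s *\<^sub>R v)) has_derivative (\<lambda>s. s *\<^sub>R v)) (at 0)"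
    using pr_has_derivative[OF pD] \<open>grad t p \<bullet> v = 0\<close> by simp
  moreover have "(\<lambda>s. pr (p + s *\<^sub>R v)) ` T \<subseteq> S"
    using pr_in_graph c(6) by (fastforce simp: T_def)
  moreover have "open T" unfolding T_def by (intro open_vimage open_D) (auto intro!: continuous_intros)
  ultimately show ?thesis using that[of T "\<lambda>s. pr (p + s *\<^sub>R v)"] pD c(5) by (auto simp: T_def)
qed

lemma has_derivative_within_agree:
  assumes "(F has_derivative L) (at p)" "open V" "p \<in> V" "p \<in> S" "\<And>y. y \<in> S \<inter> V \<Longrightarrow> u y = F y"
  shows "(u has_derivative L) (at p within S)"
proof -
  obtain d where "d > 0" "ball p d \<subseteq> V" using assms(2,3) open_contains_ball by blast
  then show ?thesis
    using assms(5) by (intro has_derivative_transform_within[OF has_derivative_at_withinI[OF assms(1)] _ assms(4)])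
      (auto simp: dist_commute subset_eq)
qed

text \<open>This makes the derivative within \<open>S\<close>, a choice among many linear maps, well defined after
  composition with the tangential projection.\<close>

lemma derivative_within_surface_unique:
  assumes ld: "local_defining S p W f" "p \<in> S" and v: "grad f p \<bullet> v = 0"
    and A: "(u has_derivative A) (at p within S)" and B: "(u has_derivative B) (at p within S)"
  shows "A v = B v"
proof -
  obtain \<gamma> T where g: "open T" "(0::real) \<in> T" "\<gamma> 0 = p" "\<gamma> ` T \<subseteq> S"
    "(\<gamma> has_derivative (\<lambda>s. s *\<^sub>R v)) (at 0)"
    using tangent_curve[OF ld v] by metis
  have "((\<lambda>s. u (\<gamma> s)) has_derivative (\<lambda>s. L (s *\<^sub>R v))) (at 0)" if "(u has_derivative L) (at p within S)" for L
    using diff_chain_within[OF has_derivative_at_withinI[OF g(5)], of u L T] has_derivative_subset[OF that g(4)]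
      at_within_open[OF g(2,1)] g(3) by (simp add: o_def)
  from has_derivative_unique[OF this[OF A] this[OF B]] show ?thesis
    by (metis scaleR_one)
qed

locale hypersurface_point =
  fixes S :: "'a::euclidean_space set" and p :: 'a and W :: "'a set" and G :: "'a \<Rightarrow> real"
  assumes local_def: "local_defining S p W G" and p_in: "p \<in> S"
begin

lemma open_W: "open W" and p_W: "p \<in> W" and smooth_G: "smooth_on W G"
  and grad_nonzero: "y \<in> W \<Longrightarrow> grad G y \<noteq> 0" and S_W: "y \<in> W \<Longrightarrow> y \<in> S \<longleftrightarrow> G y = 0"
  using local_def by (auto simp: local_defining_def)

lemma at_point: "y \<in> S \<inter> W \<Longrightarrow> hypersurface_point S y W G"
  using local_def by unfold_locales (auto simp: local_defining_def)

abbreviation "\<nu> \<equiv> unit_grad G"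

lemma norm_normal: "y \<in> W \<Longrightarrow> norm (\<nu> y) = 1"
  using grad_nonzero by (simp add: unit_grad_def)

lemma normal_normal [simp]: "y \<in> W \<Longrightarrow> \<nu> y \<bullet> \<nu> y = 1"
  using norm_normal by (simp add: dot_square_norm)

lemma grad_eq_normal: "y \<in> W \<Longrightarrow> grad G y = norm (grad G y) *\<^sub>R \<nu> y"
  using grad_nonzero by (simp add: unit_grad_def)

lemma grad_orth_iff: "y \<in> W \<Longrightarrow> grad G y \<bullet> v = 0 \<longleftrightarrow> \<nu> y \<bullet> v = 0"
  using grad_nonzero by (simp add: unit_grad_def)

lemma Ck_G: "Ck_on k W G"
  using smooth_G by (simp add: smooth_on_def)

lemma Ck_normal: "Ck_field k W \<nu>"
  using grad_nonzero by (intro Ck_field_unit_grad open_W Ck_G)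

lemma normal_differentiable: "y \<in> W \<Longrightarrow> \<nu> differentiable (at y)"
  by (rule Ck_field_differentiable[OF Ck_normal])

lemma normal_deriv_orth: 
  assumes "y \<in> W"
  shows "frechet_derivative \<nu> (at y) h \<bullet> \<nu> y = 0"
proof -
  note d = has_derivative_frechet[OF normal_differentiable[OF assms]]
  have "((\<lambda>y. \<nu> y \<bullet> \<nu> y) has_derivative (\<lambda>h. \<nu> y \<bullet> frechet_derivative \<nu> (at y) h + frechet_derivative \<nu> (at y) h \<bullet> \<nu> y)) (at y)"
    by (intro has_derivative_inner d)
  moreover have "((\<lambda>y. \<nu> y \<bullet> \<nu> y) has_derivative (\<lambda>h. 0)) (at y)"
    by (rule has_derivative_transform_within_open[OF has_derivative_const[of 1] open_W assms]) simp
  ultimately have "(\<lambda>h. \<nu> y \<bullet> frechet_derivative \<nu> (at y) h + frechet_derivative \<nu> (at y) h \<bullet> \<nu> y) = (\<lambda>h. 0)"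
    by (rule has_derivative_unique)
  from fun_cong[OF this, of h] show ?thesis by (simp add: inner_commute)
qed

text \<open>Another defining function vanishes along the curves in \<open>S\<close>, so its gradient is orthogonal to their
  velocities.\<close>

lemma tangent_space_eq: "tangent_space S p = {v. \<nu> p \<bullet> v = 0}"
proof (intro equalityI subsetI CollectI)
  show "\<nu> p \<bullet> v = 0" if "v \<in> tangent_space S p" for v
    using that local_def grad_orth_iff[OF p_W] by (auto simp: tangent_space_def)
  fix v assume "v \<in> {v. \<nu> p \<bullet> v = 0}"
  then have v: "grad G p \<bullet> v = 0" using grad_orth_iff[OF p_W] by auto
  show "v \<in> tangent_space S p" unfolding tangent_space_def
  proof (intro CollectI allI impI)
    fix W' f assume ld: "local_defining S p W' f"
    then have W': "open W'" "p \<in> W'" "smooth_on W' f" "\<And>y. y \<in> W' \<Longrightarrow> y \<in> S \<Longrightarrow> f y = 0"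
      by (auto simp: local_defining_def)
    have "(f has_derivative (\<lambda>h. grad f p \<bullet> h)) (at p within S)"
      by (rule has_derivative_at_withinI[OF has_derivative_grad[OF smooth_on_differentiable[OF W'(3,2)]]])
    moreover have "(f has_derivative (\<lambda>h. 0)) (at p within S)"
      by (rule has_derivative_within_agree[OF has_derivative_const[of 0] W'(1,2) p_in]) (use W'(4) in auto)
    ultimately show "grad f p \<bullet> v = 0"
      by (rule derivative_within_surface_unique[OF local_def p_in v])
  qed
qed

definition P :: "'a \<Rightarrow> 'a \<Rightarrow> 'a" where "P y v = v - (v \<bullet> \<nu> y) *\<^sub>R \<nu> y"

lemma P_orth [simp]: "y \<in> W \<Longrightarrow> P y v \<bullet> \<nu> y = 0" "y \<in> W \<Longrightarrow> \<nu> y \<bullet> P y v = 0"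
  by (auto simp: P_def inner_diff_left inner_diff_right inner_commute)

lemma P_self: "w \<bullet> \<nu> y = 0 \<Longrightarrow> P y w = w"
  by (simp add: P_def)

lemma P_normal [simp]: "y \<in> W \<Longrightarrow> P y (\<nu> y) = 0"
  by (simp add: P_def)

lemma P_inner: "y \<in> W \<Longrightarrow> P y v \<bullet> w = v \<bullet> P y w" "y \<in> W \<Longrightarrow> P y v \<bullet> P y w = v \<bullet> P y w"
  by (auto simp: P_def inner_diff_left inner_diff_right inner_commute)

lemma tangent_proj_eq: "tangent_proj S p v = P p v"
  unfolding tangent_proj_def tangent_space_eq
proof (rule the_equality)
  show "P p v \<in> {v. \<nu> p \<bullet> v = 0} \<and> (\<forall>t\<in>{v. \<nu> p \<bullet> v = 0}. (v - P p v) \<bullet> t = 0)"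
    using p_W by (simp, simp add: P_def)
  fix q assume q: "q \<in> {v. \<nu> p \<bullet> v = 0} \<and> (\<forall>t\<in>{v. \<nu> p \<bullet> v = 0}. (v - q) \<bullet> t = 0)"
  then have 1: "(v - q) \<bullet> (P p v - q) = 0" and 2: "\<nu> p \<bullet> q = 0" using p_W by (auto simp: inner_diff_right)
  have "v - q = (P p v - q) + (v \<bullet> \<nu> p) *\<^sub>R \<nu> p" by (simp add: P_def)
  then have "(v - q) \<bullet> (P p v - q) = (P p v - q) \<bullet> (P p v - q) + (v \<bullet> \<nu> p) * (\<nu> p \<bullet> (P p v - q))"
    by (simp only: inner_add_left inner_scaleR_left)
  with 1 2 have "(P p v - q) \<bullet> (P p v - q) = 0"
    using p_W by (simp add: inner_diff_right[of "\<nu> p"])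
  then show "q = P p v" by simp
qed

text \<open>From here on the operators on \<open>S\<close> can be computed from any extension to the ambient space.\<close>

lemma tangent_deriv_eq:
  assumes "open V" "p \<in> V" "(F has_derivative L) (at p)" "\<And>y. y \<in> S \<inter> V \<Longrightarrow> u y = F y"
  shows "tangent_deriv S u p v = L (P p v)"
proof -
  have "(u has_derivative L) (at p within S)"
    by (rule has_derivative_within_agree[OF assms(3,1,2) p_in assms(4)])
  then have "(u has_derivative frechet_derivative u (at p within S)) (at p within S)" "(u has_derivative L) (at p within S)"
    by (auto simp: frechet_derivative_works[symmetric] differentiable_def)
  then have "frechet_derivative u (at p within S) (P p v) = L (P p v)"
    by (rule derivative_within_surface_unique[OF local_def p_in, rotated 1]) (simp add: grad_orth_iff p_W)
  then show ?thesis by (simp add: tangent_deriv_def tangent_proj_eq)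
qed

lemma surface_grad_eq:
  assumes "open V" "p \<in> V" "F differentiable (at p)" "\<And>y. y \<in> S \<inter> V \<Longrightarrow> u y = F y"
  shows "surface_grad S u p = P p (grad F p)"
proof -
  have "tangent_deriv S u p b = P p (grad F p) \<bullet> b" for b
    using tangent_deriv_eq[OF assms(1,2) has_derivative_grad[OF assms(3)] assms(4)] P_inner[OF p_W] by metis
  then show ?thesis unfolding surface_grad_def by (simp add: euclidean_representation)
qed

text \<open>The trace over the tangent space is the full trace without the normal entry.\<close>

lemma sum_Basis_P:
  assumes "linear L" "y \<in> W"
  shows "(\<Sum>b\<in>Basis. L (P y b) \<bullet> P y b) = (\<Sum>b\<in>Basis. L b \<bullet> b) - L (\<nu> y) \<bullet> \<nu> y"
proof -
  interpret L: linear L by fact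
  have e: "L (P y b) \<bullet> P y b = L b \<bullet> b - (b \<bullet> \<nu> y) * (L (\<nu> y) \<bullet> b) - (b \<bullet> \<nu> y) * (L b \<bullet> \<nu> y)
      + (b \<bullet> \<nu> y) * (b \<bullet> \<nu> y) * (L (\<nu> y) \<bullet> \<nu> y)" for b
    by (simp only: P_def L.diff L.scale inner_diff_left inner_diff_right inner_scaleR_left inner_scaleR_right)
      (simp add: algebra_simps)
  have 1: "(\<Sum>b\<in>Basis. (b \<bullet> \<nu> y) * (L (\<nu> y) \<bullet> b)) = L (\<nu> y) \<bullet> \<nu> y"
    unfolding euclidean_inner[of "L (\<nu> y)" "\<nu> y"] by (intro sum.cong) (auto simp: inner_commute)
  have "L (\<nu> y) = (\<Sum>b\<in>Basis. (\<nu> y \<bullet> b) *\<^sub>R L b)" by (rule linear_Basis_sum[OF assms(1)])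
  also have "\<dots> \<bullet> \<nu> y = (\<Sum>b\<in>Basis. (b \<bullet> \<nu> y) * (L b \<bullet> \<nu> y))"
    unfolding inner_sum_left by (intro sum.cong) (auto simp: inner_commute)
  finally have 2: "(\<Sum>b\<in>Basis. (b \<bullet> \<nu> y) * (L b \<bullet> \<nu> y)) = L (\<nu> y) \<bullet> \<nu> y" by simp
  have "(\<Sum>b\<in>Basis. (b \<bullet> \<nu> y) * (b \<bullet> \<nu> y)) = \<nu> y \<bullet> \<nu> y"
    unfolding euclidean_inner[of "\<nu> y" "\<nu> y"] by (intro sum.cong) (auto simp: inner_commute)
  then have 3: "(\<Sum>b\<in>Basis. (b \<bullet> \<nu> y) * (b \<bullet> \<nu> y) * (L (\<nu> y) \<bullet> \<nu> y)) = L (\<nu> y) \<bullet> \<nu> y"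
    using assms(2) by (simp flip: sum_distrib_right)
  show ?thesis unfolding e by (simp add: sum.distrib sum_subtractf 1 2 3)
qed

lemma surface_div_eq:
  assumes "open V" "p \<in> V" "X differentiable (at p)" "\<And>y. y \<in> S \<inter> V \<Longrightarrow> Y y = X y"
  shows "surface_div S Y p = divergence X p - frechet_derivative X (at p) (\<nu> p) \<bullet> \<nu> p"
proof -
  have "linear (frechet_derivative X (at p))" using assms(3) by (rule linear_frechet_derivative)
  from sum_Basis_P[OF this p_W] show ?thesis
    unfolding surface_div_def divergence_def tangent_proj_eq
    using tangent_deriv_eq[OF assms(1,2) has_derivative_frechet[OF assms(3)] assms(4)] by simp
qed

text \<open>A continuous unit normal field agrees near \<open>p\<close> with \<open>\<nu>\<close> or with \<open>-\<nu>\<close>, because its product with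
  \<open>\<nu>\<close> is continuous with values in \<open>{-1, 1}\<close>.\<close>

lemma second_fundamental_form_eq:
  obtains \<sigma> :: real where "\<sigma> = 1 \<or> \<sigma> = -1"
    "\<And>v w. second_fundamental_form S p v w = \<sigma> * (frechet_derivative \<nu> (at p) (P p v) \<bullet> P p w)"
proof -
  define N where "N = (SOME N. \<exists>V. open V \<and> p \<in> V \<and> unit_normal_field S (S \<inter> V) N)"
  have "unit_normal_field S (S \<inter> W) \<nu>"
    unfolding unit_normal_field_def
  proof (intro conjI ballI)
    show "continuous_on (S \<inter> W) \<nu>"
      using Ck_field_continuous[OF Ck_normal[of 0]] continuous_on_subset by blast
    fix y assume "y \<in> S \<inter> W"
    then interpret y: hypersurface_point S y W G by (rule at_point)
    show "norm (\<nu> y) = 1" by (rule norm_normal[OF y.p_W])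
    show "\<nu> y \<bullet> v = 0" if "v \<in> tangent_space S y" for v using that y.tangent_space_eq by auto
  qed
  then have "\<exists>N V. open V \<and> p \<in> V \<and> unit_normal_field S (S \<inter> V) N" using open_W p_W by blast
  then have "\<exists>V. open V \<and> p \<in> V \<and> unit_normal_field S (S \<inter> V) N"
    unfolding N_def by (rule someI_ex)
  then obtain V where V: "open V" "p \<in> V" "unit_normal_field S (S \<inter> V) N" by blast
  define T where "T = S \<inter> (V \<inter> W)"
  have pT: "p \<in> T" using p_in p_W V by (simp add: T_def)
  have cont: "continuous_on T (\<lambda>y. N y \<bullet> \<nu> y)"
    using V(3) Ck_field_continuous[OF Ck_normal[of 0]] unfolding T_def unit_normal_field_def
    by (auto intro!: continuous_intros elim: continuous_on_subset)
  have N_eq: "N y = (N y \<bullet> \<nu> y) *\<^sub>R \<nu> y" "N y \<bullet> \<nu> y = 1 \<or> N y \<bullet> \<nu> y = -1" if "y \<in> T" for y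
  proof -
    interpret y: hypersurface_point S y W G using that by (auto simp: T_def intro: at_point)
    have N: "norm (N y) = 1" "N y \<bullet> P y v = 0" for v
      using V(3) that y.tangent_space_eq y.p_W by (auto simp: unit_normal_field_def T_def)
    have "P y (N y) \<bullet> P y (N y) = 0" using P_inner(2)[OF y.p_W, of "N y" "N y"] N(2)[of "N y"] by simp
    then show *: "N y = (N y \<bullet> \<nu> y) *\<^sub>R \<nu> y" by (simp add: P_def)
    have "\<bar>N y \<bullet> \<nu> y\<bar> * norm (\<nu> y) = 1" using N(1) * by (metis norm_scaleR)
    then show "N y \<bullet> \<nu> y = 1 \<or> N y \<bullet> \<nu> y = -1" using norm_normal[OF y.p_W] by (simp add: abs_eq_iff')
  qed
  define \<sigma> where "\<sigma> = N p \<bullet> \<nu> p"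
  obtain d where d: "d > 0" "\<And>y. y \<in> T \<Longrightarrow> dist y p < d \<Longrightarrow> dist (N y \<bullet> \<nu> y) (N p \<bullet> \<nu> p) < 1"
    using cont pT unfolding continuous_on_iff by (metis zero_less_one)
  have same: "N y = \<sigma> *\<^sub>R \<nu> y" if "y \<in> S \<inter> (V \<inter> W \<inter> ball p d)" for y
  proof -
    have y: "y \<in> T" "dist y p < d" using that by (auto simp: T_def dist_commute)
    have "N y \<bullet> \<nu> y = \<sigma>" using N_eq(2)[OF y(1)] N_eq(2)[OF pT] d(2)[OF y] by (auto simp: \<sigma>_def dist_real_def)
    then show ?thesis using N_eq(1)[OF y(1)] by simp
  qed
  have "((\<lambda>y. \<sigma> *\<^sub>R \<nu> y) has_derivative (\<lambda>h. \<sigma> *\<^sub>R frechet_derivative \<nu> (at p) h)) (at p)"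
    by (intro has_derivative_scaleR_right has_derivative_frechet normal_differentiable p_W)
  from tangent_deriv_eq[where V = "V \<inter> W \<inter> ball p d" and u = N, OF _ _ this] have "tangent_deriv S N p v = \<sigma> *\<^sub>R frechet_derivative \<nu> (at p) (P p v)" for v
    using V open_W p_W d(1) same by (auto intro!: open_Int)
  then have "second_fundamental_form S p v w = \<sigma> * (frechet_derivative \<nu> (at p) (P p v) \<bullet> P p w)" for v w
    unfolding second_fundamental_form_def N_def[symmetric] tangent_proj_eq by simp
  then show ?thesis using that N_eq(2)[OF pT] \<sigma>_def by blast
qed

lemma linear_normal_deriv: "y \<in> W \<Longrightarrow> linear (frechet_derivative \<nu> (at y))"
  by (rule linear_frechet_derivative[OF normal_differentiable])

text \<open>The normal entry of the trace vanishes as \<open>\<nu>\<close> has constant length.\<close>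

lemma mean_curvature_zero_iff: "mean_curvature S p = 0 \<longleftrightarrow> divergence \<nu> p = 0"
proof -
  obtain \<sigma> :: real where s: "\<sigma> = 1 \<or> \<sigma> = -1"
    "\<And>v w. second_fundamental_form S p v w = \<sigma> * (frechet_derivative \<nu> (at p) (P p v) \<bullet> P p w)"
    using second_fundamental_form_eq by blast
  have "mean_curvature S p = \<sigma> * divergence \<nu> p"
    unfolding mean_curvature_def divergence_def s(2)
    using sum_Basis_P[OF linear_normal_deriv[OF p_W] p_W] normal_deriv_orth[OF p_W]
    by (simp flip: sum_distrib_left)
  then show ?thesis using s(1) by auto
qed

lemma sff_norm_sq_eq:
  "sff_norm_sq S p = (\<Sum>b\<in>Basis. \<Sum>c\<in>Basis. (frechet_derivative \<nu> (at p) (P p b) \<bullet> c)\<^sup>2)"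
proof -
  obtain \<sigma> :: real where s: "\<sigma> = 1 \<or> \<sigma> = -1"
    "\<And>v w. second_fundamental_form S p v w = \<sigma> * (frechet_derivative \<nu> (at p) (P p v) \<bullet> P p w)"
    using second_fundamental_form_eq by blast
  have "(\<sigma> * a)\<^sup>2 = a\<^sup>2" for a using s(1) by auto
  moreover have "frechet_derivative \<nu> (at p) h \<bullet> P p c = frechet_derivative \<nu> (at p) h \<bullet> c" for h c
    using P_inner(1)[OF p_W, of "frechet_derivative \<nu> (at p) h" c] P_self[OF normal_deriv_orth[OF p_W]] by simp
  ultimately show ?thesis unfolding sff_norm_sq_def s(2) by simp
qed

end

section \<open>Hausdorff measure on hyperplanes\<close>

lemma space_hausdorff [simp]: "space (hausdorff_measure n :: 'a::metric_space measure) = UNIV"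
  and sets_hausdorff [simp, measurable_cong]: "sets (hausdorff_measure n :: 'a::metric_space measure) = sets borel"
  unfolding hausdorff_measure_def
  using sets.sigma_sets_eq[of "borel :: 'a measure"] by (auto simp: sets_measure_of space_measure_of_conv)

text \<open>A set function that is not countably additive is turned into the zero measure by \<^const>\<open>measure_of\<close>.
  The integral identities below hold in either case.\<close>

lemma hausdorff_measure_cases:
  obtains (outer) "\<And>A :: 'a::metric_space set. A \<in> sets borel \<Longrightarrow> emeasure (hausdorff_measure n) A = hausdorff_outer n A"
  | (zero) "\<And>A :: 'a::metric_space set. emeasure (hausdorff_measure n) A = 0"
proof -
  have "sigma_sets UNIV (sets borel) = (sets borel :: 'a set set)"
    using sets.sigma_sets_eq[of "borel :: 'a measure"] by simp
  then have "emeasure (hausdorff_measure n) (A :: 'a set) = (if A \<in> sets borel \<and>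
      measure_space UNIV (sets (borel :: 'a measure)) (hausdorff_outer n) then hausdorff_outer n A else 0)" for A
    unfolding hausdorff_measure_def by (simp add: emeasure_measure_of_conv)
  then show ?thesis using that by (cases "measure_space UNIV (sets (borel :: 'a measure)) (hausdorff_outer n)") auto
qed

lemma hausdorff_outer_lipschitz:
  fixes f :: "'a::euclidean_space \<Rightarrow> 'b::euclidean_space"
  assumes L: "L > 0" and lip: "\<And>x y. x \<in> A \<Longrightarrow> y \<in> A \<Longrightarrow> dist (f x) (f y) \<le> L * dist x y"
  shows "hausdorff_outer n (f ` A) \<le> ennreal (L ^ n) * hausdorff_outer n A"
proof -
  let ?c = "ennreal (L ^ n)"
  let ?term = "\<lambda>E. if E = {} then 0 else ennreal (unit_ball_vol (real n) * (diameter E / 2) ^ n)"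
  have content: "hausdorff_content n (L * \<delta>) (f ` A) \<le> ?c * hausdorff_content n \<delta> A" for \<delta>
  proof -
    have "ennreal ((1 / L) ^ n) * hausdorff_content n (L * \<delta>) (f ` A) \<le> hausdorff_content n \<delta> A"
      unfolding hausdorff_content_def[of n \<delta> A]
    proof (rule INF_greatest)
      fix E :: "nat \<Rightarrow> 'a set"
      assume "E \<in> {E. A \<subseteq> (\<Union>i. E i) \<and> (\<forall>i. bounded (E i) \<and> diameter (E i) \<le> \<delta>)}"
      then have E: "A \<subseteq> (\<Union>i. E i)" "\<And>i. bounded (E i)" "\<And>i. diameter (E i) \<le> \<delta>" by auto
      define F where "F i = f ` (A \<inter> E i)" for i
      have dF: "dist (f x) (f y) \<le> L * diameter (E i)" if "x \<in> A \<inter> E i" "y \<in> A \<inter> E i" for x y i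
      proof -
        have "dist (f x) (f y) \<le> L * dist x y" using lip that by auto
        also have "\<dots> \<le> L * diameter (E i)"
          using diameter_bounded_bound[OF E(2)] that L by (intro mult_left_mono) auto
        finally show ?thesis .
      qed
      have diam: "diameter (F i) \<le> L * diameter (E i)" for i
      proof (rule diameter_le)
        show "F i \<noteq> {} \<or> 0 \<le> L * diameter (E i)" using L diameter_ge_0[OF E(2)] by simp
        show "norm (x - y) \<le> L * diameter (E i)" if "x \<in> F i" "y \<in> F i" for x y
          using that dF unfolding F_def dist_norm by blast
      qed
      have bF: "bounded (F i)" for i
      proof (cases "A \<inter> E i = {}")
        case False
        then obtain x where x: "x \<in> A \<inter> E i" by blast
        show ?thesis unfolding bounded_def F_def using dF[OF x] by blast
      qed (simp add: F_def)
      have "hausdorff_content n (L * \<delta>) (f ` A) \<le> (\<Sum>i. ?term (F i))"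
        unfolding hausdorff_content_def
      proof (rule INF_lower, intro CollectI conjI allI)
        show "f ` A \<subseteq> (\<Union>i. F i)" using E(1) unfolding F_def by blast
        show "diameter (F i) \<le> L * \<delta>" for i
          by (rule order_trans[OF diam mult_left_mono[OF E(3)]]) (use L in simp)
      qed (rule bF)
      also have "\<dots> \<le> (\<Sum>i. ?c * ?term (E i))"
      proof (rule suminf_le)
        fix i
        show "?term (F i) \<le> ?c * ?term (E i)"
        proof (cases "F i = {}")
          case False
          then have "E i \<noteq> {}" by (auto simp: F_def)
          have "(diameter (F i) / 2) ^ n \<le> (L * (diameter (E i) / 2)) ^ n"
            using diam[of i] diameter_ge_0[OF bF[of i]] by (intro power_mono) auto
          then have "unit_ball_vol (real n) * (diameter (F i) / 2) ^ n
              \<le> unit_ball_vol (real n) * (L ^ n * (diameter (E i) / 2) ^ n)"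
            unfolding power_mult_distrib by (intro mult_left_mono unit_ball_vol_nonneg) auto
          then have "unit_ball_vol (real n) * (diameter (F i) / 2) ^ n
              \<le> L ^ n * (unit_ball_vol (real n) * (diameter (E i) / 2) ^ n)"
            by (simp only: mult.left_commute)
          then have "ennreal (unit_ball_vol (real n) * (diameter (F i) / 2) ^ n)
              \<le> ennreal (L ^ n * (unit_ball_vol (real n) * (diameter (E i) / 2) ^ n))" by (rule ennreal_leI)
          also have "\<dots> = ?c * ennreal (unit_ball_vol (real n) * (diameter (E i) / 2) ^ n)"
            using L by (intro ennreal_mult') simp
          finally show ?thesis using False \<open>E i \<noteq> {}\<close> by simp
        qed auto
      qed auto
      also have "\<dots> = ?c * (\<Sum>i. ?term (E i))" by (rule ennreal_suminf_cmult)
      finally have "ennreal ((1 / L) ^ n) * hausdorff_content n (L * \<delta>) (f ` A)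
          \<le> ennreal ((1 / L) ^ n) * (?c * (\<Sum>i. ?term (E i)))" by (intro mult_left_mono) auto
      also have "\<dots> = (\<Sum>i. ?term (E i))"
        using L by (simp add: mult.assoc[symmetric] ennreal_mult'[symmetric] power_mult_distrib[symmetric])
      finally show "ennreal ((1 / L) ^ n) * hausdorff_content n (L * \<delta>) (f ` A) \<le> (\<Sum>i. ?term (E i))" .
    qed
    then have "?c * (ennreal ((1 / L) ^ n) * hausdorff_content n (L * \<delta>) (f ` A)) \<le> ?c * hausdorff_content n \<delta> A"
      by (intro mult_left_mono) auto
    then show ?thesis
      using L by (simp add: mult.assoc[symmetric] ennreal_mult'[symmetric] power_mult_distrib[symmetric])
  qed
  show ?thesis unfolding hausdorff_outer_def[of n "f ` A"]
  proof (rule SUP_least)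
    fix \<delta> :: real assume \<delta>: "\<delta> \<in> {0<..}"
    have "hausdorff_content n \<delta> (f ` A) \<le> ?c * hausdorff_content n (\<delta> / L) A"
      using content[of "\<delta> / L"] L by simp
    also have "\<dots> \<le> ?c * hausdorff_outer n A"
      unfolding hausdorff_outer_def using \<delta> L by (intro mult_left_mono SUP_upper) auto
    finally show "hausdorff_content n \<delta> (f ` A) \<le> ?c * hausdorff_outer n A" .
  qed
qed

lemma hausdorff_content_finite_cover:
  fixes A :: "'a::euclidean_space set"
  assumes I: "finite I" "A \<subseteq> (\<Union>i\<in>I. E i)" and d: "0 \<le> d" "d \<le> \<delta>"
    and E: "\<And>i. i \<in> I \<Longrightarrow> bounded (E i)" "\<And>i. i \<in> I \<Longrightarrow> diameter (E i) \<le> d"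
  shows "hausdorff_content n \<delta> A \<le> ennreal (real (card I) * (unit_ball_vol (real n) * (d / 2) ^ n))"
proof -
  let ?term = "\<lambda>E. if E = {} then 0 else ennreal (unit_ball_vol (real n) * (diameter E / 2) ^ n)"
  obtain h where h: "bij_betw h {..<card I} I"
    using ex_bij_betw_nat_finite[OF I(1)] by (auto simp: atLeast0LessThan)
  define F where "F j = (if j < card I then E (h j) else {})" for j
  have hI: "h j \<in> I" if "j < card I" for j using h that by (auto simp: bij_betw_def)
  have "hausdorff_content n \<delta> A \<le> (\<Sum>j. ?term (F j))"
    unfolding hausdorff_content_def
  proof (rule INF_lower, intro CollectI conjI allI)
    show "A \<subseteq> (\<Union>j. F j)"
    proof
      fix x assume "x \<in> A"
      with I(2) have "x \<in> (\<Union>i\<in>I. E i)" by (rule subsetD)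
      then obtain i where i: "i \<in> I" "x \<in> E i" by (rule UN_E)
      have "i \<in> h ` {..<card I}" unfolding bij_betw_imp_surj_on[OF h] by (rule i(1))
      then obtain j where "h j = i" "j < card I" by (auto elim!: imageE)
      then have "x \<in> F j" using i(2) by (simp add: F_def)
      then show "x \<in> (\<Union>j. F j)" by (rule UN_I[OF UNIV_I])
    qed
    show "bounded (F j)" "diameter (F j) \<le> \<delta>" for j
      using E[OF hI[of j]] d by (auto simp: F_def)
  qed
  also have "\<dots> = (\<Sum>j<card I. ?term (F j))"
    by (rule suminf_finite) (auto simp: F_def)
  also have "\<dots> \<le> (\<Sum>j<card I. ennreal (unit_ball_vol (real n) * (d / 2) ^ n))"
  proof (rule sum_mono)
    fix j assume j: "j \<in> {..<card I}"
    show "?term (F j) \<le> ennreal (unit_ball_vol (real n) * (d / 2) ^ n)"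
      using j E[OF hI[of j]] diameter_ge_0[of "E (h j)"]
      by (auto simp: F_def intro!: ennreal_leI mult_left_mono power_mono unit_ball_vol_nonneg)
  qed
  also have "\<dots> = ennreal (real (card I) * (unit_ball_vol (real n) * (d / 2) ^ n))"
    using d unit_ball_vol_nonneg[of "real n"]
    by (simp add: ennreal_mult' ennreal_of_nat_eq_real_of_nat)
  finally show ?thesis .
qed

text \<open>A cube of side \<open>2 R\<close> is cut into \<open>(2 N)\<^sup>n\<close> cubes of side \<open>R / N\<close>, whose diameters are of order
  \<open>1 / N\<close>, so the Hausdorff sums stay bounded as \<open>N\<close> grows.\<close>

lemma hausdorff_outer_coordinate_plane_finite:
  fixes b :: "'a::euclidean_space"
  assumes b: "b \<in> Basis" and n: "n = DIM('a) - 1" and R: "R > 0"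
  shows "hausdorff_outer n ({x. x \<bullet> b = 0} \<inter> cball 0 R) < \<infinity>"
proof -
  let ?B = "Basis - {b} :: 'a set"
  let ?A = "{x. x \<bullet> b = 0} \<inter> cball 0 R"
  let ?M = "unit_ball_vol (real n) * (real n * R) ^ n"
  have cardB: "card ?B = n" using b n by simp
  have bound: "hausdorff_content n \<delta> ?A \<le> ennreal (3 ^ n * ?M)" if \<delta>: "\<delta> > 0" for \<delta>
  proof -
    obtain N :: nat where N: "N > 0" "real n * R / real N \<le> \<delta>"
    proof -
      obtain N :: nat where "real N > real n * R / \<delta> + 1" using reals_Archimedean2 by blast
      moreover have "real n * R / \<delta> \<ge> 0" using R \<delta> by simp
      ultimately have "N > 0" "real n * R / \<delta> \<le> real N" by (auto intro: ccontr)
      then show ?thesis using that[of N] \<open>\<delta> > 0\<close> by (auto simp: field_simps)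
    qed
    \<comment> \<open>The index \<open>2 N\<close> is attained only on the right faces of the cube.\<close>
    define I where "I = (PiE ?B (\<lambda>_. {..<2 * N + 1}))"
    define E where "E k = {x. x \<bullet> b = 0 \<and> (\<forall>i\<in>?B. real (k i) * (R / N) - R \<le> x \<bullet> i \<and> x \<bullet> i \<le> (real (k i) + 1) * (R / N) - R)}"
      for k :: "'a \<Rightarrow> nat"
    have dE: "norm (x - y) \<le> real n * R / N" if "x \<in> E k" "y \<in> E k" for x y k
    proof -
      have "norm (x - y) \<le> (\<Sum>i\<in>Basis. \<bar>(x - y) \<bullet> i\<bar>)" by (rule norm_le_l1)
      also have "\<dots> = \<bar>(x - y) \<bullet> b\<bar> + (\<Sum>i\<in>?B. \<bar>(x - y) \<bullet> i\<bar>)" using b by (simp add: sum.remove)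
      also have "\<dots> \<le> 0 + (\<Sum>i\<in>?B. R / N)"
      proof (intro add_mono sum_mono)
        show "\<bar>(x - y) \<bullet> b\<bar> \<le> 0" using that by (simp add: E_def inner_diff_left)
        fix i assume i: "i \<in> ?B"
        have "x \<bullet> i \<le> (real (k i) + 1) * (R / N) - R" "real (k i) * (R / N) - R \<le> x \<bullet> i"
          "y \<bullet> i \<le> (real (k i) + 1) * (R / N) - R" "real (k i) * (R / N) - R \<le> y \<bullet> i"
          using that i unfolding E_def by blast+
        moreover have "(real (k i) + 1) * (R / N) = real (k i) * (R / N) + R / N" by (simp only: distrib_right mult_1_left)
        ultimately show "\<bar>(x - y) \<bullet> i\<bar> \<le> R / N" unfolding abs_le_iff inner_diff_left by linarith
      qed
      finally show ?thesis using cardB by simp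
    qed
    have "hausdorff_content n \<delta> ?A \<le> ennreal (real (card I) * (unit_ball_vol (real n) * (real n * R / N / 2) ^ n))"
    proof (rule hausdorff_content_finite_cover)
      show "finite I" unfolding I_def by (intro finite_PiE) auto
      show "?A \<subseteq> (\<Union>k\<in>I. E k)"
      proof
        fix x assume x: "x \<in> ?A"
        define k where "k = restrict (\<lambda>i. nat \<lfloor>(x \<bullet> i + R) * N / R\<rfloor>) ?B"
        have xi: "\<bar>x \<bullet> i\<bar> \<le> R" if "i \<in> ?B" for i
          using x Basis_le_norm[of i x] that by auto
        have ki: "real (k i) \<le> (x \<bullet> i + R) * N / R" "(x \<bullet> i + R) * N / R < real (k i) + 1" if "i \<in> ?B" for i
        proof -
          have "0 \<le> (x \<bullet> i + R) * N / R" using xi[OF that] R by (auto simp: abs_le_iff)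
          then have "0 \<le> \<lfloor>(x \<bullet> i + R) * N / R\<rfloor>" by simp
          then have "real (k i) = of_int \<lfloor>(x \<bullet> i + R) * N / R\<rfloor>" using that by (simp add: k_def)
          then show "real (k i) \<le> (x \<bullet> i + R) * N / R" "(x \<bullet> i + R) * N / R < real (k i) + 1" by linarith+
        qed
        have "k \<in> I" unfolding I_def
        proof (rule PiE_I)
          fix i assume i: "i \<in> ?B"
          have "(x \<bullet> i + R) * N / R \<le> (R + R) * N / R"
            using xi[OF i] R by (intro divide_right_mono mult_right_mono) (auto simp: abs_le_iff)
          also have "\<dots> = real (2 * N)" using R by (simp add: field_simps)
          finally have "real (k i) \<le> real (2 * N)" using ki(1)[OF i] by linarith
          then show "k i \<in> {..<2 * N + 1}" by simp
        qed (auto simp: k_def restrict_def)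
        moreover have "x \<in> E k" unfolding E_def
        proof (intro CollectI conjI ballI)
          show "x \<bullet> b = 0" using x by simp
          fix i assume i: "i \<in> ?B"
          show "real (k i) * (R / N) - R \<le> x \<bullet> i" "x \<bullet> i \<le> (real (k i) + 1) * (R / N) - R"
            using ki[OF i] R N(1) by (auto simp: field_simps)
        qed
        ultimately show "x \<in> (\<Union>k\<in>I. E k)" by blast
      qed
      show "0 \<le> real n * R / N" using R by simp
      show "real n * R / N \<le> \<delta>" by (rule N(2))
      show "diameter (E k) \<le> real n * R / N" for k
        using dE R by (intro diameter_le) auto
      show "bounded (E k)" for k
      proof (cases "E k = {}")
        case False
        then obtain x where "x \<in> E k" by blast
        then show ?thesis unfolding bounded_def dist_norm using dE by blast
      qed simp
    qed
    also have "\<dots> \<le> ennreal (3 ^ n * ?M)"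
    proof (rule ennreal_leI)
      have "real (card I) * (real n * R / N / 2) ^ n = ((2 * real N + 1) * (real n * R / N / 2)) ^ n"
      proof -
        have "real (card I) = (2 * real N + 1) ^ n"
          unfolding I_def using cardB by (simp add: card_PiE add.commute)
        then show ?thesis by (simp only: power_mult_distrib)
      qed
      also have "\<dots> \<le> (3 * (real n * R)) ^ n"
      proof (rule power_mono)
        have "(2 * real N + 1) * (real n * R / N / 2) = real n * R * ((2 * real N + 1) / (2 * N))" by (simp add: mult_ac)
        also have "\<dots> \<le> real n * R * 3" using N(1) R by (intro mult_left_mono) (auto simp: field_simps)
        finally show "(2 * real N + 1) * (real n * R / N / 2) \<le> 3 * (real n * R)" by simp
      qed (use R in simp)
      finally show "real (card I) * (unit_ball_vol (real n) * (real n * R / N / 2) ^ n) \<le> 3 ^ n * ?M"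
        using mult_left_mono[of "real (card I) * (real n * R / N / 2) ^ n" "(3 * (real n * R)) ^ n" "unit_ball_vol (real n)"]
          unit_ball_vol_nonneg[of "real n"] by (simp add: power_mult_distrib mult_ac)
    qed
    finally show ?thesis .
  qed
  have "hausdorff_outer n ?A \<le> ennreal (3 ^ n * ?M)"
    unfolding hausdorff_outer_def using bound by (intro SUP_least) auto
  then show ?thesis by (metis ennreal_less_top infinity_ennreal_def order.strict_trans1)
qed


text \<open>The reflection that exchanges two vectors of equal length.  For \<open>v = v'\<close> it is the identity, as
  division by zero yields zero.\<close>

definition reflect :: "'a::euclidean_space \<Rightarrow> 'a \<Rightarrow> 'a \<Rightarrow> 'a" where
  "reflect v v' z = z - (2 * (z \<bullet> (v - v')) / ((v - v') \<bullet> (v - v'))) *\<^sub>R (v - v')"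

lemma reflect_diff: "reflect v v' (x - y) = reflect v v' x - reflect v v' y"
  unfolding reflect_def inner_diff_left[of x y "v - v'"]
  by (simp only: right_diff_distrib diff_divide_distrib scaleR_diff_left) simp

lemma reflect_scale: "reflect v v' (c *\<^sub>R x) = c *\<^sub>R reflect v v' x"
  by (simp add: reflect_def algebra_simps)

lemma reflect_inner: "reflect v v' x \<bullet> reflect v v' y = x \<bullet> y"
proof (cases "v = v'")
  case False
  define u where "u = v - v'"
  have "u \<bullet> u \<noteq> 0" using False by (simp add: u_def)
  then show ?thesis unfolding reflect_def u_def[symmetric]
    by (simp add: inner_diff_left inner_diff_right inner_commute field_simps)
qed (simp add: reflect_def)

lemma norm_reflect: "norm (reflect v v' x) = norm x"
  by (simp add: norm_eq_sqrt_inner reflect_inner)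

lemma reflect_reflect: "reflect v v' (reflect v v' x) = x"
proof (cases "v = v'")
  case False
  define u where "u = v - v'"
  have u: "u \<bullet> u \<noteq> 0" using False by (simp add: u_def)
  define c where "c = 2 * (x \<bullet> u) / (u \<bullet> u)"
  have "2 * ((x - c *\<^sub>R u) \<bullet> u) / (u \<bullet> u) = - c"
    using u by (simp add: c_def inner_diff_left field_simps)
  then show ?thesis unfolding reflect_def u_def[symmetric] c_def[symmetric] by simp
qed (simp add: reflect_def)

lemma reflect_swap:
  assumes "norm v = norm v'"
  shows "reflect v v' v = v'"
proof (cases "v = v'")
  case False
  have "v \<bullet> v = v' \<bullet> v'" using assms by (simp add: dot_square_norm)
  then have "(v - v') \<bullet> (v - v') = 2 * (v \<bullet> (v - v'))"
    by (simp add: inner_diff_left inner_diff_right inner_commute)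
  moreover have "(v - v') \<bullet> (v - v') \<noteq> 0" using False by simp
  ultimately show ?thesis by (simp add: reflect_def)
qed (simp add: reflect_def)

lemma reflect_mem_plane:
  assumes "norm v = norm v'"
  shows "reflect v v' x \<bullet> v' = x \<bullet> v"
  using reflect_inner[of v v' x v] reflect_swap[OF assms] by simp

lemma hausdorff_outer_isometry:
  fixes f g :: "'a::euclidean_space \<Rightarrow> 'a"
  assumes iso: "\<And>x y. dist (f x) (f y) = dist x y" and fg: "\<And>x. f (g x) = x"
  shows "hausdorff_outer n (f -` A) = hausdorff_outer n A"
proof (rule antisym)
  have gf: "g (f x) = x" for x
    using iso[of "g (f x)" x] fg by simp
  have "dist (g x) (g y) = dist x y" for x y using iso[of "g x" "g y"] fg by simp
  moreover have "f -` A = g ` A" using fg gf by (auto simp: image_iff) metis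
  ultimately show "hausdorff_outer n (f -` A) \<le> hausdorff_outer n A"
    using hausdorff_outer_lipschitz[of 1 A g n] by simp
  have "A = f ` (f -` A)" using fg by (metis image_vimage_eq inf_top.right_neutral surjI)
  then show "hausdorff_outer n A \<le> hausdorff_outer n (f -` A)"
    using hausdorff_outer_lipschitz[of 1 "f -` A" f n] iso by simp
qed

lemma hausdorff_outer_mono: "A \<subseteq> B \<Longrightarrow> hausdorff_outer n A \<le> hausdorff_outer n B"
  unfolding hausdorff_outer_def hausdorff_content_def
  by (intro SUP_mono' INF_superset_mono) auto

text \<open>A reflection carries the hyperplane to a coordinate hyperplane.\<close>

lemma hausdorff_outer_plane_finite:
  fixes v :: "'a::euclidean_space"
  assumes v: "norm v = 1" and n: "n = DIM('a) - 1"
  shows "hausdorff_outer n ({x. x \<bullet> v = 0} \<inter> cball 0 R) < \<infinity>"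
proof -
  obtain b :: 'a where b: "b \<in> Basis" by (meson ex_in_conv nonempty_Basis)
  have nb: "norm v = norm b" "norm b = norm v" using v b by simp_all
  have *: "{x. x \<bullet> v = 0} \<inter> cball 0 (max R 1) = reflect v b -` ({x. x \<bullet> b = 0} \<inter> cball 0 (max R 1))"
    using reflect_mem_plane[OF nb(1)] by (auto simp: norm_reflect)
  have "hausdorff_outer n ({x. x \<bullet> v = 0} \<inter> cball 0 (max R 1)) = hausdorff_outer n ({x. x \<bullet> b = 0} \<inter> cball 0 (max R 1))"
    unfolding * by (rule hausdorff_outer_isometry[where g = "reflect v b"])
      (simp_all add: dist_norm reflect_diff[symmetric] norm_reflect reflect_reflect)
  then have "hausdorff_outer n ({x. x \<bullet> v = 0} \<inter> cball 0 (max R 1)) < \<infinity>"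
    using hausdorff_outer_coordinate_plane_finite[OF b n, of "max R 1"] by simp
  moreover have "hausdorff_outer n ({x. x \<bullet> v = 0} \<inter> cball 0 R) \<le> hausdorff_outer n ({x. x \<bullet> v = 0} \<inter> cball 0 (max R 1))"
    by (rule hausdorff_outer_mono) auto
  ultimately show ?thesis by (rule order.strict_trans1[rotated])
qed

lemma nn_integral_lborel_translation:
  fixes f :: "'a::euclidean_space \<Rightarrow> ennreal"
  assumes [measurable]: "f \<in> borel_measurable borel"
  shows "(\<integral>\<^sup>+y. f (y + c) \<partial>lborel) = (\<integral>\<^sup>+y. f y \<partial>lborel)"
proof -
  have "(\<integral>\<^sup>+y. f y \<partial>distr lborel borel ((+) c)) = (\<integral>\<^sup>+y. f (c + y) \<partial>lborel)"
    by (rule nn_integral_distr) auto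
  then show ?thesis by (simp add: lborel_distr_plus add.commute)
qed

text \<open>The volume of a slab over a cylinder does not depend on the section from which the slab is
  erected: both sides are the integral over \<open>Z \<times> \<real>\<close> of \<open>\<phi> (t z) * \<phi>' (t' z + s)\<close>, read along \<open>s\<close> or
  along the translates of \<open>z\<close>.\<close>

lemma cylinder_section_independent:
  fixes Z :: "'a::euclidean_space set" and t t' :: "'a \<Rightarrow> real" and \<phi> \<phi>' :: "real \<Rightarrow> ennreal"
  assumes [measurable]: "Z \<in> sets borel" "t \<in> borel_measurable borel" "t' \<in> borel_measurable borel"
      "\<phi> \<in> borel_measurable borel" "\<phi>' \<in> borel_measurable borel"
    and Z: "\<And>z s. z + s *\<^sub>R e \<in> Z \<longleftrightarrow> z \<in> Z"
    and t: "\<And>z s. z \<in> Z \<Longrightarrow> t (z + s *\<^sub>R e) = t z + s" and t': "\<And>z s. z \<in> Z \<Longrightarrow> t' (z + s *\<^sub>R e) = t' z + s"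
  shows "(\<integral>\<^sup>+z. indicator Z z * \<phi> (t z) \<partial>lborel) * (\<integral>\<^sup>+s. \<phi>' s \<partial>lborel)
       = (\<integral>\<^sup>+z. indicator Z z * \<phi>' (t' z) \<partial>lborel) * (\<integral>\<^sup>+s. \<phi> s \<partial>lborel)"
proof -
  have "(\<integral>\<^sup>+z. indicator Z z * \<phi> (t z) \<partial>lborel) * (\<integral>\<^sup>+s. \<phi>' s \<partial>lborel)
      = (\<integral>\<^sup>+z. indicator Z z * \<phi> (t z) * (\<integral>\<^sup>+s. \<phi>' s \<partial>lborel) \<partial>lborel)"
    by (rule nn_integral_multc[symmetric]) measurable
  also have "\<dots> = (\<integral>\<^sup>+z. \<integral>\<^sup>+s. indicator Z z * \<phi> (t z) * \<phi>' (s + t' z) \<partial>lborel \<partial>lborel)"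
    by (subst nn_integral_cmult) (auto simp: nn_integral_lborel_translation)
  also have "\<dots> = (\<integral>\<^sup>+s. \<integral>\<^sup>+z. indicator Z z * \<phi> (t z) * \<phi>' (s + t' z) \<partial>lborel \<partial>lborel)"
    by (rule lborel_pair.Fubini') measurable
  also have "\<dots> = (\<integral>\<^sup>+s. \<integral>\<^sup>+z. indicator Z z * \<phi>' (t' z) * \<phi> (t z - s) \<partial>lborel \<partial>lborel)"
  proof (rule nn_integral_cong)
    fix s
    have "(\<integral>\<^sup>+z. indicator Z z * \<phi> (t z) * \<phi>' (s + t' z) \<partial>lborel)
        = (\<integral>\<^sup>+z. indicator Z (z + (-s) *\<^sub>R e) * \<phi> (t (z + (-s) *\<^sub>R e)) * \<phi>' (s + t' (z + (-s) *\<^sub>R e)) \<partial>lborel)"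
      by (rule nn_integral_lborel_translation[symmetric]) measurable
    also have "\<dots> = (\<integral>\<^sup>+z. indicator Z z * \<phi>' (t' z) * \<phi> (t z - s) \<partial>lborel)"
    proof (rule nn_integral_cong)
      fix z show "indicator Z (z + (-s) *\<^sub>R e) * \<phi> (t (z + (-s) *\<^sub>R e)) * \<phi>' (s + t' (z + (-s) *\<^sub>R e))
          = indicator Z z * \<phi>' (t' z) * \<phi> (t z - s)"
        using Z[of z "-s"] t[of z "-s"] t'[of z "-s"] by (cases "z \<in> Z") (simp_all add: mult_ac)
    qed
    finally show "(\<integral>\<^sup>+z. indicator Z z * \<phi> (t z) * \<phi>' (s + t' z) \<partial>lborel)
        = (\<integral>\<^sup>+z. indicator Z z * \<phi>' (t' z) * \<phi> (t z - s) \<partial>lborel)" .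
  qed
  also have "\<dots> = (\<integral>\<^sup>+z. \<integral>\<^sup>+s. indicator Z z * \<phi>' (t' z) * \<phi> (t z - s) \<partial>lborel \<partial>lborel)"
    by (rule lborel_pair.Fubini') measurable
  also have "\<dots> = (\<integral>\<^sup>+z. indicator Z z * \<phi>' (t' z) * (\<integral>\<^sup>+s. \<phi> s \<partial>lborel) \<partial>lborel)"
  proof (rule nn_integral_cong)
    fix z
    have "(\<integral>\<^sup>+s. \<phi> (t z - s) \<partial>lborel) = (\<integral>\<^sup>+s. \<phi> s \<partial>lborel)"
      using nn_integral_real_affine[of \<phi> "-1" "t z"] by simp
    then show "(\<integral>\<^sup>+s. indicator Z z * \<phi>' (t' z) * \<phi> (t z - s) \<partial>lborel)
        = indicator Z z * \<phi>' (t' z) * (\<integral>\<^sup>+s. \<phi> s \<partial>lborel)"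
      by (subst nn_integral_cmult) auto
  qed
  also have "\<dots> = (\<integral>\<^sup>+z. indicator Z z * \<phi>' (t' z) \<partial>lborel) * (\<integral>\<^sup>+s. \<phi> s \<partial>lborel)"
    by (rule nn_integral_multc) measurable
  finally show ?thesis .
qed

section \<open>The area formula for graphs\<close>

text \<open>The part of the hyperplane orthogonal to \<open>v\<close> within the unit ball about \<open>\<sigma> v\<close>; its Hausdorff measure
  is the profile with which the hyperplane is thickened.\<close>

definition slice :: "'a::euclidean_space \<Rightarrow> real \<Rightarrow> 'a set" where
  "slice v \<sigma> = {x. x \<bullet> v = 0 \<and> norm (\<sigma> *\<^sub>R v - x) < 1}"

lemma slice_borel [measurable]: "slice v \<sigma> \<in> sets borel"
proof -
  have "slice v \<sigma> = {x. x \<bullet> v = 0} \<inter> {x. norm (\<sigma> *\<^sub>R v - x) < 1}" by (auto simp: slice_def)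
  moreover have "closed {x. x \<bullet> v = 0}" by (intro closed_Collect_eq continuous_intros)
  moreover have "open {x. norm (\<sigma> *\<^sub>R v - x) < 1}" by (intro open_Collect_less continuous_intros)
  ultimately show ?thesis by auto
qed

lemma hausdorff_slice_eq:
  fixes v v' :: "'a::euclidean_space"
  assumes v: "norm v = norm v'"
  shows "hausdorff_outer n (slice v \<sigma>) = hausdorff_outer n (slice v' \<sigma>)"
proof -
  have "norm (\<sigma> *\<^sub>R v' - reflect v v' x) = norm (\<sigma> *\<^sub>R v - x)" for x
    using norm_reflect[of v v' "\<sigma> *\<^sub>R v - x"] by (simp add: reflect_diff reflect_scale reflect_swap[OF v])
  then have "slice v \<sigma> = reflect v v' -` slice v' \<sigma>"
    using reflect_mem_plane[OF v] by (auto simp: slice_def)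
  then show ?thesis
    using hausdorff_outer_isometry[of "reflect v v'" "reflect v v'" n]
    by (simp add: dist_norm reflect_diff[symmetric] norm_reflect reflect_reflect)
qed

text \<open>Restricted to a hyperplane, the Hausdorff measure is invariant under the translations of the
  hyperplane.  As in the proof that Haar measure is unique, integrating \<open>1\<^sub>Z (x) * 1\<^sub>B (y - x)\<close> over \<open>x\<close> in
  the hyperplane and \<open>y\<close> in space, and shifting \<open>x\<close> by the projection of \<open>y\<close>, turns Hausdorff measure
  into Lebesgue measure up to a factor that a rotation shows to be the same for all hyperplanes.\<close>

lemma hausdorff_hyperplane_section:
  fixes v e :: "'a::euclidean_space" and Z :: "'a set"
  assumes outer: "\<And>A :: 'a set. A \<in> sets borel \<Longrightarrow> emeasure (hausdorff_measure n) A = hausdorff_outer n A"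
    and n: "n = DIM('a) - 1" and v: "norm v = 1" and c: "e \<bullet> v \<noteq> 0"
    and Z_borel [measurable]: "Z \<in> sets borel" and Z: "\<And>z s. z + s *\<^sub>R e \<in> Z \<longleftrightarrow> z \<in> Z"
  shows "emeasure lborel (ball 0 1 :: 'a set) * emeasure (hausdorff_measure n) (Z \<inter> {x. x \<bullet> v = 0})
       = (\<integral>\<^sup>+y. indicator Z y * hausdorff_outer n (slice v (y \<bullet> v)) \<partial>lborel)"
    and "(\<lambda>\<sigma>. hausdorff_outer n (slice v \<sigma>)) \<in> borel_measurable borel"
proof -
  let ?H = "hausdorff_measure n :: 'a measure"
  let ?B = "ball 0 1 :: 'a set"
  define \<beta> :: "'a \<Rightarrow> ennreal" where "\<beta> = indicator ?B"
  have ind [measurable]: "\<beta> \<in> borel_measurable borel"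
    unfolding \<beta>_def by (intro borel_measurable_indicator borel_open open_ball)
  define T where "T = {x. x \<bullet> v = 0}"
  have T_borel [measurable]: "T \<in> sets borel"
    unfolding T_def by (intro borel_closed closed_Collect_eq continuous_intros)
  define M where "M = density ?H (indicator T)"
  have sets_M [measurable_cong]: "sets M = sets borel" and space_M [simp]: "space M = UNIV"
    by (auto simp: M_def)
  have emeasure_M: "emeasure M A = emeasure ?H (A \<inter> T)" if "A \<in> sets borel" for A
  proof -
    have "emeasure M A = (\<integral>\<^sup>+x. indicator T x * indicator A x \<partial>?H)"
      unfolding M_def using that by (intro emeasure_density) auto
    also have "\<dots> = (\<integral>\<^sup>+x. indicator (A \<inter> T) x \<partial>?H)"
      by (intro nn_integral_cong) (auto simp: indicator_def)
    also have "\<dots> = emeasure ?H (A \<inter> T)"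
      using that by (intro nn_integral_indicator) auto
    finally show ?thesis .
  qed
  have AE_M: "AE x in M. x \<in> T"
    unfolding M_def by (subst AE_density) (auto simp: indicator_def)
  interpret M: sigma_finite_measure M
  proof
    show "\<exists>A. countable A \<and> A \<subseteq> sets M \<and> \<Union> A = space M \<and> (\<forall>a\<in>A. emeasure M a \<noteq> \<infinity>)"
    proof (intro exI[of _ "range (\<lambda>m::nat. cball 0 (real m))"] conjI ballI)
      show "\<Union> (range (\<lambda>m::nat. cball 0 (real m))) = space M"
        by (auto simp: real_arch_simple)
      fix a assume "a \<in> range (\<lambda>m::nat. cball (0::'a) (real m))"
      then obtain m :: nat where "a = cball 0 (real m)" by blast
      then show "emeasure M a \<noteq> \<infinity>"
        using hausdorff_outer_plane_finite[OF v n, of m]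
        by (simp add: emeasure_M outer T_def Int_commute)
    qed (auto simp: sets_M)
  qed
  interpret P: pair_sigma_finite lborel M ..
  have M_shift: "(\<integral>\<^sup>+x. f (x + \<tau>) \<partial>M) = (\<integral>\<^sup>+x. f x \<partial>M)"
    if f [measurable]: "f \<in> borel_measurable borel" and \<tau>: "\<tau> \<in> T" for f :: "'a \<Rightarrow> ennreal" and \<tau>
  proof -
    have "distr M borel (\<lambda>x. x + \<tau>) = M"
    proof (rule measure_eqI)
      fix A assume "A \<in> sets (distr M borel (\<lambda>x. x + \<tau>))"
      then have A [measurable]: "A \<in> sets borel" by simp
      have T_shift: "(\<lambda>x. x + \<tau>) -` A \<inter> T = (\<lambda>x. x + \<tau>) -` (A \<inter> T)"
        using \<tau> by (auto simp: T_def inner_add_left)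
      have A': "(\<lambda>x. x + \<tau>) -` A \<in> sets borel" "(\<lambda>x. x + \<tau>) -` (A \<inter> T) \<in> sets borel"
        using measurable_sets[of "\<lambda>x. x + \<tau>" "borel :: 'a measure" borel] A by auto
      have "emeasure (distr M borel (\<lambda>x. x + \<tau>)) A = emeasure M ((\<lambda>x. x + \<tau>) -` A)"
        by (simp add: emeasure_distr)
      also have "\<dots> = hausdorff_outer n ((\<lambda>x. x + \<tau>) -` (A \<inter> T))"
        using A' by (simp add: emeasure_M T_shift outer)
      also have "\<dots> = hausdorff_outer n (A \<inter> T)"
        by (rule hausdorff_outer_isometry[where g = "\<lambda>x. x - \<tau>"]) (simp_all add: dist_norm)
      also have "\<dots> = emeasure M A" by (simp add: emeasure_M outer)
      finally show "emeasure (distr M borel (\<lambda>x. x + \<tau>)) A = emeasure M A" .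
    qed (simp add: sets_M)
    then have "(\<integral>\<^sup>+x. f x \<partial>M) = (\<integral>\<^sup>+x. f x \<partial>distr M borel (\<lambda>x. x + \<tau>))" by simp
    also have "\<dots> = (\<integral>\<^sup>+x. f (x + \<tau>) \<partial>M)" by (rule nn_integral_distr) measurable
    finally show ?thesis by simp
  qed
  \<comment> \<open>\<open>P\<close> projects onto the hyperplane along \<open>e\<close>, which keeps \<open>Z\<close> invariant.\<close>
  define s where "s y = y \<bullet> v / (e \<bullet> v)" for y
  define P where "P y = y - s y *\<^sub>R e" for y
  have [measurable]: "s \<in> borel_measurable borel" "P \<in> borel_measurable borel"
    unfolding P_def s_def by (intro borel_measurable_continuous_onI continuous_intros; simp add: c)+
  have P_T: "P y \<in> T" for y using c by (simp add: T_def P_def s_def inner_diff_left)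
  have P_Z: "P y \<in> Z \<longleftrightarrow> y \<in> Z" for y using Z[of y "- s y"] by (simp add: P_def)
  have shift_T: "s (y + x) = s y" "P (y + x) = P y + x" if "x \<in> T" for x y
    using that by (simp_all add: T_def s_def P_def inner_add_left)
  have slice_M: "(\<integral>\<^sup>+x. \<beta> (s y *\<^sub>R e - x) \<partial>M) = hausdorff_outer n (slice v (y \<bullet> v))" for y
  proof -
    define \<tau> where "\<tau> = s y *\<^sub>R e - (y \<bullet> v) *\<^sub>R v"
    have \<tau>: "\<tau> \<in> T" using v c by (simp add: \<tau>_def T_def s_def inner_diff_left dot_square_norm)
    have "(\<integral>\<^sup>+x. \<beta> (s y *\<^sub>R e - x) \<partial>M) = (\<integral>\<^sup>+x. \<beta> (s y *\<^sub>R e - (x + \<tau>)) \<partial>M)"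
      by (rule M_shift[symmetric, OF _ \<tau>])
        (rule measurable_compose[OF _ ind], measurable)
    also have "\<dots> = (\<integral>\<^sup>+x. indicator {x. norm ((y \<bullet> v) *\<^sub>R v - x) < 1} x \<partial>M)"
      by (intro nn_integral_cong) (simp add: \<tau>_def \<beta>_def indicator_def dist_norm norm_minus_commute algebra_simps)
    also have "\<dots> = emeasure M {x. norm ((y \<bullet> v) *\<^sub>R v - x) < 1}"
      by (intro nn_integral_indicator) (simp add: sets_M)
    also have "\<dots> = emeasure ?H (slice v (y \<bullet> v))"
      by (subst emeasure_M) (auto intro!: arg_cong2[where f = emeasure] simp: slice_def T_def)
    finally show ?thesis by (simp add: outer)
  qed
  have vol: "(\<integral>\<^sup>+y. \<beta> (y - x) \<partial>lborel) = emeasure lborel ?B" for x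
    using nn_integral_lborel_translation[OF ind, of "- x"] by (simp add: \<beta>_def)
  have "emeasure lborel ?B * emeasure ?H (Z \<inter> T) = (\<integral>\<^sup>+x. indicator Z x * emeasure lborel ?B \<partial>M)"
    by (subst nn_integral_multc) (auto simp: emeasure_M mult.commute)
  also have "\<dots> = (\<integral>\<^sup>+x. \<integral>\<^sup>+y. indicator Z x * \<beta> (y - x) \<partial>lborel \<partial>M)"
  proof (rule nn_integral_cong)
    fix x
    have "(\<lambda>y. \<beta> (y - x)) \<in> borel_measurable borel"
      by (rule measurable_compose[OF _ ind]) measurable
    then show "indicator Z x * emeasure lborel ?B = (\<integral>\<^sup>+y. indicator Z x * \<beta> (y - x) \<partial>lborel)"
      by (subst nn_integral_cmult) (auto simp: vol)
  qed
  also have "\<dots> = (\<integral>\<^sup>+y. \<integral>\<^sup>+x. indicator Z x * \<beta> (y - x) \<partial>M \<partial>lborel)"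
    by (rule P.Fubini') measurable
  also have "\<dots> = (\<integral>\<^sup>+y. \<integral>\<^sup>+x. indicator Z (x + P y) * \<beta> (y - (x + P y)) \<partial>M \<partial>lborel)"
    by (intro nn_integral_cong M_shift[symmetric] P_T) measurable
  also have "\<dots> = (\<integral>\<^sup>+x. \<integral>\<^sup>+y. indicator Z (x + P y) * \<beta> (y - (x + P y)) \<partial>lborel \<partial>M)"
    by (rule P.Fubini'[symmetric]) measurable
  also have "\<dots> = (\<integral>\<^sup>+x. \<integral>\<^sup>+y. indicator Z y * \<beta> (s y *\<^sub>R e - x) \<partial>lborel \<partial>M)"
  proof (rule nn_integral_cong_AE, rule AE_mp[OF AE_M], rule AE_I2, rule impI)
    fix x assume x: "x \<in> T"
    then have x': "- x \<in> T" by (simp add: T_def)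
    have "(\<integral>\<^sup>+y. indicator Z (x + P y) * \<beta> (y - (x + P y)) \<partial>lborel)
        = (\<integral>\<^sup>+y. indicator Z (x + P (y + - x)) * \<beta> ((y + - x) - (x + P (y + - x))) \<partial>lborel)"
      by (rule nn_integral_lborel_translation[symmetric]) measurable
    also have "\<dots> = (\<integral>\<^sup>+y. indicator Z y * \<beta> (s y *\<^sub>R e - x) \<partial>lborel)"
    proof (rule nn_integral_cong)
      fix y
      have a: "(y + - x) - (x + P (y + - x)) = s y *\<^sub>R e - x"
        unfolding shift_T(2)[OF x'] by (simp add: P_def)
      have b: "x + P (y + - x) = P y" unfolding shift_T(2)[OF x'] by simp
      show "indicator Z (x + P (y + - x)) * \<beta> ((y + - x) - (x + P (y + - x)))
          = (indicator Z y * \<beta> (s y *\<^sub>R e - x) :: ennreal)"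
        unfolding a unfolding b using P_Z[of y] by (simp add: indicator_def)
    qed
    finally show "(\<integral>\<^sup>+y. indicator Z (x + P y) * \<beta> (y - (x + P y)) \<partial>lborel)
        = (\<integral>\<^sup>+y. indicator Z y * \<beta> (s y *\<^sub>R e - x) \<partial>lborel)" .
  qed
  also have "\<dots> = (\<integral>\<^sup>+y. \<integral>\<^sup>+x. indicator Z y * \<beta> (s y *\<^sub>R e - x) \<partial>M \<partial>lborel)"
    by (rule P.Fubini') measurable
  also have "\<dots> = (\<integral>\<^sup>+y. indicator Z y * hausdorff_outer n (slice v (y \<bullet> v)) \<partial>lborel)"
  proof (rule nn_integral_cong)
    fix y
    have "(\<lambda>x. \<beta> (s y *\<^sub>R e - x)) \<in> borel_measurable borel"
      by (rule measurable_compose[OF _ ind]) measurable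
    then show "(\<integral>\<^sup>+x. indicator Z y * \<beta> (s y *\<^sub>R e - x) \<partial>M)
        = indicator Z y * hausdorff_outer n (slice v (y \<bullet> v))"
      by (subst nn_integral_cmult) (auto simp: slice_M)
  qed
  finally show "emeasure lborel ?B * emeasure ?H (Z \<inter> {x. x \<bullet> v = 0})
      = (\<integral>\<^sup>+y. indicator Z y * hausdorff_outer n (slice v (y \<bullet> v)) \<partial>lborel)"
    by (simp add: T_def)
  have "(\<lambda>\<sigma>. \<integral>\<^sup>+x. \<beta> (s (\<sigma> *\<^sub>R v) *\<^sub>R e - x) \<partial>M) \<in> borel_measurable borel"
    by measurable
  then show "(\<lambda>\<sigma>. hausdorff_outer n (slice v \<sigma>)) \<in> borel_measurable borel"
    using v by (simp add: slice_M dot_square_norm)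
qed

text \<open>By Pythagoras the slice is empty for \<open>|\<sigma>| > 1\<close> and lies in the unit ball otherwise.\<close>

lemma hausdorff_slice_integral_finite:
  fixes v :: "'a::euclidean_space"
  assumes n: "n = DIM('a) - 1" and v: "norm v = 1"
  shows "(\<integral>\<^sup>+\<sigma>. hausdorff_outer n (slice v \<sigma>) \<partial>lborel) < \<infinity>"
proof -
  let ?h = "hausdorff_outer n ({x. x \<bullet> v = 0} \<inter> cball 0 1)"
  have le: "hausdorff_outer n (slice v \<sigma>) \<le> ?h * indicator {-1..1} \<sigma>" for \<sigma>
  proof -
    have sq: "(norm (\<sigma> *\<^sub>R v - x))\<^sup>2 = \<sigma>\<^sup>2 + (norm x)\<^sup>2" if "x \<bullet> v = 0" for x
    proof -
      have "v \<bullet> v = 1" using v by (simp add: dot_square_norm)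
      then show ?thesis using that unfolding power2_norm_eq_inner
        by (simp add: inner_diff_left inner_diff_right inner_commute[of v x] power2_eq_square)
    qed
    have small: "\<sigma>\<^sup>2 + (norm x)\<^sup>2 < 1" if "x \<in> slice v \<sigma>" for x
    proof -
      have "(norm (\<sigma> *\<^sub>R v - x))\<^sup>2 < 1" using that by (simp add: slice_def abs_square_less_1)
      then show ?thesis using sq[of x] that by (simp add: slice_def)
    qed
    have 1: "slice v \<sigma> \<subseteq> {x. x \<bullet> v = 0} \<inter> cball 0 1"
    proof
      fix x assume x: "x \<in> slice v \<sigma>"
      have "(norm x)\<^sup>2 \<le> 1\<^sup>2" using small[OF x] zero_le_power2[of \<sigma>] unfolding power_one by linarith
      then have "norm x \<le> 1" by (rule power2_le_imp_le) simp
      then show "x \<in> {x. x \<bullet> v = 0} \<inter> cball 0 1" using x by (simp add: slice_def)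
    qed
    show ?thesis
    proof (cases "\<sigma> \<in> {-1..1}")
      case True
      then show ?thesis using hausdorff_outer_mono[OF 1, of n] by simp
    next
      case False
      then have "\<not> \<sigma>\<^sup>2 < 1" by (auto simp: abs_square_less_1)
      then have "slice v \<sigma> = {}" using small by (smt (verit) ex_in_conv zero_le_power2)
      moreover have "hausdorff_outer n ({} :: 'a set) \<le> ennreal (1 ^ n * 0)"
        unfolding hausdorff_outer_def
        using hausdorff_content_finite_cover[of "{}" "{} :: 'a set" "\<lambda>_. {}" 0 _ n] by (intro SUP_least) auto
      ultimately show ?thesis by simp
    qed
  qed
  have "(\<integral>\<^sup>+\<sigma>. hausdorff_outer n (slice v \<sigma>) \<partial>lborel) \<le> (\<integral>\<^sup>+\<sigma>. ?h * indicator {-1..1 :: real} \<sigma> \<partial>lborel)"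
    by (intro nn_integral_mono le)
  also have "\<dots> = ?h * emeasure lborel {-1..1 :: real}"
    by (subst nn_integral_cmult) auto
  also have "\<dots> < \<infinity>"
    using hausdorff_outer_plane_finite[OF v n, of 1] by (auto simp: ennreal_mult_less_top)
  finally show ?thesis .
qed

text \<open>The factor \<open>\<kappa>\<close> compares the Hausdorff measure with slabs of profile \<open>\<phi>\<close>.  Its value is
  immaterial, as it only enters integrals that vanish and statements of finiteness.\<close>

lemma hausdorff_hyperplane_slab:
  fixes \<phi> :: "real \<Rightarrow> ennreal"
  assumes n: "n = DIM('a::euclidean_space) - 1"
    and [measurable]: "\<phi> \<in> borel_measurable borel" and \<phi>: "0 < (\<integral>\<^sup>+s. \<phi> s \<partial>lborel)" "(\<integral>\<^sup>+s. \<phi> s \<partial>lborel) < \<infinity>"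
    and outer: "\<And>A :: 'a set. A \<in> sets borel \<Longrightarrow> emeasure (hausdorff_measure n) A = hausdorff_outer n A"
  obtains \<kappa> :: ennreal where "\<kappa> < \<infinity>"
    "\<And>(v :: 'a) e Z t. \<lbrakk>norm v = 1; e \<bullet> v \<noteq> 0; Z \<in> sets borel; t \<in> borel_measurable borel;
       \<And>z s. z + s *\<^sub>R e \<in> Z \<longleftrightarrow> z \<in> Z; \<And>z s. z \<in> Z \<Longrightarrow> t (z + s *\<^sub>R e) = t z + s\<rbrakk> \<Longrightarrow>
       emeasure (hausdorff_measure n) (Z \<inter> {x. x \<bullet> v = 0})
         = \<kappa> * ennreal (1 / \<bar>e \<bullet> v\<bar>) * (\<integral>\<^sup>+z. indicator Z z * \<phi> (t z) \<partial>lborel)"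
proof -
  obtain b :: 'a where b: "b \<in> Basis" by (meson ex_in_conv nonempty_Basis)
  define \<psi> where "\<psi> = (\<lambda>\<sigma>. hausdorff_outer n (slice b \<sigma>))"
  have \<psi>: "hausdorff_outer n (slice v \<sigma>) = \<psi> \<sigma>" if "norm v = 1" for v :: 'a and \<sigma>
    unfolding \<psi>_def using that b by (intro hausdorff_slice_eq) simp
  have [measurable]: "\<psi> \<in> borel_measurable borel"
    unfolding \<psi>_def using b by (intro hausdorff_hyperplane_section(2)[OF outer n, where Z = "{}" and e = b]) auto
  have \<psi>_fin: "(\<integral>\<^sup>+\<sigma>. \<psi> \<sigma> \<partial>lborel) < \<infinity>"
    unfolding \<psi>_def using b by (intro hausdorff_slice_integral_finite n) simp
  define \<omega> where "\<omega> = emeasure lborel (ball 0 1 :: 'a set)"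
  have \<omega>: "0 < \<omega>" "\<omega> < \<infinity>"
    unfolding \<omega>_def using emeasure_lborel_ball_finite[of "0::'a" 1]
      by (auto simp: emeasure_ball unit_ball_vol_pos)
  define I where "I = (\<integral>\<^sup>+s. \<phi> s \<partial>lborel)"
  define \<kappa> where "\<kappa> = (\<integral>\<^sup>+\<sigma>. \<psi> \<sigma> \<partial>lborel) / (\<omega> * I)"
  have \<omega>I: "0 < \<omega> * I" "\<omega> * I < \<infinity>"
    using \<omega> \<phi> by (auto simp: I_def ennreal_zero_less_mult_iff ennreal_mult_less_top)
  show ?thesis
  proof (rule that)
    show "\<kappa> < \<infinity>" unfolding \<kappa>_def using \<psi>_fin \<omega>I
      by (auto simp: less_top[symmetric] ennreal_divide_eq_top_iff)
  next
    fix v e :: 'a and Z t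
    assume v: "norm v = 1" and c: "e \<bullet> v \<noteq> 0" and Z: "Z \<in> sets borel" "\<And>z s. z + s *\<^sub>R e \<in> Z \<longleftrightarrow> z \<in> Z"
      and t: "t \<in> borel_measurable borel" "\<And>z s. z \<in> Z \<Longrightarrow> t (z + s *\<^sub>R e) = t z + s"
    define X where "X = (\<integral>\<^sup>+z. indicator Z z * \<phi> (t z) \<partial>lborel)"
    define h where "h = emeasure (hausdorff_measure n) (Z \<inter> {x. x \<bullet> v = 0})"
    have "\<omega> * h = (\<integral>\<^sup>+y. indicator Z y * \<psi> (y \<bullet> v) \<partial>lborel)"
      unfolding \<omega>_def h_def using hausdorff_hyperplane_section(1)[OF outer n v c Z] \<psi>[OF v] by simp
    also have "\<dots> = (\<integral>\<^sup>+y. indicator Z y * \<psi> ((e \<bullet> v) * (y \<bullet> v / (e \<bullet> v))) \<partial>lborel)"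
      using c by simp
    finally have "\<omega> * h * I = (\<integral>\<^sup>+y. indicator Z y * \<psi> ((e \<bullet> v) * (y \<bullet> v / (e \<bullet> v))) \<partial>lborel) * I" by simp
    also have "\<dots> = X * (\<integral>\<^sup>+s. \<psi> ((e \<bullet> v) * s) \<partial>lborel)"
      unfolding I_def X_def
      by (rule cylinder_section_independent[where t = "\<lambda>y. y \<bullet> v / (e \<bullet> v)" and t' = t and e = e and \<phi> = "\<lambda>s. \<psi> ((e \<bullet> v) * s)"])
        (use Z t c in \<open>auto simp: inner_add_left add_divide_distrib\<close>)
    also have "(\<integral>\<^sup>+s. \<psi> s \<partial>lborel) = \<bar>e \<bullet> v\<bar> * (\<integral>\<^sup>+s. \<psi> ((e \<bullet> v) * s) \<partial>lborel)"
      using nn_integral_real_affine[of \<psi> "e \<bullet> v" 0] c by simp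
    then have "(\<integral>\<^sup>+s. \<psi> ((e \<bullet> v) * s) \<partial>lborel) = ennreal (1 / \<bar>e \<bullet> v\<bar>) * (\<integral>\<^sup>+s. \<psi> s \<partial>lborel)"
      using c by (simp add: mult.assoc[symmetric] ennreal_mult'[symmetric])
    finally have "(\<omega> * I) * h = (\<integral>\<^sup>+s. \<psi> s \<partial>lborel) * (ennreal (1 / \<bar>e \<bullet> v\<bar>) * X)"
      by (simp add: mult_ac)
    moreover have "\<omega> * I \<noteq> 0" "\<omega> * I \<noteq> top" using \<omega>I by auto
    ultimately have "h = (\<integral>\<^sup>+s. \<psi> s \<partial>lborel) * (ennreal (1 / \<bar>e \<bullet> v\<bar>) * X) / (\<omega> * I)"
      using ennreal_mult_divide_eq[of "\<omega> * I" h] by (metis mult.commute)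
    then show "h = \<kappa> * ennreal (1 / \<bar>e \<bullet> v\<bar>) * X"
      by (simp add: \<kappa>_def ennreal_times_divide mult.assoc ennreal_divide_times)
  qed
qed

text \<open>The profile of the slabs over a graph.  It is \<open>C\<^sup>1\<close>, so that slabs can be differentiated.\<close>

definition bump :: "real \<Rightarrow> real" where "bump s = (max 0 (1 - s\<^sup>2))\<^sup>2"

lemma bump_nonneg [simp]: "0 \<le> bump s"
  by (simp add: bump_def)

lemma bump_outside: "1 \<le> \<bar>s\<bar> \<Longrightarrow> bump s = 0"
  by (simp add: bump_def max_def abs_le_square_iff[of 1 s, simplified])

lemma bump_le_1: "bump s \<le> 1"
  unfolding bump_def by (rule power_le_one) auto

lemma continuous_bump: "continuous_on A bump"
  unfolding bump_def by (intro continuous_intros)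

lemma bump_measurable [measurable]: "bump \<in> borel_measurable borel"
  by (rule borel_measurable_continuous_onI[OF continuous_bump])

lemma bump_integral_pos: "0 < (\<integral>\<^sup>+s. ennreal (bump s) \<partial>lborel)"
proof -
  have "(\<integral>\<^sup>+s. ennreal (1/2) * indicator {0..1/2::real} s \<partial>lborel) \<le> (\<integral>\<^sup>+s. ennreal (bump s) \<partial>lborel)"
  proof (rule nn_integral_mono)
    fix s :: real
    have "bump s \<ge> 1/2" if "s \<in> {0..1/2}"
    proof -
      have "s\<^sup>2 \<le> (1/2)\<^sup>2" using that by (intro power_mono) auto
      then have "3/4 \<le> 1 - s\<^sup>2" by (simp add: power2_eq_square)
      then have "(3/4)\<^sup>2 \<le> (1 - s\<^sup>2)\<^sup>2" by (intro power_mono) auto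
      then show ?thesis using \<open>3/4 \<le> 1 - s\<^sup>2\<close> by (simp add: bump_def max_def power2_eq_square)
    qed
    then have "s \<in> {0..1/2} \<Longrightarrow> ennreal (1/2) \<le> ennreal (bump s)" by (intro ennreal_leI)
    then show "ennreal (1/2) * indicator {0..1/2::real} s \<le> ennreal (bump s)"
      by (simp only: indicator_def split: if_splits) simp
  qed
  moreover have "(\<integral>\<^sup>+s. ennreal (1/2) * indicator {0..1/2::real} s \<partial>lborel) = ennreal (1/2) * emeasure lborel {0..1/2::real}"
    by (subst nn_integral_cmult) auto
  moreover have "0 < ennreal (1/2) * emeasure lborel {0..1/2::real}"
    by (auto simp: zero_less_iff_neq_zero)
  ultimately show ?thesis by (simp only:)
qed

lemma bump_integral_finite: "(\<integral>\<^sup>+s. ennreal (bump s) \<partial>lborel) < \<infinity>"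
proof -
  have "(\<integral>\<^sup>+s. ennreal (bump s) \<partial>lborel) \<le> (\<integral>\<^sup>+s. indicator {-1..1::real} s \<partial>lborel)"
    using bump_outside bump_le_1 by (intro nn_integral_mono) (force simp: indicator_def)
  also have "\<dots> < \<infinity>" by simp
  finally show ?thesis .
qed

text \<open>By Lindelof, countably many of the neighbourhoods suffice, and these can be made disjoint.\<close>

lemma emeasure_le_locally:
  fixes M M' :: "'a::second_countable_topology measure"
  assumes sets: "sets M = sets borel" "sets M' = sets borel"
    and loc: "\<And>p. p \<in> S \<Longrightarrow> \<exists>N. open N \<and> p \<in> N \<and> (\<forall>A\<in>sets borel. A \<subseteq> N \<longrightarrow> emeasure M A \<le> q * emeasure M' A)"
    and S: "S \<in> sets borel" "emeasure M (- S) = 0" and A: "A \<in> sets borel"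
  shows "emeasure M A \<le> q * emeasure M' A"
proof (cases "S = {}")
  case True
  have "emeasure M A \<le> emeasure M (- S)" using S sets A True by (intro emeasure_mono) auto
  then show ?thesis using S by simp
next
  case False
  obtain N where N: "\<And>p. p \<in> S \<Longrightarrow> open (N p) \<and> p \<in> N p \<and> (\<forall>A\<in>sets borel. A \<subseteq> N p \<longrightarrow> emeasure M A \<le> q * emeasure M' A)"
    using loc by metis
  obtain F where F: "F \<subseteq> N ` S" "countable F" "\<Union> F = \<Union> (N ` S)"
    using Lindelof[of "N ` S"] N by auto
  have "F \<noteq> {}" using F(3) N False by auto
  then have rF: "range (from_nat_into F) = F" using F(2) by (rule range_from_nat_into)
  define B where "B = from_nat_into F"
  have BF: "B i \<in> F" for i unfolding B_def using \<open>F \<noteq> {}\<close> by (rule from_nat_into)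
  have B: "open (B i)" "\<And>A. A \<in> sets borel \<Longrightarrow> A \<subseteq> B i \<Longrightarrow> emeasure M A \<le> q * emeasure M' A" for i
    using BF[of i] F(1) N by auto
  define D where "D i = A \<inter> disjointed B i" for i
  have Bb: "range B \<subseteq> sets borel" using B(1) by auto
  have D: "D i \<in> sets borel" "D i \<subseteq> B i" for i
    using sets.range_disjointed_sets[OF Bb] A disjointed_subset[of B i] by (auto simp: D_def)
  have disj: "disjoint_family D"
    using disjoint_family_disjointed[of B] unfolding D_def by (auto simp: disjoint_family_on_def)
  have UD: "(\<Union>i. D i) = A \<inter> \<Union> F"
    using UN_disjointed_eq[of B] rF by (auto simp: D_def B_def)
  have SF: "S \<subseteq> \<Union> F" unfolding F(3) using N by auto
  have "emeasure M A \<le> emeasure M ((\<Union>i. D i) \<union> - S)"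
  proof (rule emeasure_mono)
    show "A \<subseteq> (\<Union>i. D i) \<union> - S" unfolding UD using SF by blast
    have "(\<Union>i. D i) \<in> sets borel" using D(1) by (intro sets.countable_UN') auto
    then show "(\<Union>i. D i) \<union> - S \<in> sets M" unfolding sets using S(1) by (intro sets.Un) auto
  qed
  also have "\<dots> \<le> emeasure M (\<Union>i. D i) + emeasure M (- S)"
    using D(1) S sets by (intro emeasure_subadditive) auto
  also have "\<dots> = (\<Sum>i. emeasure M (D i))"
    using S(2) D(1) sets by (simp add: suminf_emeasure[OF _ disj] image_subset_iff)
  also have "\<dots> \<le> (\<Sum>i. q * emeasure M' (D i))"
    by (rule suminf_le, rule B(2)[OF D]) auto
  also have "\<dots> = q * emeasure M' (\<Union>i. D i)"
    using D(1) sets by (simp add: suminf_emeasure[OF _ disj] image_subset_iff)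
  also have "\<dots> \<le> q * emeasure M' A"
    using A sets by (intro mult_left_mono emeasure_mono) (auto simp: D_def)
  finally show ?thesis .
qed

lemma ennreal_le_of_factors:
  fixes x y :: ennreal
  assumes "\<And>q. q > 1 \<Longrightarrow> x \<le> ennreal q * y"
  shows "x \<le> y"
proof (cases y)
  case (real r)
  have "x \<le> ennreal (2 * r)" using assms[of 2] real by (simp add: ennreal_mult)
  then obtain a where a: "x = ennreal a" "0 \<le> a" by (cases x) (auto simp: top_unique)
  have "a \<le> r"
  proof (rule field_le_mult_one_interval)
    fix z :: real assume z: "0 < z" "z < 1"
    have "ennreal a \<le> ennreal (1 / z) * ennreal r" using assms[of "1 / z"] a real z by simp
    also have "\<dots> = ennreal (1 / z * r)" using z by (intro ennreal_mult'[symmetric]) simp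
    finally have "a \<le> 1 / z * r" by (subst (asm) ennreal_le_iff) (use z real in auto)
    then show "z * a \<le> r" using z by (simp add: field_simps)
  qed
  then show ?thesis using a real by (simp add: ennreal_leI)
qed auto

lemma exists_small_power:
  assumes "q > (1::real)"
  obtains \<epsilon> where "0 < \<epsilon>" "\<epsilon> < 1" "(1 / (1 - \<epsilon>)) ^ m \<le> q"
proof -
  have "((\<lambda>\<epsilon>::real. (1 / (1 - \<epsilon>)) ^ m) \<longlongrightarrow> (1 / (1 - 0)) ^ m) (at_right 0)"
    by (intro tendsto_intros) auto
  then have "eventually (\<lambda>\<epsilon>::real. (1 / (1 - \<epsilon>)) ^ m < q) (at_right 0)"
    using assms by (intro order_tendstoD) auto
  moreover have "eventually (\<lambda>\<epsilon>::real. 0 < \<epsilon> \<and> \<epsilon> < 1) (at_right 0)"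
    by (auto simp: eventually_at_right_field intro!: exI[of _ 1])
  ultimately have "eventually (\<lambda>\<epsilon>::real. (1 / (1 - \<epsilon>)) ^ m < q \<and> 0 < \<epsilon> \<and> \<epsilon> < 1) (at_right 0)"
    by eventually_elim auto
  from eventually_happens[OF this] obtain \<epsilon> :: real where "(1 / (1 - \<epsilon>)) ^ m < q" "0 < \<epsilon>" "\<epsilon> < 1" by auto
  then show ?thesis using that by auto
qed

context graph_chart
begin

definition cyl :: "'a set \<Rightarrow> 'a set" where "cyl A = {z \<in> D. pr z \<in> A}"

lemma continuous_grad_t: "continuous_on D (grad t)"
  using t_smooth by (intro Ck_field_continuous[of 0] Ck_field_grad) (simp add: smooth_on_def del: Ck_on.simps)

lemma continuous_t: "continuous_on D t"
  using t_smooth Ck_on_continuous unfolding smooth_on_def by blast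

lemma continuous_pr: "continuous_on D pr"
  by (rule Ck_field_continuous[OF Ck_pr])

lemma D_borel [measurable]: "D \<in> sets borel"
  using open_D by simp

lemma graph_borel [measurable]: "graph \<in> sets borel"
proof -
  have "closedin (top_of_set D) {z \<in> D. t z = 0}"
    by (rule continuous_closedin_preimage_constant[OF continuous_t])
  then obtain C where "closed C" "graph = C \<inter> D" by (auto simp: closedin_closed graph_def)
  then show ?thesis by auto
qed

text \<open>Extensions by zero of the functions of the chart, which are measurable on the whole space.\<close>

definition "t0 = (\<lambda>z. indicator D z *\<^sub>R t z)"
definition "pr0 = (\<lambda>z. indicator D z *\<^sub>R pr z)"
definition "slope = (\<lambda>z. indicator D z *\<^sub>R norm (grad t z))"

lemma chart_measurable [measurable]:
  "t0 \<in> borel_measurable borel" "pr0 \<in> borel_measurable borel" "slope \<in> borel_measurable borel"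
  unfolding t0_def pr0_def slope_def
  by (intro borel_measurable_continuous_on_indicator continuous_t continuous_pr continuous_on_norm continuous_grad_t D_borel)+

lemma cyl_borel: "A \<in> sets borel \<Longrightarrow> cyl A \<in> sets borel"
proof -
  assume [measurable]: "A \<in> sets borel"
  have "cyl A = D \<inter> pr0 -` A" by (auto simp: cyl_def pr0_def)
  moreover have "pr0 -` A \<in> sets borel" using measurable_sets[OF chart_measurable(2), of A] by simp
  ultimately show ?thesis using sets.Int[OF D_borel] by simp
qed

lemma shift_D_iff: "z + s *\<^sub>R e \<in> D \<longleftrightarrow> z \<in> D"
  using shift_D[of z s] shift_D[of "z + s *\<^sub>R e" "- s"] by auto

lemma cyl_shift: "z + s *\<^sub>R e \<in> cyl A \<longleftrightarrow> z \<in> cyl A"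
  using pr_shift[of z s] shift_D_iff by (auto simp: cyl_def)

lemma slope_ge_1: "z \<in> D \<Longrightarrow> 1 \<le> norm (grad t z)"
  using Cauchy_Schwarz_ineq2[of "grad t z" e] norm_e by simp

text \<open>The mean value inequality on a ball where the gradient varies by at most \<open>\<epsilon>\<close>.\<close>

lemma strict_derivative:
  assumes p: "p \<in> D" and "0 < \<epsilon>"
  obtains d where "d > 0" "ball p d \<subseteq> D" "\<And>z. z \<in> ball p d \<Longrightarrow> norm (grad t z - grad t p) \<le> \<epsilon>"
    "\<And>a b. a \<in> ball p d \<Longrightarrow> b \<in> ball p d \<Longrightarrow> \<bar>t a - t b - grad t p \<bullet> (a - b)\<bar> \<le> \<epsilon> * norm (a - b)"
proof -
  obtain d1 where d1: "d1 > 0" "ball p d1 \<subseteq> D" using open_D p open_contains_ball by blast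
  obtain d2 where d2: "d2 > 0" "\<And>z. z \<in> D \<Longrightarrow> dist z p < d2 \<Longrightarrow> dist (grad t z) (grad t p) < \<epsilon>"
    using continuous_grad_t p \<open>0 < \<epsilon>\<close> unfolding continuous_on_iff by metis
  define d where "d = min d1 d2"
  have d: "d > 0" "ball p d \<subseteq> D" using d1 d2 by (auto simp: d_def)
  have g: "norm (grad t z - grad t p) \<le> \<epsilon>" if "z \<in> ball p d" for z
  proof -
    have "z \<in> D" "dist z p < d2" using that d(2) by (auto simp: d_def dist_commute)
    from d2(2)[OF this] show ?thesis by (simp add: dist_norm)
  qed
  have "\<bar>t a - t b - grad t p \<bullet> (a - b)\<bar> \<le> \<epsilon> * norm (a - b)" if ab: "a \<in> ball p d" "b \<in> ball p d" for a b
  proof -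
    have "norm ((t a - grad t p \<bullet> a) - (t b - grad t p \<bullet> b)) \<le> \<epsilon> * norm (a - b)"
    proof (rule differentiable_bound[of "ball p d" _ "\<lambda>z h. (grad t z - grad t p) \<bullet> h"])
      fix z assume z: "z \<in> ball p d"
      have "(t has_derivative (\<lambda>h. grad t z \<bullet> h)) (at z within ball p d)"
        by (rule has_derivative_at_withinI[OF t_has_derivative]) (use z d(2) in auto)
      then show "((\<lambda>z. t z - grad t p \<bullet> z) has_derivative (\<lambda>h. (grad t z - grad t p) \<bullet> h)) (at z within ball p d)"
        unfolding inner_diff_left by (intro has_derivative_diff has_derivative_inner_right has_derivative_ident)
      show "onorm (\<lambda>h. (grad t z - grad t p) \<bullet> h) \<le> \<epsilon>"
      proof (rule onorm_bound)
        show "norm ((grad t z - grad t p) \<bullet> h) \<le> \<epsilon> * norm h" for h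
          using order_trans[OF Cauchy_Schwarz_ineq2 mult_right_mono[OF g[OF z]]] by simp
      qed (use \<open>0 < \<epsilon>\<close> in simp)
    qed (use ab in auto)
    then show ?thesis by (simp add: inner_diff_right algebra_simps)
  qed
  then show ?thesis using that d g by blast
qed

text \<open>The volume of the slab over \<open>A\<close> with profile \<^const>\<open>bump\<close>, where \<open>|\<nabla>t|\<close> is the area element of the
  graph over the hyperplane orthogonal to \<open>e\<close>.\<close>

definition slab :: "'a set \<Rightarrow> ennreal" where
  "slab A = (\<integral>\<^sup>+z. indicator (cyl A) z * ennreal (slope z * bump (t0 z)) \<partial>lborel)"

text \<open>Near \<open>p\<close> the graph differs from its tangent plane at \<open>p\<close> so little that the projection along \<open>e\<close>
  between the two changes distances by a factor close to \<open>1\<close>.\<close>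

lemma area_estimate:
  fixes \<kappa> :: ennreal
  assumes n: "n = DIM('a) - 1" and p: "p \<in> graph" and q: "q > 1"
    and outer: "\<And>A :: 'a set. A \<in> sets borel \<Longrightarrow> emeasure (hausdorff_measure n) A = hausdorff_outer n A"
    and \<kappa>: "\<And>(v :: 'a) e Z t. \<lbrakk>norm v = 1; e \<bullet> v \<noteq> 0; Z \<in> sets borel; t \<in> borel_measurable borel;
       \<And>z s. z + s *\<^sub>R e \<in> Z \<longleftrightarrow> z \<in> Z; \<And>z s. z \<in> Z \<Longrightarrow> t (z + s *\<^sub>R e) = t z + s\<rbrakk> \<Longrightarrow>
       emeasure (hausdorff_measure n) (Z \<inter> {x. x \<bullet> v = 0})
         = \<kappa> * ennreal (1 / \<bar>e \<bullet> v\<bar>) * (\<integral>\<^sup>+z. indicator Z z * ennreal (bump (t z)) \<partial>lborel)"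
  shows "\<exists>N. open N \<and> p \<in> N \<and> (\<forall>A\<in>sets borel. A \<subseteq> N \<longrightarrow>
    emeasure (hausdorff_measure n) (A \<inter> graph) \<le> ennreal q * (\<kappa> * slab A) \<and>
    \<kappa> * slab A \<le> ennreal q * emeasure (hausdorff_measure n) (A \<inter> graph))"
proof -
  obtain \<epsilon> where \<epsilon>: "0 < \<epsilon>" "\<epsilon> < 1" "(1 / (1 - \<epsilon>)) ^ Suc n \<le> q" using exists_small_power[OF q] by blast
  have pD: "p \<in> D" using p by (simp add: graph_def)
  obtain d where d: "d > 0" "ball p d \<subseteq> D" "\<And>z. z \<in> ball p d \<Longrightarrow> norm (grad t z - grad t p) \<le> \<epsilon>"
    "\<And>a b. a \<in> ball p d \<Longrightarrow> b \<in> ball p d \<Longrightarrow> \<bar>t a - t b - grad t p \<bullet> (a - b)\<bar> \<le> \<epsilon> * norm (a - b)"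
    using strict_derivative[OF pD \<epsilon>(1)] by blast
  define g where "g = norm (grad t p)"
  have g: "1 \<le> g" unfolding g_def by (rule slope_ge_1[OF pD])
  define v where "v = grad t p /\<^sub>R g"
  have v: "norm v = 1" using g unfolding v_def norm_scaleR g_def[symmetric] by simp
  have ev: "e \<bullet> v = 1 / g" using grad_t_e[OF pD] by (simp add: v_def inner_commute divide_inverse)
  define T where "T = {x. x \<bullet> v = 0}"
  have T: "x \<in> T \<longleftrightarrow> grad t p \<bullet> x = 0" for x using g by (auto simp: T_def v_def inner_commute)
  have T_borel [measurable]: "T \<in> sets borel"
    unfolding T_def by (intro borel_closed closed_Collect_eq continuous_intros)
  \<comment> \<open>The projection along \<open>e\<close> onto the tangent plane, moved to the origin.\<close>
  define Q where "Q y = y - (grad t p \<bullet> y) *\<^sub>R e" for y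
  have Q_bounds: "norm (Q a - Q b) \<le> (1 + \<epsilon>) * norm (a - b)" "(1 - \<epsilon>) * norm (a - b) \<le> norm (Q a - Q b)"
    if "a \<in> ball p d \<inter> graph" "b \<in> ball p d \<inter> graph" for a b
  proof -
    have "\<bar>grad t p \<bullet> (a - b)\<bar> \<le> \<epsilon> * norm (a - b)" using d(4)[of a b] that by (auto simp: graph_def)
    then have "norm ((grad t p \<bullet> (a - b)) *\<^sub>R e) \<le> \<epsilon> * norm (a - b)" using norm_e by simp
    moreover have eq: "Q a - Q b = (a - b) - (grad t p \<bullet> (a - b)) *\<^sub>R e"
      by (simp add: Q_def inner_diff_right algebra_simps)
    ultimately show "norm (Q a - Q b) \<le> (1 + \<epsilon>) * norm (a - b)" "(1 - \<epsilon>) * norm (a - b) \<le> norm (Q a - Q b)"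
      unfolding eq distrib_right left_diff_distrib mult_1 using norm_triangle_ineq4[of "a - b" "(grad t p \<bullet> (a - b)) *\<^sub>R e"]
        norm_triangle_ineq2[of "a - b" "(grad t p \<bullet> (a - b)) *\<^sub>R e"] by linarith+
  qed
  show ?thesis
  proof (intro exI[of _ "ball p d"] conjI ballI impI)
    fix A :: "'a set" assume A [measurable]: "A \<in> sets borel" and AN: "A \<subseteq> ball p d"
    let ?h = "hausdorff_outer n"
    define Z where "Z = cyl A"
    have [measurable]: "Z \<in> sets borel" unfolding Z_def by (rule cyl_borel[OF A])
    define Y where "Y = (\<integral>\<^sup>+z. indicator Z z * ennreal (bump (t0 z)) \<partial>lborel)"
    have Q_image: "Q ` (A \<inter> graph) = Z \<inter> T" and pr_image: "pr ` (Z \<inter> T) = A \<inter> graph"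
      and Q_pr: "\<And>x. x \<in> Z \<inter> T \<Longrightarrow> Q (pr x) = x \<and> pr x \<in> A \<inter> graph"
    proof -
      have 1: "Q (pr x) = x \<and> pr x \<in> A \<inter> graph" if "x \<in> Z \<inter> T" for x
      proof -
        have "x \<in> D" "pr x \<in> A" "grad t p \<bullet> x = 0" using that T by (auto simp: Z_def cyl_def)
        then show ?thesis using pr_in_graph grad_t_e[OF pD] by (simp add: Q_def pr_def inner_diff_right)
      qed
      have 2: "Q y \<in> Z \<inter> T \<and> pr (Q y) = y" if "y \<in> A \<inter> graph" for y
      proof -
        have y: "y \<in> D" "pr y = y" using that graph_subset by auto
        have "Q y = y + (- (grad t p \<bullet> y)) *\<^sub>R e" by (simp add: Q_def)
        then have "Q y \<in> D" "pr (Q y) = y" using shift_D[OF y(1)] pr_shift[OF y(1)] y(2) by metis+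
        moreover have "Q y \<in> T" using grad_t_e[OF pD] unfolding T by (simp add: Q_def inner_diff_right)
        ultimately show ?thesis using that by (auto simp: Z_def cyl_def)
      qed
      show "Q ` (A \<inter> graph) = Z \<inter> T"
      proof (rule set_eqI, rule iffI)
        fix x assume "x \<in> Q ` (A \<inter> graph)"
        then obtain y where "x = Q y" "y \<in> A \<inter> graph" by (rule imageE)
        then show "x \<in> Z \<inter> T" using 2 by simp
      next
        fix x assume "x \<in> Z \<inter> T"
        then show "x \<in> Q ` (A \<inter> graph)" using 1[of x] image_eqI[of x Q "pr x" "A \<inter> graph"] by simp
      qed
      show "pr ` (Z \<inter> T) = A \<inter> graph"
      proof (rule set_eqI, rule iffI)
        fix y assume "y \<in> pr ` (Z \<inter> T)"
        then obtain x where "y = pr x" "x \<in> Z \<inter> T" by (rule imageE)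
        then show "y \<in> A \<inter> graph" using 1[of x] by simp
      next
        fix y assume "y \<in> A \<inter> graph"
        then show "y \<in> pr ` (Z \<inter> T)" using 2[of y] image_eqI[of y pr "Q y" "Z \<inter> T"] by simp
      qed
      show "\<And>x. x \<in> Z \<inter> T \<Longrightarrow> Q (pr x) = x \<and> pr x \<in> A \<inter> graph" by (rule 1)
    qed
    have up: "?h (Z \<inter> T) \<le> ennreal ((1 + \<epsilon>) ^ n) * ?h (A \<inter> graph)"
      unfolding Q_image[symmetric] using \<epsilon>(1) Q_bounds(1) AN
      by (intro hausdorff_outer_lipschitz) (auto simp: dist_norm subset_eq)
    have down: "?h (A \<inter> graph) \<le> ennreal ((1 / (1 - \<epsilon>)) ^ n) * ?h (Z \<inter> T)"
      unfolding pr_image[symmetric]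
    proof (rule hausdorff_outer_lipschitz)
      fix x y assume x: "x \<in> Z \<inter> T" and y: "y \<in> Z \<inter> T"
      have "pr x \<in> ball p d \<inter> graph" "pr y \<in> ball p d \<inter> graph"
        using Q_pr[OF x] Q_pr[OF y] AN by blast+
      from Q_bounds(2)[OF this] have "(1 - \<epsilon>) * norm (pr x - pr y) \<le> norm (x - y)"
        using Q_pr[OF x] Q_pr[OF y] by simp
      then show "dist (pr x) (pr y) \<le> 1 / (1 - \<epsilon>) * dist x y"
        using \<epsilon>(2) by (simp add: dist_norm field_simps)
    qed (use \<epsilon> in simp)
    have plane: "?h (Z \<inter> T) = \<kappa> * (ennreal g * Y)"
    proof -
      have "emeasure (hausdorff_measure n) (Z \<inter> T) = \<kappa> * ennreal (1 / \<bar>e \<bullet> v\<bar>) * Y"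
        unfolding T_def Y_def
      proof (rule \<kappa>[OF v])
        show "e \<bullet> v \<noteq> 0" using g ev by simp
        show "z + s *\<^sub>R e \<in> Z \<longleftrightarrow> z \<in> Z" for z s unfolding Z_def by (rule cyl_shift)
        show "t0 (z + s *\<^sub>R e) = t0 z + s" if "z \<in> Z" for z s
        proof -
          have "z \<in> D" using that by (simp add: Z_def cyl_def)
          then show ?thesis by (simp add: t0_def shift_D_iff t_shift)
        qed
      qed measurable
      then show ?thesis using ev g by (simp add: outer mult.assoc)
    qed
    have slope: "norm (grad t z) \<le> (1 + \<epsilon>) * g" "(1 - \<epsilon>) * g \<le> norm (grad t z)" if "z \<in> Z" for z
    proof -
      have "z \<in> D" "pr z \<in> ball p d" using that AN by (auto simp: Z_def cyl_def)
      then have "norm (grad t z - grad t p) \<le> \<epsilon>" using d(3)[of "pr z"] grad_t_pr by simp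
      moreover have "\<epsilon> \<le> \<epsilon> * g" using \<epsilon> g by simp
      ultimately show "norm (grad t z) \<le> (1 + \<epsilon>) * g" "(1 - \<epsilon>) * g \<le> norm (grad t z)"
        using norm_triangle_ineq3[of "grad t z" "grad t p"] unfolding g_def[symmetric] by (auto simp: algebra_simps)
    qed
    have Z_slope: "slope z = norm (grad t z)" if "z \<in> Z" for z
      using that by (simp add: slope_def Z_def cyl_def)
    have le: "slab A \<le> ennreal (1 + \<epsilon>) * (ennreal g * Y)"
    proof -
      have "slab A \<le> (\<integral>\<^sup>+z. ennreal ((1 + \<epsilon>) * g) * (indicator Z z * ennreal (bump (t0 z))) \<partial>lborel)"
        unfolding slab_def Z_def[symmetric]
      proof (rule nn_integral_mono)
        fix z
        show "indicator Z z * ennreal (slope z * bump (t0 z)) \<le> ennreal ((1 + \<epsilon>) * g) * (indicator Z z * ennreal (bump (t0 z)))"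
          using slope(1)[of z] Z_slope[of z] g \<epsilon>
          by (cases "z \<in> Z") (auto simp: ennreal_mult''[symmetric] intro!: ennreal_leI mult_right_mono)
      qed
      also have "\<dots> = ennreal ((1 + \<epsilon>) * g) * Y" unfolding Y_def by (rule nn_integral_cmult) measurable
      finally show ?thesis using g \<epsilon> by (simp add: ennreal_mult mult.assoc)
    qed
    have ge: "ennreal g * Y \<le> ennreal (1 / (1 - \<epsilon>)) * slab A"
    proof -
      have "ennreal g * Y = (\<integral>\<^sup>+z. ennreal g * (indicator Z z * ennreal (bump (t0 z))) \<partial>lborel)"
        unfolding Y_def by (rule nn_integral_cmult[symmetric]) measurable
      also have "\<dots> \<le> (\<integral>\<^sup>+z. ennreal (1 / (1 - \<epsilon>)) * (indicator Z z * ennreal (slope z * bump (t0 z))) \<partial>lborel)"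
      proof (rule nn_integral_mono)
        fix z
        have "g \<le> 1 / (1 - \<epsilon>) * norm (grad t z)" if "z \<in> Z"
          using slope(2)[OF that] \<epsilon> by (simp add: field_simps)
        then show "ennreal g * (indicator Z z * ennreal (bump (t0 z))) \<le> ennreal (1 / (1 - \<epsilon>)) * (indicator Z z * ennreal (slope z * bump (t0 z)))"
          using Z_slope[of z] g \<epsilon>
          by (cases "z \<in> Z") (auto simp: ennreal_mult''[symmetric] mult.assoc[symmetric] simp del: times_divide_eq_left intro!: ennreal_leI mult_right_mono)
      qed
      also have "\<dots> = ennreal (1 / (1 - \<epsilon>)) * slab A"
        unfolding slab_def Z_def[symmetric] by (rule nn_integral_cmult) measurable
      finally show ?thesis .
    qed
    have pow1: "ennreal ((1 / (1 - \<epsilon>)) ^ Suc n) = ennreal (1 / (1 - \<epsilon>)) * ennreal ((1 / (1 - \<epsilon>)) ^ n)"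
      and pow2: "ennreal ((1 + \<epsilon>) ^ Suc n) = ennreal (1 + \<epsilon>) * ennreal ((1 + \<epsilon>) ^ n)"
      unfolding power_Suc using \<epsilon> by (intro ennreal_mult; simp)+
    have H: "emeasure (hausdorff_measure n) (A \<inter> graph) = ?h (A \<inter> graph)" by (simp add: outer)
    have "?h (A \<inter> graph) \<le> ennreal ((1 / (1 - \<epsilon>)) ^ n) * (\<kappa> * (ennreal (1 / (1 - \<epsilon>)) * slab A))"
      using order_trans[OF down[unfolded plane] mult_left_mono[OF mult_left_mono[OF ge]]] by simp
    also have "\<dots> = ennreal ((1 / (1 - \<epsilon>)) ^ Suc n) * (\<kappa> * slab A)"
      unfolding pow1 by (simp only: mult_ac)
    also have "\<dots> \<le> ennreal q * (\<kappa> * slab A)" by (intro mult_right_mono ennreal_leI \<epsilon>(3)) simp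
    finally show "emeasure (hausdorff_measure n) (A \<inter> graph) \<le> ennreal q * (\<kappa> * slab A)" unfolding H .
    have "\<kappa> * slab A \<le> \<kappa> * (ennreal (1 + \<epsilon>) * (ennreal g * Y))" by (intro mult_left_mono le) simp
    also have "\<dots> = ennreal (1 + \<epsilon>) * ?h (Z \<inter> T)" by (simp add: plane mult_ac)
    also have "\<dots> \<le> ennreal (1 + \<epsilon>) * (ennreal ((1 + \<epsilon>) ^ n) * ?h (A \<inter> graph))" by (intro mult_left_mono up) simp
    also have "\<dots> = ennreal ((1 + \<epsilon>) ^ Suc n) * ?h (A \<inter> graph)"
      unfolding pow2 by (simp only: mult_ac)
    also have "\<dots> \<le> ennreal q * ?h (A \<inter> graph)"
    proof (intro mult_right_mono ennreal_leI)
      have "(1 + \<epsilon>) * (1 - \<epsilon>) \<le> 1" by (simp add: algebra_simps)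
      then have "1 + \<epsilon> \<le> 1 / (1 - \<epsilon>)" using \<epsilon>(2) by (simp add: pos_le_divide_eq)
      then have "(1 + \<epsilon>) ^ Suc n \<le> (1 / (1 - \<epsilon>)) ^ Suc n" using \<epsilon>(1) by (intro power_mono) auto
      then show "(1 + \<epsilon>) ^ Suc n \<le> q" using \<epsilon>(3) by linarith
    qed simp
    finally show "\<kappa> * slab A \<le> ennreal q * emeasure (hausdorff_measure n) (A \<inter> graph)" unfolding H .
  qed (use d in auto)
qed

definition slab_measure :: "ennreal \<Rightarrow> 'a measure" where
  "slab_measure \<kappa> = distr (density lborel (\<lambda>z. \<kappa> * (indicator D z * ennreal (slope z * bump (t0 z))))) borel pr0"

lemma emeasure_slab_measure:
  assumes [measurable]: "A \<in> sets borel"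
  shows "emeasure (slab_measure \<kappa>) A = \<kappa> * slab A"
proof -
  have [measurable]: "cyl A \<in> sets borel" by (rule cyl_borel) simp
  have [measurable]: "pr0 -` A \<in> sets borel" using measurable_sets[OF chart_measurable(2), of A] by simp
  have "emeasure (slab_measure \<kappa>) A = (\<integral>\<^sup>+z. \<kappa> * (indicator D z * ennreal (slope z * bump (t0 z))) * indicator (pr0 -` A) z \<partial>lborel)"
    unfolding slab_measure_def by (simp add: emeasure_distr emeasure_density)
  also have "\<dots> = (\<integral>\<^sup>+z. \<kappa> * (indicator (cyl A) z * ennreal (slope z * bump (t0 z))) \<partial>lborel)"
    by (intro nn_integral_cong) (auto simp: indicator_def cyl_def pr0_def)
  also have "\<dots> = \<kappa> * slab A"
    unfolding slab_def by (rule nn_integral_cmult) measurable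
  finally show ?thesis .
qed

end

text \<open>The constant is the same for all charts.  If the Hausdorff outer measure failed to be
  countably additive on the Borel sets, the Hausdorff measure would be zero by convention and the
  formula would hold with \<open>\<kappa> = 0\<close>.\<close>

theorem area_formula:
  obtains \<kappa> :: ennreal where "\<kappa> < \<infinity>"
    "\<forall>(e :: 'a::euclidean_space) D t. graph_chart e D t \<longrightarrow>
      density (hausdorff_measure (DIM('a) - 1)) (indicator (graph_chart.graph D t)) = graph_chart.slab_measure e D t \<kappa>"
proof -
  let ?H = "hausdorff_measure (DIM('a) - 1) :: 'a measure"
  show ?thesis
  proof (cases rule: hausdorff_measure_cases[where n = "DIM('a) - 1" and ?'a = 'a])
    case outer
    have meas: "(\<lambda>s. ennreal (bump s)) \<in> borel_measurable borel" by measurable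
    note slab = hausdorff_hyperplane_slab[OF refl meas bump_integral_pos bump_integral_finite outer]
    show ?thesis
    proof (rule slab)
      fix \<kappa> :: ennreal
      assume \<kappa>: "\<kappa> < \<infinity>"
        "\<And>(v :: 'a) e Z t. \<lbrakk>norm v = 1; e \<bullet> v \<noteq> 0; Z \<in> sets borel; t \<in> borel_measurable borel;
         \<And>z s. z + s *\<^sub>R e \<in> Z \<longleftrightarrow> z \<in> Z; \<And>z s. z \<in> Z \<Longrightarrow> t (z + s *\<^sub>R e) = t z + s\<rbrakk> \<Longrightarrow>
         emeasure ?H (Z \<inter> {x. x \<bullet> v = 0})
           = \<kappa> * ennreal (1 / \<bar>e \<bullet> v\<bar>) * (\<integral>\<^sup>+z. indicator Z z * ennreal (bump (t z)) \<partial>lborel)"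
      show ?thesis
      proof (rule that[OF \<kappa>(1)], intro allI impI)
        fix e :: 'a and D t assume "graph_chart e D t"
        then interpret graph_chart e D t .
        let ?M = "density ?H (indicator graph)" and ?M' = "slab_measure \<kappa>"
        have M: "emeasure ?M A = emeasure ?H (A \<inter> graph)" if "A \<in> sets borel" for A
        proof -
          have "emeasure ?M A = (\<integral>\<^sup>+x. indicator graph x * indicator A x \<partial>?H)"
            using that by (intro emeasure_density) auto
          also have "\<dots> = (\<integral>\<^sup>+x. indicator (A \<inter> graph) x \<partial>?H)"
            by (intro nn_integral_cong) (auto simp: indicator_def)
          also have "\<dots> = emeasure ?H (A \<inter> graph)" using that by (intro nn_integral_indicator) auto
          finally show ?thesis .
        qed
        have sM: "sets ?M = sets borel" and sM': "sets ?M' = sets borel" by (auto simp: slab_measure_def)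
        have est: "\<exists>N. open N \<and> p \<in> N \<and> (\<forall>A\<in>sets borel. A \<subseteq> N \<longrightarrow>
            emeasure ?H (A \<inter> graph) \<le> ennreal q * (\<kappa> * slab A) \<and>
            \<kappa> * slab A \<le> ennreal q * emeasure ?H (A \<inter> graph))" if "p \<in> graph" "q > 1" for p q
          by (rule area_estimate[OF refl that outer \<kappa>(2)])
        show "?M = ?M'"
        proof (rule measure_eqI)
          fix A assume "A \<in> sets ?M"
          then have A: "A \<in> sets borel" by simp
          have "cyl (- graph) = {}" using pr_in_graph by (auto simp: cyl_def)
          then have 0: "emeasure ?M' (- graph) = 0" by (simp add: emeasure_slab_measure slab_def)
          show "emeasure ?M A = emeasure ?M' A"
          proof (rule antisym; rule ennreal_le_of_factors)
            fix q :: real assume q: "q > 1"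
            show "emeasure ?M A \<le> ennreal q * emeasure ?M' A"
            proof (rule emeasure_le_locally[OF sM sM' _ graph_borel _ A])
              fix p assume p: "p \<in> graph"
              show "\<exists>N. open N \<and> p \<in> N \<and> (\<forall>A\<in>sets borel. A \<subseteq> N \<longrightarrow> emeasure ?M A \<le> ennreal q * emeasure ?M' A)"
              proof -
                obtain N where N: "open N" "p \<in> N" "\<forall>A\<in>sets borel. A \<subseteq> N \<longrightarrow> emeasure ?H (A \<inter> graph) \<le> ennreal q * (\<kappa> * slab A)"
                  using est[OF p q] by metis
                then show ?thesis by (intro exI[of _ N] conjI ballI impI) (simp_all only: M emeasure_slab_measure)
              qed
            next
              show "emeasure ?M (- graph) = 0" by (subst M) auto
            qed
            show "emeasure ?M' A \<le> ennreal q * emeasure ?M A"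
            proof (rule emeasure_le_locally[OF sM' sM _ graph_borel 0 A])
              fix p assume p: "p \<in> graph"
              show "\<exists>N. open N \<and> p \<in> N \<and> (\<forall>A\<in>sets borel. A \<subseteq> N \<longrightarrow> emeasure ?M' A \<le> ennreal q * emeasure ?M A)"
              proof -
                obtain N where N: "open N" "p \<in> N" "\<forall>A\<in>sets borel. A \<subseteq> N \<longrightarrow> \<kappa> * slab A \<le> ennreal q * emeasure ?H (A \<inter> graph)"
                  using est[OF p q] by metis
                then show ?thesis by (intro exI[of _ N] conjI ballI impI) (simp_all only: M emeasure_slab_measure)
              qed
            qed
          qed
        qed (simp add: sM')
      qed
    qed
  next
    case zero
    show ?thesis
    proof (rule that[of 0], simp, intro allI impI)
      fix e :: 'a and D t assume "graph_chart e D t"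
      then interpret graph_chart e D t .
      have 0: "emeasure (density ?H (indicator graph)) A = 0" if "A \<in> sets borel" for A
      proof -
        have "emeasure (density ?H (indicator graph)) A = (\<integral>\<^sup>+x. indicator graph x * indicator A x \<partial>?H)"
          using that by (intro emeasure_density) auto
        also have "\<dots> \<le> (\<integral>\<^sup>+x. indicator UNIV x \<partial>?H)"
          by (intro nn_integral_mono) (auto simp: indicator_def)
        also have "\<dots> = 0" using zero by (subst nn_integral_indicator) auto
        finally show ?thesis by simp
      qed
      show "density ?H (indicator graph) = slab_measure 0"
      proof (intro measure_eqI)
        fix A assume "A \<in> sets (density ?H (indicator graph))"
        then have A: "A \<in> sets borel" by simp
        show "emeasure (density ?H (indicator graph)) A = emeasure (slab_measure 0) A"
          using 0[OF A] emeasure_slab_measure[OF A, of 0] by simp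
      qed (simp add: slab_measure_def)
    qed
  qed
qed

section \<open>The divergence theorem\<close>

text \<open>The mean value theorem along \<open>h\<close> reduces the second difference to a difference of gradients, to which
  the derivative of the gradient applies.\<close>

lemma second_difference_estimate:
  fixes f :: "'a::euclidean_space \<Rightarrow> real" and g :: "'a \<Rightarrow> 'a"
  assumes U: "open U" "x \<in> U" and f: "\<And>y. y \<in> U \<Longrightarrow> (f has_derivative (\<lambda>h. g y \<bullet> h)) (at y)"
    and g: "(g has_derivative L) (at x)" and "\<epsilon> > 0"
  obtains \<delta> where "\<delta> > 0" "\<And>\<tau>. 0 < \<tau> \<Longrightarrow> \<tau> < \<delta> \<Longrightarrow>
    \<bar>(f (x + \<tau> *\<^sub>R h + \<tau> *\<^sub>R k) - f (x + \<tau> *\<^sub>R h) - f (x + \<tau> *\<^sub>R k) + f x) - \<tau>\<^sup>2 * (L k \<bullet> h)\<bar>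
      \<le> \<epsilon> * \<tau>\<^sup>2 * ((2 * norm h + norm k) * norm h)"
proof -
  interpret L: bounded_linear L using g by (rule has_derivative_bounded_linear)
  obtain d1 where d1: "d1 > 0" "ball x d1 \<subseteq> U" using U open_contains_ball by blast
  obtain d2 where d2: "d2 > 0" "\<And>y. norm (y - x) < d2 \<Longrightarrow> norm (g y - g x - L (y - x)) \<le> \<epsilon> * norm (y - x)"
    using g \<open>\<epsilon> > 0\<close> unfolding has_derivative_at_alt by blast
  define d where "d = min d1 d2"
  define \<delta> where "\<delta> = d / (norm h + norm k + 1)"
  have pos: "0 < norm h + norm k + 1" using norm_ge_zero[of h] norm_ge_zero[of k] by linarith
  have "\<delta> > 0" using d1 d2 pos by (simp add: \<delta>_def d_def)
  moreover have "\<bar>(f (x + \<tau> *\<^sub>R h + \<tau> *\<^sub>R k) - f (x + \<tau> *\<^sub>R h) - f (x + \<tau> *\<^sub>R k) + f x) - \<tau>\<^sup>2 * (L k \<bullet> h)\<bar>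
      \<le> \<epsilon> * \<tau>\<^sup>2 * ((2 * norm h + norm k) * norm h)" if \<tau>: "0 < \<tau>" "\<tau> < \<delta>" for \<tau>
  proof -
    have small: "norm (s *\<^sub>R h + c *\<^sub>R k) < d" if "0 \<le> s" "s \<le> \<tau>" "0 \<le> c" "c \<le> \<tau>" for s c
    proof -
      have "norm (s *\<^sub>R h + c *\<^sub>R k) \<le> s * norm h + c * norm k"
        using norm_triangle_ineq[of "s *\<^sub>R h" "c *\<^sub>R k"] that by simp
      also have "\<dots> \<le> \<tau> * norm h + \<tau> * norm k" using that by (intro add_mono mult_right_mono) auto
      also have "\<dots> \<le> \<tau> * (norm h + norm k + 1)" using \<tau> by (simp add: algebra_simps)
      also have "\<dots> < d" using \<tau> pos by (simp add: \<delta>_def pos_less_divide_eq)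
      finally show ?thesis .
    qed
    define \<phi> where "\<phi> s = f (x + s *\<^sub>R h + \<tau> *\<^sub>R k) - f (x + s *\<^sub>R h)" for s
    define \<phi>' where "\<phi>' s = (g (x + s *\<^sub>R h + \<tau> *\<^sub>R k) - g (x + s *\<^sub>R h)) \<bullet> h" for s
    have der: "((\<lambda>s. f (x + s *\<^sub>R h + c *\<^sub>R k)) has_real_derivative g (x + s *\<^sub>R h + c *\<^sub>R k) \<bullet> h) (at s)"
      if "0 \<le> s" "s \<le> \<tau>" "0 \<le> c" "c \<le> \<tau>" for s c
    proof -
      have "x + s *\<^sub>R h + c *\<^sub>R k \<in> U"
      proof (rule subsetD[OF d1(2)])
        have "dist x (x + (s *\<^sub>R h + c *\<^sub>R k)) = norm (s *\<^sub>R h + c *\<^sub>R k)" unfolding dist_norm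
          by (metis add_diff_cancel_left' norm_minus_commute)
        then show "x + s *\<^sub>R h + c *\<^sub>R k \<in> ball x d1"
          using small[OF that] by (simp add: d_def add.assoc)
      qed
      moreover have "((\<lambda>s. x + s *\<^sub>R h + c *\<^sub>R k) has_derivative (\<lambda>r. r *\<^sub>R h)) (at s)"
        by (auto intro!: derivative_eq_intros)
      ultimately have "((\<lambda>s. f (x + s *\<^sub>R h + c *\<^sub>R k)) has_derivative (\<lambda>r. g (x + s *\<^sub>R h + c *\<^sub>R k) \<bullet> (r *\<^sub>R h))) (at s)"
        by (intro has_derivative_compose[OF _ f])
      then show ?thesis unfolding has_field_derivative_def by (simp add: mult.commute[of _ "g _ \<bullet> h"])
    qed
    have "(\<phi> has_real_derivative \<phi>' s) (at s)" if "0 \<le> s" "s \<le> \<tau>" for s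
      using DERIV_diff[OF der[of s \<tau>] der[of s 0]] that \<tau> by (simp add: \<phi>_def[abs_def] \<phi>'_def inner_diff_left)
    then obtain s where s: "0 < s" "s < \<tau>" "\<phi> \<tau> - \<phi> 0 = (\<tau> - 0) * \<phi>' s"
      using MVT2[of 0 \<tau> \<phi> \<phi>'] \<tau> by blast
    let ?u = "s *\<^sub>R h + \<tau> *\<^sub>R k" and ?v = "s *\<^sub>R h + 0 *\<^sub>R k"
    define E where "E u = g (x + u) - g x - L u" for u
    have E: "norm (E u) \<le> \<epsilon> * norm u" if "norm u < d" for u
      using d2(2)[of "x + u"] that by (simp add: E_def d_def)
    have u: "norm ?u \<le> \<tau> * (norm h + norm k)" and v: "norm ?v \<le> \<tau> * norm h"
      using norm_triangle_ineq[of "s *\<^sub>R h" "\<tau> *\<^sub>R k"] mult_right_mono[of s \<tau> "norm h"] s \<tau>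
      by (auto simp: algebra_simps)
    have "g (x + ?u) - g (x + ?v) = E ?u - E ?v + \<tau> *\<^sub>R L k"
      by (simp add: E_def L.add L.scale)
    then have \<phi>': "\<phi>' s = (E ?u - E ?v) \<bullet> h + \<tau> * (L k \<bullet> h)"
      by (simp add: \<phi>'_def add.assoc flip: inner_scaleR_left inner_add_left)
    have "norm (E ?u - E ?v) \<le> \<epsilon> * norm ?u + \<epsilon> * norm ?v"
      using norm_triangle_ineq4[of "E ?u" "E ?v"] E[OF small, of s \<tau>] E[OF small, of s 0] s \<tau> by linarith
    also have "\<dots> \<le> \<epsilon> * (\<tau> * (norm h + norm k)) + \<epsilon> * (\<tau> * norm h)"
      using \<open>\<epsilon> > 0\<close> u v by (intro add_mono mult_left_mono) auto
    finally have "norm (E ?u - E ?v) * norm h \<le> \<epsilon> * \<tau> * (2 * norm h + norm k) * norm h"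
      by (intro mult_right_mono) (simp_all add: algebra_simps)
    then have EE: "\<bar>(E ?u - E ?v) \<bullet> h\<bar> \<le> \<epsilon> * \<tau> * (2 * norm h + norm k) * norm h"
      using Cauchy_Schwarz_ineq2[of "E ?u - E ?v" h] by linarith
    have "f (x + \<tau> *\<^sub>R h + \<tau> *\<^sub>R k) - f (x + \<tau> *\<^sub>R h) - f (x + \<tau> *\<^sub>R k) + f x = \<tau> * \<phi>' s"
      using s(3) by (simp add: \<phi>_def)
    then have "(f (x + \<tau> *\<^sub>R h + \<tau> *\<^sub>R k) - f (x + \<tau> *\<^sub>R h) - f (x + \<tau> *\<^sub>R k) + f x) - \<tau>\<^sup>2 * (L k \<bullet> h)
        = \<tau> * ((E ?u - E ?v) \<bullet> h)"
      unfolding \<phi>' by (simp add: power2_eq_square algebra_simps)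
    then have "\<bar>(f (x + \<tau> *\<^sub>R h + \<tau> *\<^sub>R k) - f (x + \<tau> *\<^sub>R h) - f (x + \<tau> *\<^sub>R k) + f x) - \<tau>\<^sup>2 * (L k \<bullet> h)\<bar>
        = \<tau> * \<bar>(E ?u - E ?v) \<bullet> h\<bar>" using \<tau> by (simp add: abs_mult)
    also have "\<dots> \<le> \<tau> * (\<epsilon> * \<tau> * (2 * norm h + norm k) * norm h)" using \<tau> by (intro mult_left_mono EE) simp
    finally show ?thesis by (simp add: power2_eq_square mult_ac)
  qed
  ultimately show ?thesis using that by blast
qed

text \<open>Both mixed derivatives are the limit of the same second difference quotient.\<close>

lemma hessian_symmetric:
  fixes f :: "'a::euclidean_space \<Rightarrow> real" and g :: "'a \<Rightarrow> 'a"
  assumes U: "open U" "x \<in> U" and f: "\<And>y. y \<in> U \<Longrightarrow> (f has_derivative (\<lambda>h. g y \<bullet> h)) (at y)"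
    and g: "(g has_derivative L) (at x)"
  shows "L h \<bullet> k = L k \<bullet> h"
proof -
  define C where "C = (2 * norm h + norm k) * norm h + (2 * norm k + norm h) * norm k + 1"
  have C: "C > 0"
    unfolding C_def by (intro add_nonneg_pos add_nonneg_nonneg mult_nonneg_nonneg) auto
  have "\<bar>L k \<bullet> h - L h \<bullet> k\<bar> \<le> e" if "e > 0" for e
  proof -
    define \<epsilon> where "\<epsilon> = e / C"
    have \<epsilon>: "\<epsilon> > 0" using that C by (simp add: \<epsilon>_def)
    obtain \<delta>1 where 1: "\<delta>1 > 0" "\<And>\<tau>. 0 < \<tau> \<Longrightarrow> \<tau> < \<delta>1 \<Longrightarrow>
      \<bar>(f (x + \<tau> *\<^sub>R h + \<tau> *\<^sub>R k) - f (x + \<tau> *\<^sub>R h) - f (x + \<tau> *\<^sub>R k) + f x) - \<tau>\<^sup>2 * (L k \<bullet> h)\<bar>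
      \<le> \<epsilon> * \<tau>\<^sup>2 * ((2 * norm h + norm k) * norm h)"
      using second_difference_estimate[OF U f g \<epsilon>, of h k] by blast
    obtain \<delta>2 where 2: "\<delta>2 > 0" "\<And>\<tau>. 0 < \<tau> \<Longrightarrow> \<tau> < \<delta>2 \<Longrightarrow>
      \<bar>(f (x + \<tau> *\<^sub>R k + \<tau> *\<^sub>R h) - f (x + \<tau> *\<^sub>R k) - f (x + \<tau> *\<^sub>R h) + f x) - \<tau>\<^sup>2 * (L h \<bullet> k)\<bar>
      \<le> \<epsilon> * \<tau>\<^sup>2 * ((2 * norm k + norm h) * norm k)"
      using second_difference_estimate[OF U f g \<epsilon>, of k h] by blast
    define \<tau> where "\<tau> = min \<delta>1 \<delta>2 / 2"
    have \<tau>: "0 < \<tau>" "\<tau> < \<delta>1" "\<tau> < \<delta>2" using 1(1) 2(1) by (auto simp: \<tau>_def)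
    have comm: "x + \<tau> *\<^sub>R k + \<tau> *\<^sub>R h = x + \<tau> *\<^sub>R h + \<tau> *\<^sub>R k" by simp
    have "\<bar>\<tau>\<^sup>2 * (L k \<bullet> h) - \<tau>\<^sup>2 * (L h \<bullet> k)\<bar>
        \<le> \<epsilon> * \<tau>\<^sup>2 * ((2 * norm h + norm k) * norm h) + \<epsilon> * \<tau>\<^sup>2 * ((2 * norm k + norm h) * norm k)"
      using 1(2)[OF \<tau>(1,2)] 2(2)[OF \<tau>(1,3)] unfolding comm by linarith
    also have "\<dots> \<le> \<epsilon> * \<tau>\<^sup>2 * C" unfolding C_def distrib_left using \<epsilon> by simp
    also have "\<bar>\<tau>\<^sup>2 * (L k \<bullet> h) - \<tau>\<^sup>2 * (L h \<bullet> k)\<bar> = \<tau>\<^sup>2 * \<bar>L k \<bullet> h - L h \<bullet> k\<bar>"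
      by (simp add: abs_mult flip: right_diff_distrib)
    finally have "\<tau>\<^sup>2 * \<bar>L k \<bullet> h - L h \<bullet> k\<bar> \<le> \<tau>\<^sup>2 * e" using C by (simp add: \<epsilon>_def mult.commute)
    then show ?thesis using \<tau>(1) by simp
  qed
  then have "\<bar>L k \<bullet> h - L h \<bullet> k\<bar> \<le> 0" by (rule field_le_epsilon[of _ 0, simplified])
  then show ?thesis by simp
qed

lemma DERIV_sqpos: "((\<lambda>u. (max 0 u)\<^sup>2) has_real_derivative 2 * max 0 u) (at u)" for u :: real
proof -
  consider "u > 0" | "u < 0" | "u = 0" by linarith
  then show ?thesis
  proof cases
    case 1
    have "((\<lambda>u. u\<^sup>2) has_real_derivative 2 * max 0 u) (at u)"
      using 1 by (auto intro!: derivative_eq_intros)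
    then show ?thesis
      by (rule has_field_derivative_transform_within_open[of _ _ _ "{0<..}"]) (use 1 in \<open>auto simp: max_def\<close>)
  next
    case 2
    have "((\<lambda>u. 0) has_real_derivative 2 * max 0 u) (at u)" using 2 by (simp add: max_def)
    then show ?thesis
      by (rule has_field_derivative_transform_within_open[of _ _ _ "{..<0}"]) (use 2 in \<open>auto simp: max_def\<close>)
  next
    case 3
    have "((\<lambda>y::real. (max 0 y)\<^sup>2 / y) \<longlongrightarrow> 0) (at 0)"
    proof (rule Lim_null_comparison)
      show "eventually (\<lambda>y::real. norm ((max 0 y)\<^sup>2 / y) \<le> \<bar>y\<bar>) (at 0)"
        by (intro always_eventually allI) (auto simp: max_def power2_eq_square)
      show "((\<lambda>y::real. \<bar>y\<bar>) \<longlongrightarrow> 0) (at 0)" by (intro tendsto_eq_intros) auto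
    qed
    then show ?thesis using 3 by (simp add: has_field_derivative_iff)
  qed
qed

lemma Ck_on_sqpos:
  assumes "open U" "Ck_on (Suc 0) U f"
  shows "Ck_on (Suc 0) U (\<lambda>x. (max 0 (f x))\<^sup>2)"
proof (rule Ck_on_SucI)
  have cont: "continuous_on U f" by (rule Ck_on_continuous[OF assms(2)])
  show "((\<lambda>x. (max 0 (f x))\<^sup>2) has_derivative (\<lambda>h. 2 * max 0 (f x) * frechet_derivative f (at x) h)) (at x)"
    if "x \<in> U" for x
    using has_derivative_compose[OF has_derivative_frechet, of f x "\<lambda>u. (max 0 u)\<^sup>2" "\<lambda>h. 2 * max 0 (f x) * h"]
      DERIV_sqpos[of "f x"] assms(2) that by (simp add: has_field_derivative_def)
  show "Ck_on 0 U (\<lambda>x. 2 * max 0 (f x) * frechet_derivative f (at x) b)" if "b \<in> Basis" for b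
    using assms(2) that cont by (auto intro!: continuous_intros)
qed fact

lemma divergence_scaleR:
  assumes "s differentiable (at x)" "X differentiable (at x)"
  shows "divergence (\<lambda>x. s x *\<^sub>R X x) x = s x * divergence X x + grad s x \<bullet> X x"
proof -
  have "frechet_derivative (\<lambda>x. s x *\<^sub>R X x) (at x)
      = (\<lambda>h. s x *\<^sub>R frechet_derivative X (at x) h + frechet_derivative s (at x) h *\<^sub>R X x)"
    by (intro frechet_derivative_eq has_derivative_scaleR has_derivative_frechet assms)
  then show ?thesis
    unfolding divergence_def grad_def
    by (simp add: inner_add_left sum.distrib sum_distrib_left inner_sum_left inner_commute[of "X x"])
qed

lemma divergence_cong_open:
  assumes "open U" "x \<in> U" "\<And>y. y \<in> U \<Longrightarrow> X y = Y y" "X differentiable (at x)"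
  shows "divergence X x = divergence Y x" "frechet_derivative X (at x) = frechet_derivative Y (at x)"
proof -
  have "(Y has_derivative frechet_derivative X (at x)) (at x)"
    by (rule has_derivative_transform_within_open[OF has_derivative_frechet[OF assms(4)] assms(1,2,3)])
  then show 1: "frechet_derivative X (at x) = frechet_derivative Y (at x)"
    by (simp add: frechet_derivative_eq)
  show "divergence X x = divergence Y x" by (simp add: divergence_def 1)
qed

lemma Ck_on_UNIV_extension:
  assumes "open D" "compact K" "K \<subseteq> D" "Ck_on k D f" "\<And>x. x \<notin> K \<Longrightarrow> f x = 0"
  shows "Ck_on k UNIV f"
proof (rule Ck_on_local)
  fix x
  show "\<exists>W. open W \<and> x \<in> W \<and> Ck_on k W f"
  proof (cases "x \<in> D")
    case False
    have "open (- K)" using assms(2) by (simp add: compact_imp_closed open_Compl)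
    moreover have "Ck_on k (- K) f"
      by (rule Ck_on_cong[OF \<open>open (- K)\<close> _ Ck_on_const[of k "- K" 0]]) (use assms(5) in auto)
    ultimately show ?thesis using False assms(3) by (intro exI[of _ "- K"]) auto
  qed (use assms in auto)
qed

text \<open>The derivative of a compactly supported function has integral zero, because the function and
  its translates have the same integral.\<close>

lemma integral_partial_derivative_zero:
  fixes f :: "'a::euclidean_space \<Rightarrow> real"
  assumes f: "Ck_on (Suc 0) UNIV f" and K: "compact K" "\<And>x. x \<notin> K \<Longrightarrow> f x = 0" and b: "b \<in> Basis"
  shows "integrable lborel (\<lambda>x. frechet_derivative f (at x) b)"
    and "(LINT x|lborel. frechet_derivative f (at x) b) = 0"
proof -
  define g where "g x = frechet_derivative f (at x) b" for x
  have contf: "continuous_on UNIV f" by (rule Ck_on_continuous[OF f])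
  have contg: "continuous_on UNIV g" using f b by (simp add: g_def[abs_def])
  have der: "(f has_derivative frechet_derivative f (at x)) (at x)" for x
    using f by (intro has_derivative_frechet) simp
  \<comment> \<open>Difference quotients with steps up to \<open>1\<close> vanish off \<open>K'\<close>, and \<open>K2\<close> contains the points at which the
    mean value theorem evaluates the derivative.\<close>
  define K' where "K' = (\<lambda>(y, s). y - s *\<^sub>R b) ` (K \<times> {0..1::real})"
  have K': "compact K'" unfolding K'_def using K(1)
    by (intro compact_continuous_image compact_Times) (auto intro!: continuous_intros simp: case_prod_beta)
  have outside: "f (x + s *\<^sub>R b) = 0" if "x \<notin> K'" "0 \<le> s" "s \<le> 1" for x s
  proof (rule K(2), rule notI)
    assume "x + s *\<^sub>R b \<in> K"
    then have "(\<lambda>(y, s). y - s *\<^sub>R b) (x + s *\<^sub>R b, s) \<in> K'"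
      unfolding K'_def using that by (intro imageI) auto
    then show False using that by simp
  qed
  have derline: "((\<lambda>s. f (x + s *\<^sub>R b)) has_real_derivative g (x + s *\<^sub>R b)) (at s)" for x s
  proof -
    have "((\<lambda>s. x + s *\<^sub>R b) has_derivative (\<lambda>r. r *\<^sub>R b)) (at s)" by (auto intro!: derivative_eq_intros)
    from has_derivative_compose[OF this der]
    have "((\<lambda>s. f (x + s *\<^sub>R b)) has_derivative (\<lambda>r. frechet_derivative f (at (x + s *\<^sub>R b)) (r *\<^sub>R b))) (at s)" .
    then show ?thesis
      using linear_scale[OF has_derivative_linear[OF der[of "x + s *\<^sub>R b"]]]
      by (simp add: has_field_derivative_def g_def mult.commute[of _ "frechet_derivative _ _ _"])
  qed
  have g0: "g x = 0" if "x \<notin> K'" for x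
  proof -
    have "- K' \<subseteq> {x. f x = 0}" using outside[of _ 0] by auto
    moreover have "open (- K')" using K' by (simp add: compact_imp_closed open_Compl)
    ultimately have "(f has_derivative (\<lambda>h. 0)) (at x)"
      using that by (intro has_derivative_transform_within_open[OF has_derivative_const[of 0], of "- K'"]) auto
    then show ?thesis by (simp add: g_def frechet_derivative_eq)
  qed
  have intf: "integrable lborel f"
  proof -
    have "(\<lambda>x. indicator K x *\<^sub>R f x) = f" using K(2) by (auto simp: indicator_def fun_eq_iff)
    then show ?thesis using borel_integrable_compact[OF K(1) continuous_on_subset[OF contf subset_UNIV]] by simp
  qed
  define Q where "Q k x = (f (x + (1 / real (Suc k)) *\<^sub>R b) - f x) / (1 / real (Suc k))" for k x
  have f_shift: "integrable lborel (\<lambda>x. f (x + c))" "(LINT x|lborel. f (x + c)) = (LINT x|lborel. f x)" for c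
  proof -
    have fm: "f \<in> borel_measurable borel" by (rule borel_measurable_continuous_onI[OF contf])
    show "(LINT x|lborel. f (x + c)) = (LINT x|lborel. f x)"
      using integral_distr[of "(+) c" lborel borel f] fm by (simp add: lborel_distr_plus add.commute)
    show "integrable lborel (\<lambda>x. f (x + c))"
      using integrable_distr_eq[of "(+) c" lborel borel f] fm intf by (simp add: lborel_distr_plus add.commute)
  qed
  have intQ: "(LINT x|lborel. Q k x) = 0" for k
    using f_shift intf by (simp add: Q_def[abs_def])
  define K2 where "K2 = (\<lambda>(y, s). y + s *\<^sub>R b) ` (K' \<times> {0..1::real})"
  have K2: "compact K2" unfolding K2_def using K'
    by (intro compact_continuous_image compact_Times) (auto intro!: continuous_intros simp: case_prod_beta)
  then have "bounded (g ` K2)"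
    using contg by (intro compact_imp_bounded compact_continuous_image) (auto intro: continuous_on_subset)
  then obtain B where B: "\<And>x. x \<in> K2 \<Longrightarrow> \<bar>g x\<bar> \<le> B" by (auto simp: bounded_iff)
  have Qmvt: "\<exists>s. 0 < s \<and> s < 1 / real (Suc k) \<and> Q k x = g (x + s *\<^sub>R b)" for k x
  proof -
    have "\<exists>s>0. s < 1 / real (Suc k) \<and> f (x + (1 / real (Suc k)) *\<^sub>R b) - f (x + 0 *\<^sub>R b) = (1 / real (Suc k) - 0) * g (x + s *\<^sub>R b)"
      by (rule MVT2) (auto intro: derline)
    then show ?thesis by (auto simp: Q_def)
  qed
  have "integrable lborel g \<and> (\<lambda>k. LINT x|lborel. Q k x) \<longlonglongrightarrow> (LINT x|lborel. g x)"
  proof -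
    have *: "g \<in> borel_measurable lborel" "\<And>k. Q k \<in> borel_measurable lborel"
      "integrable lborel (\<lambda>x. indicator K' x *\<^sub>R B)"
      "AE x in lborel. (\<lambda>k. Q k x) \<longlonglongrightarrow> g x"
      "\<And>k. AE x in lborel. norm (Q k x) \<le> indicator K' x *\<^sub>R B"
    proof -
      show "g \<in> borel_measurable lborel" using borel_measurable_continuous_onI[OF contg] by simp
      show "Q k \<in> borel_measurable lborel" for k
        using f_shift(1)[of "(1 / real (Suc k)) *\<^sub>R b"] intf unfolding Q_def[abs_def] by (intro borel_measurable_divide borel_measurable_diff) (auto dest: borel_measurable_integrable)
      show "integrable lborel (\<lambda>x. indicator K' x *\<^sub>R B)"
        by (rule borel_integrable_compact[OF K']) (intro continuous_intros)
      show "AE x in lborel. (\<lambda>k. Q k x) \<longlonglongrightarrow> g x"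
      proof (rule AE_I2)
        fix x
        have "(\<lambda>k. (f (x + (inverse (real (Suc k))) *\<^sub>R b) - f (x + 0 *\<^sub>R b)) / (inverse (real (Suc k)) - 0)) \<longlonglongrightarrow> g (x + 0 *\<^sub>R b)"
          using derline[of x 0] unfolding has_field_derivative_iff
          by (rule filterlim_compose) (auto simp: filterlim_at simp del: of_nat_Suc intro!: LIMSEQ_inverse_real_of_nat)
        then show "(\<lambda>k. Q k x) \<longlonglongrightarrow> g x" by (simp add: Q_def inverse_eq_divide)
      qed
      show "AE x in lborel. norm (Q k x) \<le> indicator K' x *\<^sub>R B" for k
      proof (rule AE_I2)
        fix x
        show "norm (Q k x) \<le> indicator K' x *\<^sub>R B"
        proof (cases "x \<in> K'")
          case True
          obtain s where s: "0 < s" "s < 1 / real (Suc k)" "Q k x = g (x + s *\<^sub>R b)" using Qmvt by blast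
          have "1 / real (Suc k) \<le> 1" by simp
          then have "s \<le> 1" using s by linarith
          then have "x + s *\<^sub>R b \<in> K2" unfolding K2_def using True s by (intro image_eqI[of _ _ "(x, s)"]) auto
          then show ?thesis using B True s(3) by simp
        next
          case False
          have "1 / real (Suc k) \<le> 1" by simp
          then show ?thesis using False outside[OF False, of 0] outside[OF False, of "1 / real (Suc k)"] by (simp add: Q_def)
        qed
      qed
    qed
    then show ?thesis
      using integral_dominated_convergence[OF *(1,2,3,4,5)] integrable_dominated_convergence[OF *(1,2,3,4,5)] by blast
  qed
  then show "integrable lborel (\<lambda>x. frechet_derivative f (at x) b)" "(LINT x|lborel. frechet_derivative f (at x) b) = 0"
    using intQ LIMSEQ_unique[of "\<lambda>k. LINT x|lborel. Q k x" 0 "LINT x|lborel. g x"] by (auto simp: g_def[abs_def])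
qed

lemma integral_divergence_zero:
  fixes X :: "'a::euclidean_space \<Rightarrow> 'a"
  assumes X: "Ck_field (Suc 0) UNIV X" and K: "compact K" "\<And>x. x \<notin> K \<Longrightarrow> X x = 0"
  shows "(LINT x|lborel. divergence X x) = 0"
proof -
  have eq: "divergence X x = (\<Sum>b\<in>Basis. frechet_derivative (\<lambda>y. X y \<bullet> b) (at x) b)" for x
    unfolding divergence_def using Ck_field_differentiable[OF X]
    by (simp add: frechet_derivative_inner)
  note * = integral_partial_derivative_zero[OF _ K(1), of "\<lambda>y. X y \<bullet> _"]
  show ?thesis unfolding eq
    by (subst Bochner_Integration.integral_sum)
      (use X K(2) in \<open>auto intro!: * sum.neutral simp: Ck_field_def simp del: Ck_on.simps\<close>)
qed

context graph_chart
begin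

abbreviation "n \<equiv> unit_grad t"

lemma chart_point:
  assumes "graph = S \<inter> W1" "open W1" "y \<in> graph"
  shows "hypersurface_point S y (D \<inter> W1) t"
proof
  show "local_defining S y (D \<inter> W1) t" unfolding local_defining_def
  proof (intro conjI ballI)
    show "smooth_on (D \<inter> W1) t" using t_smooth unfolding smooth_on_def by (auto intro: Ck_on_subset)
    show "S \<inter> (D \<inter> W1) = {y \<in> D \<inter> W1. t y = 0}" using assms(1) by (auto simp: graph_def)
  qed (use assms open_D grad_t_nonzero graph_subset in auto)
qed (use assms in auto)

text \<open>Since \<open>X\<close> is tangent to the level sets of \<open>t\<close>, the derivative of \<open>bump (t z)\<close> does not
  contribute, and the symmetry of the Hessian of \<open>t\<close> turns the derivative of the area element
  \<open>|\<nabla>t|\<close> along \<open>X\<close> into the normal part of the divergence.\<close>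

lemma divergence_weighted_tangential:
  assumes X: "Ck_field (Suc 0) D X" and tang: "\<And>z. z \<in> D \<Longrightarrow> X z \<bullet> grad t z = 0" and z: "z \<in> D"
  shows "divergence (\<lambda>z. (bump (t z) * norm (grad t z)) *\<^sub>R X z) z
    = bump (t z) * norm (grad t z) * (divergence X z - frechet_derivative X (at z) (n z) \<bullet> n z)"
proof -
  have Xd: "X differentiable (at z)" by (rule Ck_field_differentiable[OF X z])
  have gC: "Ck_field (Suc k) D (grad t)" for k
    using t_smooth by (intro Ck_field_grad) (simp add: smooth_on_def del: Ck_on.simps)
  have gd: "(grad t has_derivative frechet_derivative (grad t) (at z)) (at z)"
    by (intro has_derivative_frechet Ck_field_differentiable[OF gC z])
  let ?L = "frechet_derivative (grad t) (at z)" and ?g = "grad t z"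
  have L_lin: "linear ?L" by (rule has_derivative_linear[OF gd])
  have g0: "?g \<noteq> 0" by (rule grad_t_nonzero[OF z])
  have gn: "?g = norm ?g *\<^sub>R n z" using g0 by (simp add: unit_grad_def)
  have sym: "?L h \<bullet> k = ?L k \<bullet> h" for h k
    by (rule hessian_symmetric[OF open_D z t_has_derivative gd])
  have bump_der: "((\<lambda>z. bump (t z)) has_derivative (\<lambda>h. (2 * max 0 (1 - (t z)\<^sup>2) * (- 2 * t z)) * (?g \<bullet> h))) (at z)"
  proof -
    have "((\<lambda>z. 1 - (t z)\<^sup>2) has_derivative (\<lambda>h. (- 2 * t z) * (?g \<bullet> h))) (at z)"
      by (auto intro!: derivative_eq_intros t_has_derivative[OF z])
    from has_derivative_compose[OF this DERIV_sqpos[unfolded has_field_derivative_def]]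
    show ?thesis unfolding bump_def[abs_def] by (simp add: mult.assoc)
  qed
  have norm_der: "((\<lambda>z. norm (grad t z)) has_derivative (\<lambda>h. ?L h \<bullet> n z)) (at z)"
    using has_derivative_compose[OF gd has_derivative_norm[OF g0]]
    by (simp add: unit_grad_def sgn_div_norm inner_commute)
  let ?s = "\<lambda>z. bump (t z) * norm (grad t z)"
  have s_der: "(?s has_derivative (\<lambda>h. bump (t z) * (?L h \<bullet> n z)
      + (2 * max 0 (1 - (t z)\<^sup>2) * (- 2 * t z)) * (?g \<bullet> h) * norm ?g)) (at z)"
    by (rule has_derivative_mult[OF bump_der norm_der])
  then have sd: "?s differentiable (at z)" by (auto simp: differentiable_def)
  have "grad ?s z \<bullet> X z = frechet_derivative ?s (at z) (X z)"
    by (rule frechet_derivative_grad[OF sd, symmetric])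
  also have "\<dots> = bump (t z) * (?L (X z) \<bullet> n z)"
    using tang[OF z] by (simp add: frechet_derivative_eq[OF s_der] inner_commute)
  also have "?L (X z) \<bullet> n z = ?L (n z) \<bullet> X z" by (rule sym)
  also have "\<dots> = - (frechet_derivative X (at z) (n z) \<bullet> ?g)"
  proof -
    have "((\<lambda>z. X z \<bullet> grad t z) has_derivative (\<lambda>h. X z \<bullet> ?L h + frechet_derivative X (at z) h \<bullet> ?g)) (at z)"
      by (intro has_derivative_inner has_derivative_frechet[OF Xd] gd)
    moreover have "((\<lambda>z. X z \<bullet> grad t z) has_derivative (\<lambda>h. 0)) (at z)"
      by (rule has_derivative_transform_within_open[OF has_derivative_const[of 0] open_D z]) (simp add: tang)
    ultimately have "(\<lambda>h. X z \<bullet> ?L h + frechet_derivative X (at z) h \<bullet> ?g) = (\<lambda>h. 0)"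
      by (rule has_derivative_unique)
    from fun_cong[OF this, of "n z"] show ?thesis by (simp add: inner_commute)
  qed
  also have "frechet_derivative X (at z) (n z) \<bullet> ?g = norm ?g * (frechet_derivative X (at z) (n z) \<bullet> n z)"
    by (rule trans[OF arg_cong[OF gn, of "\<lambda>v. frechet_derivative X (at z) (n z) \<bullet> v"]]) simp
  finally show ?thesis
    unfolding divergence_scaleR[OF sd Xd] by (simp add: algebra_simps)
qed

lemma density_graph_emeasure:
  assumes "A \<in> sets borel" "A \<subseteq> graph"
  shows "emeasure (density (hausdorff_measure m) (indicator graph)) A = emeasure (hausdorff_measure m) A"
proof -
  have "emeasure (density (hausdorff_measure m) (indicator graph)) A = (\<integral>\<^sup>+x. indicator graph x * indicator A x \<partial>hausdorff_measure m)"
    using assms by (intro emeasure_density) auto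
  also have "\<dots> = (\<integral>\<^sup>+x. indicator A x \<partial>hausdorff_measure m)"
    using assms(2) by (intro nn_integral_cong) (auto simp: indicator_def)
  also have "\<dots> = emeasure (hausdorff_measure m) A" using assms(1) by (intro nn_integral_indicator) auto
  finally show ?thesis .
qed

text \<open>The support of the slab over \<open>A\<close>.\<close>

definition "thicken A = (\<lambda>(y, s). y + s *\<^sub>R e) ` (A \<times> {-1..1::real})"

lemma thicken:
  assumes "compact A" "A \<subseteq> graph"
  shows "compact (thicken A)" "thicken A \<subseteq> D" "\<And>z. z \<in> D \<Longrightarrow> z \<notin> thicken A \<Longrightarrow> pr z \<in> A \<Longrightarrow> bump (t z) = 0"
proof -
  show "compact (thicken A)" unfolding thicken_def using assms(1)
    by (intro compact_continuous_image compact_Times) (auto intro!: continuous_intros simp: case_prod_beta)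
  show "thicken A \<subseteq> D" using assms(2) graph_subset shift_D by (auto simp: thicken_def)
  fix z assume z: "z \<in> D" "z \<notin> thicken A" "pr z \<in> A"
  have "\<not> \<bar>t z\<bar> \<le> 1"
  proof
    assume "\<bar>t z\<bar> \<le> 1"
    then have "(\<lambda>(y, s). y + s *\<^sub>R e) (pr z, t z) \<in> thicken A"
      unfolding thicken_def using z(3) by (intro imageI) auto
    then show False using z(2) by (simp add: pr_def)
  qed
  then show "bump (t z) = 0" by (intro bump_outside) simp
qed

lemma hausdorff_compact_finite:
  assumes \<kappa>: "\<kappa> < \<infinity>" "density (hausdorff_measure m) (indicator graph) = slab_measure \<kappa>"
    and A: "compact A" "A \<subseteq> graph"
  shows "emeasure (hausdorff_measure m) A < \<infinity>"
proof -
  have Ab [measurable]: "A \<in> sets borel" using A(1) by (simp add: compact_imp_closed borel_closed)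
  have "compact ((\<lambda>z. norm (grad t z)) ` thicken A)"
    using thicken[OF A] continuous_grad_t
    by (intro compact_continuous_image continuous_on_norm) (auto intro: continuous_on_subset)
  then have "bounded ((\<lambda>z. norm (grad t z)) ` thicken A)" by (rule compact_imp_bounded)
  then obtain B where B: "\<And>z. z \<in> thicken A \<Longrightarrow> norm (grad t z) \<le> B" by (auto simp: bounded_iff)
  have eq: "emeasure (hausdorff_measure m) A = \<kappa> * slab A"
    using density_graph_emeasure[OF Ab A(2), of m] \<kappa>(2) emeasure_slab_measure[OF Ab] by simp
  have "slab A \<le> (\<integral>\<^sup>+z. ennreal B * indicator (thicken A) z \<partial>lborel)"
    unfolding slab_def
  proof (rule nn_integral_mono)
    fix z
    show "indicator (cyl A) z * ennreal (slope z * bump (t0 z)) \<le> ennreal B * indicator (thicken A) z"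
    proof (cases "z \<in> cyl A")
      case True
      then have z: "z \<in> D" "pr z \<in> A" by (auto simp: cyl_def)
      show ?thesis
      proof (cases "z \<in> thicken A")
        case True
        have "slope z * bump (t0 z) \<le> B * 1"
          using B[OF True] z(1) bump_le_1 by (intro mult_mono) (auto simp: slope_def intro: order_trans[OF norm_ge_zero])
        then show ?thesis using True \<open>z \<in> cyl A\<close> by (simp add: ennreal_leI)
      next
        case False
        then show ?thesis using thicken(3)[OF A z(1) False z(2)] z(1) by (simp add: t0_def)
      qed
    qed simp
  qed
  also have "\<dots> = ennreal B * emeasure lborel (thicken A)"
    using thicken(1)[OF A] by (subst nn_integral_cmult) (auto simp: compact_imp_closed borel_closed)
  also have "\<dots> < \<infinity>"
    using emeasure_compact_finite[OF thicken(1)[OF A]] by (simp add: ennreal_mult_less_top)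
  finally have "slab A < \<infinity>" .
  then show ?thesis using \<kappa>(1) by (simp add: eq ennreal_mult_less_top)
qed

text \<open>The area formula turns the integral over the graph into the integral over space of the divergence of
  the compactly supported field \<open>bump (t z) |\<nabla>t| X (pr z)\<close>.\<close>

lemma chart_divergence_theorem:
  assumes \<kappa>: "\<kappa> < \<infinity>" "density (hausdorff_measure m) (indicator graph) = slab_measure \<kappa>"
    and X: "Ck_field (Suc 0) D (\<lambda>z. X (pr z))" and tang: "\<And>z. z \<in> D \<Longrightarrow> X (pr z) \<bullet> grad t z = 0"
    and K: "compact K" "K \<subseteq> graph" "\<And>y. y \<in> graph \<Longrightarrow> y \<notin> K \<Longrightarrow> X y = 0"
  defines "\<delta> \<equiv> \<lambda>y. divergence (\<lambda>z. X (pr z)) y - frechet_derivative (\<lambda>z. X (pr z)) (at y) (n y) \<bullet> n y"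
  shows "(LINT y|hausdorff_measure m. indicator graph y *\<^sub>R \<delta> y) = 0"
proof -
  obtain k where k: "\<kappa> = ennreal k" "0 \<le> k" using \<kappa>(1) by (cases \<kappa>) auto
  let ?X = "\<lambda>z. X (pr z)"
  have n_C: "Ck_field k D n" for k
    using t_smooth grad_t_nonzero by (intro Ck_field_unit_grad open_D) (auto simp: smooth_on_def simp del: Ck_on.simps)
  have \<delta>_cont: "continuous_on D \<delta>"
  proof -
    have "Ck_on 0 D (divergence ?X)" by (rule Ck_on_divergence[OF X open_D])
    moreover have "continuous_on D (\<lambda>y. frechet_derivative ?X (at y) (n y))"
    proof -
      have "frechet_derivative ?X (at y) (n y) = (\<Sum>b\<in>Basis. (n y \<bullet> b) *\<^sub>R frechet_derivative ?X (at y) b)" if "y \<in> D" for y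
        by (rule linear_Basis_sum[OF linear_frechet_derivative[OF Ck_field_differentiable[OF X that]]])
      moreover have "continuous_on D (\<lambda>y. \<Sum>b\<in>Basis. (n y \<bullet> b) *\<^sub>R frechet_derivative ?X (at y) b)"
        using Ck_field_continuous[OF Ck_field_deriv[OF X open_D]] Ck_field_continuous[OF n_C[of 0]]
        by (intro continuous_intros) auto
      ultimately show ?thesis by (simp cong: continuous_on_cong)
    qed
    ultimately show ?thesis
      unfolding \<delta>_def using Ck_field_continuous[OF n_C[of 0]] by (auto intro!: continuous_intros)
  qed
  define f where "f = (\<lambda>y. indicator graph y *\<^sub>R \<delta> y)"
  have f_meas [measurable]: "f \<in> borel_measurable borel"
    unfolding f_def by (intro borel_measurable_continuous_on_indicator graph_borel continuous_on_subset[OF \<delta>_cont graph_subset])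
  have \<delta>_pr: "\<delta> (pr z) = \<delta> z" if z: "z \<in> D" for z
  proof -
    have "(?X has_derivative frechet_derivative ?X (at z)) (at (z + (- t z) *\<^sub>R e))"
      by (rule deriv_shift[where c = 0, OF z has_derivative_frechet[OF Ck_field_differentiable[OF X z]]])
        (simp only: pr_shift add_0_right)
    then have "frechet_derivative ?X (at (pr z)) = frechet_derivative ?X (at z)"
      by (simp add: pr_def[of z] frechet_derivative_eq)
    then show ?thesis by (simp add: \<delta>_def divergence_def unit_grad_def grad_t_pr[OF z])
  qed
  define V where "V z = (if z \<in> D then (bump (t z) * norm (grad t z)) *\<^sub>R X (pr z) else 0)" for z
  have V_D: "Ck_field (Suc 0) D (\<lambda>z. (bump (t z) * norm (grad t z)) *\<^sub>R X (pr z))"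
  proof -
    have "Ck_on (Suc 0) D (\<lambda>z. bump (t z))"
      unfolding bump_def using t_smooth by (intro Ck_on_sqpos Ck_on_diff Ck_on_power open_D Ck_on_const) (auto simp: smooth_on_def simp del: Ck_on.simps)
    moreover have "Ck_on (Suc 0) D (\<lambda>z. norm (grad t z))"
      using t_smooth grad_t_nonzero by (intro Ck_on_norm Ck_field_grad open_D) (auto simp: smooth_on_def simp del: Ck_on.simps)
    ultimately show ?thesis by (intro Ck_field_scaleR Ck_on_mult open_D X)
  qed
  have V0: "V z = 0" if "z \<notin> thicken K" for z
    using that thicken(3)[OF K(1,2), of z] K(3)[of "pr z"] pr_in_graph[of z] by (auto simp: V_def)
  have V_UNIV: "Ck_field (Suc 0) UNIV V" unfolding Ck_field_def
  proof
    fix b :: 'a assume b: "b \<in> Basis"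
    have "Ck_field (Suc 0) D V" by (rule Ck_field_cong[OF open_D _ V_D]) (simp add: V_def)
    then have "Ck_on (Suc 0) D (\<lambda>x. V x \<bullet> b)" using b unfolding Ck_field_def by blast
    then show "Ck_on (Suc 0) UNIV (\<lambda>x. V x \<bullet> b)"
      by (rule Ck_on_UNIV_extension[OF open_D thicken(1,2)[OF K(1,2)]]) (simp add: V0)
  qed
  have divV: "divergence V z = indicator D z * (slope z * bump (t0 z)) * f (pr0 z)" for z
  proof (cases "z \<in> D")
    case True
    have "divergence V z = divergence (\<lambda>z. (bump (t z) * norm (grad t z)) *\<^sub>R X (pr z)) z"
      by (rule divergence_cong_open(1)[OF open_D True]) (simp add: V_def, rule Ck_field_differentiable[OF V_UNIV UNIV_I])
    also have "\<dots> = bump (t z) * norm (grad t z) * \<delta> z"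
      unfolding \<delta>_def by (rule divergence_weighted_tangential[OF X tang True])
    also have "\<delta> z = f (pr0 z)"
      using True \<delta>_pr[OF True] pr_in_graph[OF True] by (simp add: f_def pr0_def)
    finally show ?thesis using True by (simp add: slope_def t0_def)
  next
    case False
    have op: "open (- thicken K)" using thicken(1)[OF K(1,2)] by (simp add: compact_imp_closed open_Compl)
    have "z \<in> - thicken K" using False thicken(2)[OF K(1,2)] by auto
    then have "divergence V z = divergence (\<lambda>z. 0) z"
      by (rule divergence_cong_open(1)[OF op]) (simp add: V0, rule Ck_field_differentiable[OF V_UNIV UNIV_I])
    then show ?thesis using False by (simp add: divergence_def frechet_derivative_const)
  qed
  have "(LINT y|hausdorff_measure m. indicator graph y *\<^sub>R \<delta> y)
      = (LINT y|density (hausdorff_measure m) (\<lambda>y. ennreal (indicator graph y)). f y)"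
  proof -
    have fm: "f \<in> borel_measurable (hausdorff_measure m)"
      by (subst measurable_cong_sets[OF sets_hausdorff refl]) (rule f_meas)
    have "(LINT y|density (hausdorff_measure m) (\<lambda>y. ennreal (indicator graph y)). f y)
        = (LINT y|hausdorff_measure m. indicator graph y *\<^sub>R f y)"
      by (rule integral_density[OF fm]) auto
    also have "\<dots> = (LINT y|hausdorff_measure m. indicator graph y *\<^sub>R \<delta> y)"
      by (intro Bochner_Integration.integral_cong) (auto simp: f_def indicator_def)
    finally show ?thesis by simp
  qed
  also have "\<dots> = (LINT y|slab_measure \<kappa>. f y)"
    using \<kappa>(2) by (simp add: ennreal_indicator)
  also have "\<dots> = (LINT z|density lborel (\<lambda>z. ennreal (k * (indicator D z * (slope z * bump (t0 z))))). f (pr0 z))"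
  proof -
    have "\<kappa> * (indicator D z * ennreal (slope z * bump (t0 z))) = ennreal (k * (indicator D z * (slope z * bump (t0 z))))" for z
      using k by (auto simp: indicator_def ennreal_mult')
    then show ?thesis unfolding slab_measure_def by (simp add: integral_distr)
  qed
  also have "\<dots> = (LINT z|lborel. (k * (indicator D z * (slope z * bump (t0 z)))) *\<^sub>R f (pr0 z))"
  proof (rule integral_density)
    have "0 \<le> slope z" for z by (simp add: slope_def)
    then show "AE z in lborel. 0 \<le> k * (indicator D z * (slope z * bump (t0 z)))" using k by simp
  qed measurable
  also have "\<dots> = (LINT z|lborel. k * divergence V z)"
    by (intro Bochner_Integration.integral_cong) (auto simp: divV)
  also have "\<dots> = 0"
    using integral_divergence_zero[OF V_UNIV thicken(1)[OF K(1,2)] V0] by simp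
  finally show ?thesis .
qed

end

definition hypersurface :: "'a::euclidean_space set \<Rightarrow> bool" where
  "hypersurface S \<longleftrightarrow> (\<forall>p\<in>S. \<exists>W G. local_defining S p W G)"

definition C1_field_on :: "'a::euclidean_space set \<Rightarrow> ('a \<Rightarrow> 'a) \<Rightarrow> bool" where
  "C1_field_on S X \<longleftrightarrow> (\<forall>p\<in>S. \<exists>V Y. open V \<and> p \<in> V \<and> Ck_field (Suc 0) V Y \<and> (\<forall>y\<in>S \<inter> V. X y = Y y))"

lemma hypersurface_pointI:
  assumes "hypersurface S" "p \<in> S"
  obtains W G where "hypersurface_point S p W G"
  using assms unfolding hypersurface_def hypersurface_point_def by blast

lemma C1_field_onE:
  assumes "C1_field_on S X" "p \<in> S"
  obtains V Y where "open V" "p \<in> V" "Ck_field (Suc 0) V Y" "\<forall>y\<in>S \<inter> V. X y = Y y"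
  using assms unfolding C1_field_on_def by blast

lemma compact_graph_cover:
  assumes S: "hypersurface S" and K: "compact K" "K \<subseteq> S"
  obtains P r W e D t where "finite P" "P \<subseteq> K" "K \<subseteq> (\<Union>p\<in>P. ball p (r p))"
    "\<forall>p\<in>P. 0 < r p \<and> cball p (r p) \<subseteq> W p \<and> open (W p) \<and> graph_chart (e p) (D p) (t p)
       \<and> graph_chart.graph (D p) (t p) = S \<inter> W p"
proof -
  have "\<forall>p\<in>K. \<exists>r W e D t. 0 < r \<and> cball p r \<subseteq> W \<and> open W \<and> graph_chart e D t \<and> graph_chart.graph D t = S \<inter> W"
  proof
    fix p assume "p \<in> K"
    then have p: "p \<in> S" using K by auto
    then obtain W0 G where ld: "local_defining S p W0 G" using S unfolding hypersurface_def by blast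
    obtain e D t W where c: "graph_chart e D t" "open W" "p \<in> W" "graph_chart.graph D t = S \<inter> W"
      using graph_chart_exists[OF ld p] by metis
    obtain r where "0 < r" "cball p r \<subseteq> W" using c(2,3) open_contains_cball by blast
    then show "\<exists>r W e D t. 0 < r \<and> cball p r \<subseteq> W \<and> open W \<and> graph_chart e D t \<and> graph_chart.graph D t = S \<inter> W"
      using c by blast
  qed
  then obtain r W e D t where c: "\<And>p. p \<in> K \<Longrightarrow> 0 < r p \<and> cball p (r p) \<subseteq> W p \<and> open (W p) \<and> graph_chart (e p) (D p) (t p)
       \<and> graph_chart.graph (D p) (t p) = S \<inter> W p"
    by metis
  have "K \<subseteq> (\<Union>p\<in>K. ball p (r p))" using c by force
  then obtain P where "P \<subseteq> K" "finite P" "K \<subseteq> (\<Union>p\<in>P. ball p (r p))"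
    using compactE_image[OF K(1), of K "\<lambda>p. ball p (r p)"] by auto
  then show ?thesis using that[of P r W e D t] c by blast
qed

lemma hausdorff_finite_on_compact:
  fixes S :: "'a::euclidean_space set"
  assumes S: "hypersurface S" and K: "compact K" "K \<subseteq> S"
  shows "emeasure (hausdorff_measure (DIM('a) - 1)) K < \<infinity>"
proof -
  let ?H = "hausdorff_measure (DIM('a) - 1) :: 'a measure"
  obtain \<kappa> :: ennreal where \<kappa>: "\<kappa> < \<infinity>" "\<forall>(e :: 'a) D t. graph_chart e D t \<longrightarrow>
      density ?H (indicator (graph_chart.graph D t)) = graph_chart.slab_measure e D t \<kappa>"
    using area_formula[where ?'a = 'a] by blast
  obtain P r W e D t where c: "finite P" "P \<subseteq> K" "K \<subseteq> (\<Union>p\<in>P. ball p (r p))"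
    "\<forall>p\<in>P. 0 < r p \<and> cball p (r p) \<subseteq> W p \<and> open (W p) \<and> graph_chart (e p) (D p) (t p)
       \<and> graph_chart.graph (D p) (t p) = S \<inter> W p"
    by (rule compact_graph_cover[OF S K])
  have sets: "K \<inter> cball p (r p) \<in> sets ?H" for p
    using K(1) by (simp add: compact_imp_closed borel_closed)
  have fin: "emeasure ?H (K \<inter> cball p (r p)) < \<infinity>" if "p \<in> P" for p
  proof -
    interpret graph_chart "e p" "D p" "t p" using bspec[OF c(4) that] by blast
    show ?thesis
    proof (rule hausdorff_compact_finite[OF \<kappa>(1) \<kappa>(2)[rule_format]])
      show "graph_chart (e p) (D p) (t p)" by unfold_locales
      show "compact (K \<inter> cball p (r p))" using K(1) by (simp add: compact_Int_closed)
      show "K \<inter> cball p (r p) \<subseteq> graph" using bspec[OF c(4) that] K(2) by auto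
    qed
  qed
  have cover: "K \<subseteq> (\<Union>p\<in>P. K \<inter> cball p (r p))"
  proof
    fix x assume x: "x \<in> K"
    from subsetD[OF c(3) x] obtain p where p: "p \<in> P" "x \<in> ball p (r p)" by (rule UN_E)
    show "x \<in> (\<Union>p\<in>P. K \<inter> cball p (r p))"
      by (rule UN_I[OF p(1)]) (use x p(2) in simp)
  qed
  have "emeasure ?H K \<le> emeasure ?H (\<Union>p\<in>P. K \<inter> cball p (r p))"
    by (rule emeasure_mono[OF cover sets.finite_UN[OF c(1)]]) (rule sets)
  also have "\<dots> \<le> (\<Sum>p\<in>P. emeasure ?H (K \<inter> cball p (r p)))"
    using c(1) sets by (intro emeasure_subadditive_finite) auto
  also have "\<dots> < \<infinity>" using fin c(1) by (simp add: ennreal_sum_less_top)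
  finally show ?thesis .
qed

lemma integrable_on_hypersurface:
  fixes S :: "'a::euclidean_space set" and f :: "'a \<Rightarrow> real"
  assumes S: "hypersurface S" and K: "compact K" "K \<subseteq> S" and f: "continuous_on K f"
    "\<And>y. y \<in> S \<Longrightarrow> y \<notin> K \<Longrightarrow> f y = 0"
  shows "integrable (hausdorff_measure (DIM('a) - 1)) (\<lambda>y. indicator S y *\<^sub>R f y)"
proof -
  have eq: "(\<lambda>y. indicator S y *\<^sub>R f y) = (\<lambda>y. indicator K y *\<^sub>R f y)"
    using f(2) K(2) by (auto simp: indicator_def fun_eq_iff)
  have Kb: "K \<in> sets borel" using K(1) by (simp add: compact_imp_closed borel_closed)
  have meas: "(\<lambda>y. indicator K y *\<^sub>R f y) \<in> borel_measurable (hausdorff_measure (DIM('a) - 1))"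
    by (subst measurable_cong_sets[OF sets_hausdorff refl]) (rule borel_measurable_continuous_on_indicator[OF Kb f(1)])
  obtain B where B: "\<And>y. y \<in> K \<Longrightarrow> \<bar>f y\<bar> \<le> B"
    using compact_imp_bounded[OF compact_continuous_image[OF f(1) K(1)]] by (auto simp: bounded_iff)
  show ?thesis unfolding eq
    by (rule integrableI_bounded_set[where A = K and B = B, OF _ meas hausdorff_finite_on_compact[OF S K]])
      (use Kb B in auto)
qed

lemma surface_div_add:
  assumes S: "hypersurface S" and X: "C1_field_on S X" and Y: "C1_field_on S Y" and p: "p \<in> S"
  shows "surface_div S (\<lambda>y. X y + Y y) p = surface_div S X p + surface_div S Y p"
    and "C1_field_on S (\<lambda>y. X y + Y y)"
proof -
  obtain W G where "hypersurface_point S p W G" using hypersurface_pointI[OF S p] .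
  then interpret hypersurface_point S p W G .
  obtain V X' where 1: "open V" "p \<in> V" "Ck_field (Suc 0) V X'" "\<forall>y\<in>S \<inter> V. X y = X' y"
    using C1_field_onE[OF X p] .
  obtain V' Y' where 2: "open V'" "p \<in> V'" "Ck_field (Suc 0) V' Y'" "\<forall>y\<in>S \<inter> V'. Y y = Y' y"
    using C1_field_onE[OF Y p] .
  have d: "X' differentiable (at p)" "Y' differentiable (at p)"
    using Ck_field_differentiable[OF 1(3,2)] Ck_field_differentiable[OF 2(3,2)] by auto
  have fd: "frechet_derivative (\<lambda>y. X' y + Y' y) (at p) = (\<lambda>h. frechet_derivative X' (at p) h + frechet_derivative Y' (at p) h)"
    by (intro frechet_derivative_eq has_derivative_add has_derivative_frechet d)
  have "surface_div S (\<lambda>y. X y + Y y) p = divergence (\<lambda>y. X' y + Y' y) p - frechet_derivative (\<lambda>y. X' y + Y' y) (at p) (\<nu> p) \<bullet> \<nu> p"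
    using 1 2 d by (intro surface_div_eq[of "V \<inter> V'"]) (auto intro!: differentiable_add)
  also have "\<dots> = surface_div S X p + surface_div S Y p"
  proof -
    have a: "surface_div S X p = divergence X' p - frechet_derivative X' (at p) (\<nu> p) \<bullet> \<nu> p"
      by (rule surface_div_eq[OF 1(1,2) d(1)]) (use 1(4) in auto)
    have b: "surface_div S Y p = divergence Y' p - frechet_derivative Y' (at p) (\<nu> p) \<bullet> \<nu> p"
      by (rule surface_div_eq[OF 2(1,2) d(2)]) (use 2(4) in auto)
    show ?thesis unfolding a b divergence_def fd by (simp add: inner_add_left sum.distrib)
  qed
  finally show "surface_div S (\<lambda>y. X y + Y y) p = surface_div S X p + surface_div S Y p" .
  show "C1_field_on S (\<lambda>y. X y + Y y)" unfolding C1_field_on_def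
  proof
    fix q assume q: "q \<in> S"
    obtain V X' where 1: "open V" "q \<in> V" "Ck_field (Suc 0) V X'" "\<forall>y\<in>S \<inter> V. X y = X' y"
      using C1_field_onE[OF X q] .
    obtain V' Y' where 2: "open V'" "q \<in> V'" "Ck_field (Suc 0) V' Y'" "\<forall>y\<in>S \<inter> V'. Y y = Y' y"
      using C1_field_onE[OF Y q] .
    have "Ck_field (Suc 0) (V \<inter> V') (\<lambda>y. X' y + Y' y)"
      using 1 2 by (intro Ck_field_add) (auto intro: Ck_field_subset)
    then show "\<exists>V Z. open V \<and> q \<in> V \<and> Ck_field (Suc 0) V Z \<and> (\<forall>y\<in>S \<inter> V. X y + Y y = Z y)"
      using 1 2 by (intro exI[of _ "V \<inter> V'"] exI[of _ "\<lambda>y. X' y + Y' y"]) auto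
  qed
qed

lemma surface_div_cong:
  assumes S: "hypersurface S" and X: "C1_field_on S X" and p: "p \<in> S"
    and eq: "open V" "p \<in> V" "\<And>y. y \<in> S \<inter> V \<Longrightarrow> X y = Y y"
  shows "surface_div S X p = surface_div S Y p"
proof -
  obtain W G where "hypersurface_point S p W G" using hypersurface_pointI[OF S p] .
  then interpret hypersurface_point S p W G .
  obtain V' X' where 1: "open V'" "p \<in> V'" "Ck_field (Suc 0) V' X'" "\<forall>y\<in>S \<inter> V'. X y = X' y"
    using C1_field_onE[OF X p] .
  have d: "X' differentiable (at p)" by (rule Ck_field_differentiable[OF 1(3,2)])
  show ?thesis
    using surface_div_eq[OF 1(1,2) d bspec[OF 1(4)]] surface_div_eq[of "V \<inter> V'" X' Y] d 1 eq by fastforce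
qed

lemma C1_field_on_zero [simp]: "C1_field_on S (\<lambda>y. 0)"
  unfolding C1_field_on_def by (auto intro!: exI[of _ UNIV] exI[of _ "\<lambda>y. 0"])

lemma surface_div_zero:
  assumes "hypersurface S" "p \<in> S"
  shows "surface_div S (\<lambda>y. 0) p = 0"
  using surface_div_add(1)[OF assms(1) C1_field_on_zero C1_field_on_zero assms(2)] by simp

lemma surface_div_sum:
  assumes S: "hypersurface S" and "finite P" and X: "\<And>i. i \<in> P \<Longrightarrow> C1_field_on S (X i)" and p: "p \<in> S"
  shows "surface_div S (\<lambda>y. \<Sum>i\<in>P. X i y) p = (\<Sum>i\<in>P. surface_div S (X i) p) \<and> C1_field_on S (\<lambda>y. \<Sum>i\<in>P. X i y)"
  using assms(2) X
proof (induction P rule: finite_induct)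
  case empty
  then show ?case using surface_div_zero[OF S p] by simp
next
  case (insert i P)
  then show ?case using surface_div_add[OF S, of "X i" "\<lambda>y. \<Sum>i\<in>P. X i y", OF _ _ p] by simp
qed

lemma continuous_surface_div:
  assumes S: "hypersurface S" and X: "C1_field_on S X"
  shows "continuous_on S (surface_div S X)"
  unfolding continuous_on_eq_continuous_within
proof
  fix p assume p: "p \<in> S"
  obtain W G where hp: "hypersurface_point S p W G" using hypersurface_pointI[OF S p] .
  then interpret hypersurface_point S p W G .
  obtain V Y where 1: "open V" "p \<in> V" "Ck_field (Suc 0) V Y" "\<forall>y\<in>S \<inter> V. X y = Y y"
    using C1_field_onE[OF X p] .
  define F where "F y = divergence Y y - (\<Sum>b\<in>Basis. (\<nu> y \<bullet> b) *\<^sub>R frechet_derivative Y (at y) b) \<bullet> \<nu> y" for y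
  have F: "surface_div S X y = F y" if "y \<in> S \<inter> (V \<inter> W)" for y
  proof -
    interpret y: hypersurface_point S y W G using that by (intro at_point) auto
    have d: "Y differentiable (at y)" using that 1(3) Ck_field_differentiable by blast
    show ?thesis
      using y.surface_div_eq[OF 1(1) _ d bspec[OF 1(4)]] that linear_Basis_sum[OF linear_frechet_derivative[OF d], of "\<nu> y"]
      by (simp add: F_def)
  qed
  have "continuous_on (V \<inter> W) F"
    unfolding F_def
    using Ck_on_continuous[OF Ck_on_divergence[OF 1(3,1)]] Ck_field_continuous[OF Ck_normal[of 0]]
      Ck_field_continuous[OF Ck_field_deriv[OF 1(3,1)]]
    by (intro continuous_intros) (auto intro: continuous_on_subset)
  then have "isCont F p" using 1 open_W p_W by (simp add: continuous_on_eq_continuous_at open_Int)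
  then have "continuous (at p within S) F" by (rule continuous_at_imp_continuous_at_within)
  moreover have "eventually (\<lambda>y. F y = surface_div S X y) (at p within S)"
    unfolding eventually_at_topological using 1(1,2) open_W p_W F by (intro exI[of _ "V \<inter> W"]) (auto simp: open_Int)
  ultimately show "continuous (at p within S) (surface_div S X)"
    using F[of p] p 1(2) p_W unfolding continuous_within by (simp add: tendsto_cong)
qed

text \<open>The height function of the chart is itself a defining function, and \<open>X \<circ> pr\<close> an extension of \<open>X\<close>, so
  that the statement is the divergence theorem of the chart.\<close>

lemma localized_divergence_theorem:
  fixes S :: "'a::euclidean_space set"
  assumes S: "hypersurface S" and X: "C1_field_on S X" and tang: "\<And>y. y \<in> S \<Longrightarrow> X y \<in> tangent_space S y"
    and c: "graph_chart e D t" "open W" "graph_chart.graph D t = S \<inter> W"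
    and K: "compact K" "K \<subseteq> S \<inter> W" "\<And>y. y \<in> S \<Longrightarrow> y \<notin> K \<Longrightarrow> X y = 0"
  shows "(LINT y|hausdorff_measure (DIM('a) - 1). indicator S y *\<^sub>R surface_div S X y) = 0"
proof -
  interpret graph_chart e D t by fact
  have graph_S: "graph \<subseteq> S" using c(3) by auto
  have hp: "hypersurface_point S y (D \<inter> W) t" if "y \<in> graph" for y
    by (rule chart_point[OF c(3,2) that])
  have XC: "Ck_field (Suc 0) D (\<lambda>z. X (pr z))"
    unfolding Ck_field_def
  proof (intro ballI Ck_on_local)
    fix b :: 'a and z assume b: "b \<in> Basis" and z: "z \<in> D"
    obtain V Y where 1: "open V" "pr z \<in> V" "Ck_field (Suc 0) V Y" "\<forall>y\<in>S \<inter> V. X y = Y y"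
      using C1_field_onE[OF X, of "pr z"] pr_in_graph[OF z] graph_S by blast
    define D' where "D' = D \<inter> pr -` V"
    have D': "open D'" unfolding D'_def by (rule continuous_open_preimage[OF continuous_pr open_D 1(1)])
    have "Ck_field (Suc 0) D' (\<lambda>z. Y (pr z))"
      by (rule Ck_field_compose[OF D' 1(1) 1(3) Ck_field_subset[OF Ck_pr]]) (auto simp: D'_def)
    then have "Ck_field (Suc 0) D' (\<lambda>z. X (pr z))"
    proof (rule Ck_field_cong[OF D', rotated])
      show "\<forall>z\<in>D'. Y (pr z) = X (pr z)"
      proof
        fix z assume "z \<in> D'"
        then have "pr z \<in> S \<inter> V" using pr_in_graph graph_S unfolding D'_def by blast
        then show "Y (pr z) = X (pr z)" using 1(4) by simp
      qed
    qed
    then show "\<exists>W. open W \<and> z \<in> W \<and> Ck_on (Suc 0) W (\<lambda>z. X (pr z) \<bullet> b)"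
      using D' z 1(2) b by (intro exI[of _ D']) (auto simp: Ck_field_def D'_def simp del: Ck_on.simps)
  qed
  have Xt: "X (pr z) \<bullet> grad t z = 0" if z: "z \<in> D" for z
  proof -
    interpret p: hypersurface_point S "pr z" "D \<inter> W" t by (rule hp[OF pr_in_graph[OF z]])
    have "n (pr z) \<bullet> X (pr z) = 0" using tang[of "pr z"] p.tangent_space_eq p.p_in by auto
    then have "grad t (pr z) \<bullet> X (pr z) = 0" using p.grad_orth_iff[OF p.p_W] by simp
    then show ?thesis using grad_t_pr[OF z] by (simp add: inner_commute)
  qed
  have div: "surface_div S X y = divergence (\<lambda>z. X (pr z)) y - frechet_derivative (\<lambda>z. X (pr z)) (at y) (n y) \<bullet> n y"
    if y: "y \<in> graph" for y
  proof -
    interpret p: hypersurface_point S y "D \<inter> W" t by (rule hp[OF y])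
    have yD: "y \<in> D" using y graph_subset by auto
    show ?thesis
      by (rule p.surface_div_eq[OF p.open_W p.p_W Ck_field_differentiable[OF XC yD]])
        (use c(3) in auto)
  qed
  have out: "surface_div S X y = 0" if y: "y \<in> S" "y \<notin> graph" for y
  proof -
    have "surface_div S X y = surface_div S (\<lambda>y. 0) y"
      by (rule surface_div_cong[OF S X y(1), of "- K"]) (use K y c(3) in \<open>auto simp: compact_imp_closed open_Compl\<close>)
    then show ?thesis using surface_div_zero[OF S y(1)] by simp
  qed
  obtain \<kappa> :: ennreal where \<kappa>: "\<kappa> < \<infinity>" "\<forall>(e :: 'a) D t. graph_chart e D t \<longrightarrow>
      density (hausdorff_measure (DIM('a) - 1)) (indicator (graph_chart.graph D t)) = graph_chart.slab_measure e D t \<kappa>"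
    using area_formula[where ?'a = 'a] by blast
  have "(LINT y|hausdorff_measure (DIM('a) - 1). indicator S y *\<^sub>R surface_div S X y)
      = (LINT y|hausdorff_measure (DIM('a) - 1). indicator graph y *\<^sub>R
          (divergence (\<lambda>z. X (pr z)) y - frechet_derivative (\<lambda>z. X (pr z)) (at y) (n y) \<bullet> n y))"
    using div out graph_S by (intro Bochner_Integration.integral_cong) (auto simp: indicator_def)
  also have "\<dots> = 0"
    using K c(3) by (intro chart_divergence_theorem[OF \<kappa>(1) \<kappa>(2)[rule_format, OF c(1)] XC Xt K(1)]) auto
  finally show ?thesis .
qed

text \<open>A partition of unity reduces the theorem to fields supported in a single graph.  Its functions
  need only be \<open>C\<^sup>1\<close>, so that squares of positive parts of polynomials will do.\<close>

theorem surface_divergence_theorem: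
  fixes S :: "'a::euclidean_space set"
  assumes S: "hypersurface S" and X: "C1_field_on S X" and tang: "\<And>y. y \<in> S \<Longrightarrow> X y \<in> tangent_space S y"
    and K: "compact K" "K \<subseteq> S" "\<And>y. y \<in> S \<Longrightarrow> y \<notin> K \<Longrightarrow> X y = 0"
  shows "integrable (hausdorff_measure (DIM('a) - 1)) (\<lambda>y. indicator S y *\<^sub>R surface_div S X y)"
    and "(LINT y|hausdorff_measure (DIM('a) - 1). indicator S y *\<^sub>R surface_div S X y) = 0"
proof -
  let ?H = "hausdorff_measure (DIM('a) - 1) :: 'a measure"
  have openK: "open (- K)" using K(1) by (simp add: compact_imp_closed open_Compl)
  have integ: "integrable ?H (\<lambda>y. indicator S y *\<^sub>R surface_div S Z y)"
    if Z: "C1_field_on S Z" "\<And>y. y \<in> S \<Longrightarrow> y \<notin> K \<Longrightarrow> Z y = 0" for Z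
  proof (rule integrable_on_hypersurface[OF S K(1,2)])
    show "continuous_on K (surface_div S Z)"
      using continuous_surface_div[OF S Z(1)] K(2) by (rule continuous_on_subset)
    show "surface_div S Z y = 0" if y: "y \<in> S" "y \<notin> K" for y
      using surface_div_cong[OF S Z(1) y(1) openK, of "\<lambda>y. 0"] surface_div_zero[OF S y(1)] Z(2) y by simp
  qed
  show "integrable ?H (\<lambda>y. indicator S y *\<^sub>R surface_div S X y)" by (rule integ[OF X K(3)])
  obtain P r W e D t where c: "finite P" "P \<subseteq> K" "K \<subseteq> (\<Union>p\<in>P. ball p (r p))"
    "\<forall>p\<in>P. 0 < r p \<and> cball p (r p) \<subseteq> W p \<and> open (W p) \<and> graph_chart (e p) (D p) (t p)
       \<and> graph_chart.graph (D p) (t p) = S \<inter> W p"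
    by (rule compact_graph_cover[OF S K(1,2)])
  define \<phi> where "\<phi> p y = (max 0 ((r p)\<^sup>2 - (y - p) \<bullet> (y - p)))\<^sup>2" for p y
  define \<Phi> where "\<Phi> y = (\<Sum>p\<in>P. \<phi> p y)" for y
  have \<phi>_C: "Ck_on (Suc 0) UNIV (\<phi> p)" for p
    unfolding \<phi>_def by (intro Ck_on_sqpos Ck_on_diff Ck_on_inner Ck_field_diff Ck_field_id Ck_on_const Ck_field_const open_UNIV)
  have \<Phi>_C: "Ck_on (Suc 0) UNIV \<Phi>" unfolding \<Phi>_def by (intro Ck_on_sum \<phi>_C open_UNIV)
  have \<phi>_nonneg: "0 \<le> \<phi> p y" for p y by (simp add: \<phi>_def)
  have \<phi>_pos: "0 < \<phi> p y" if "y \<in> ball p (r p)" for p y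
  proof -
    have "norm (y - p) < r p" using that by (simp add: dist_norm norm_minus_commute)
    then have "(norm (y - p))\<^sup>2 < (r p)\<^sup>2" by (intro power_strict_mono) auto
    then show ?thesis by (simp add: \<phi>_def dot_square_norm)
  qed
  have \<phi>_out: "\<phi> p y = 0" if "y \<notin> cball p (r p)" "p \<in> P" for p y
  proof -
    have "r p \<le> norm (y - p)" using that by (simp add: dist_norm norm_minus_commute)
    then have "(r p)\<^sup>2 \<le> (norm (y - p))\<^sup>2" using bspec[OF c(4) that(2)] by (intro power_mono) auto
    then show ?thesis by (simp add: \<phi>_def dot_square_norm)
  qed
  define Q where "Q = {y. 0 < \<Phi> y}"
  have openQ: "open Q" unfolding Q_def
    by (intro open_Collect_less continuous_on_const Ck_on_continuous[OF \<Phi>_C])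
  have KQ: "K \<subseteq> Q"
  proof
    fix y assume "y \<in> K"
    from subsetD[OF c(3) this] obtain p where p: "p \<in> P" "y \<in> ball p (r p)" by (rule UN_E)
    then show "y \<in> Q" unfolding Q_def \<Phi>_def
      using sum_pos2[OF c(1) p(1), of "\<lambda>p. \<phi> p y"] \<phi>_pos[OF p(2)] \<phi>_nonneg by simp
  qed
  define Xp where "Xp p y = (\<phi> p y / \<Phi> y) *\<^sub>R X y" for p y
  have Xp_sum: "(\<Sum>p\<in>P. Xp p y) = X y" if "y \<in> S" for y
  proof (cases "y \<in> K")
    case True
    then have "\<Phi> y \<noteq> 0" using KQ by (auto simp: Q_def)
    have "(\<Sum>p\<in>P. Xp p y) = (\<Sum>p\<in>P. \<phi> p y / \<Phi> y) *\<^sub>R X y" by (simp add: Xp_def scaleR_sum_left)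
    also have "(\<Sum>p\<in>P. \<phi> p y / \<Phi> y) = 1" using \<open>\<Phi> y \<noteq> 0\<close> by (simp add: \<Phi>_def flip: sum_divide_distrib)
    finally show ?thesis by simp
  qed (use K(3) that in \<open>simp add: Xp_def\<close>)
  have Xp_C: "C1_field_on S (Xp p)" for p unfolding C1_field_on_def
  proof
    fix q assume q: "q \<in> S"
    show "\<exists>V Y. open V \<and> q \<in> V \<and> Ck_field (Suc 0) V Y \<and> (\<forall>y\<in>S \<inter> V. Xp p y = Y y)"
    proof (cases "q \<in> Q")
      case True
      obtain V Y where 1: "open V" "q \<in> V" "Ck_field (Suc 0) V Y" "\<forall>y\<in>S \<inter> V. X y = Y y"
        using C1_field_onE[OF X q] .
      have "Ck_field (Suc 0) (V \<inter> Q) (\<lambda>y. (\<phi> p y / \<Phi> y) *\<^sub>R Y y)"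
        using 1 openQ by (intro Ck_field_scaleR Ck_on_divide Ck_on_subset[OF \<phi>_C] Ck_on_subset[OF \<Phi>_C])
          (auto simp: Q_def intro: Ck_field_subset)
      then show ?thesis using 1 openQ True
        by (intro exI[of _ "V \<inter> Q"] exI[of _ "\<lambda>y. (\<phi> p y / \<Phi> y) *\<^sub>R Y y"]) (auto simp: Xp_def)
    next
      case False
      then show ?thesis using KQ openK K(3)
        by (intro exI[of _ "- K"] exI[of _ "\<lambda>y. 0"]) (auto simp: Xp_def)
    qed
  qed
  have Xp0: "(LINT y|?H. indicator S y *\<^sub>R surface_div S (Xp p) y) = 0" if p: "p \<in> P" for p
  proof (rule localized_divergence_theorem[OF S Xp_C, where K = "K \<inter> cball p (r p)"])
    show "Xp p y \<in> tangent_space S y" if "y \<in> S" for y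
      using tang[OF that] by (auto simp: tangent_space_def Xp_def)
    show "Xp p y = 0" if "y \<in> S" "y \<notin> K \<inter> cball p (r p)" for y
      using that K(3) \<phi>_out[OF _ p] by (auto simp: Xp_def)
  qed (use bspec[OF c(4) p] K in \<open>auto simp: compact_Int_closed\<close>)
  have "(LINT y|?H. indicator S y *\<^sub>R surface_div S X y) = (LINT y|?H. (\<Sum>p\<in>P. indicator S y *\<^sub>R surface_div S (Xp p) y))"
  proof (intro Bochner_Integration.integral_cong refl)
    fix y
    show "indicator S y *\<^sub>R surface_div S X y = (\<Sum>p\<in>P. indicator S y *\<^sub>R surface_div S (Xp p) y)"
    proof (cases "y \<in> S")
      case True
      have *: "surface_div S (\<lambda>y. \<Sum>p\<in>P. Xp p y) y = (\<Sum>p\<in>P. surface_div S (Xp p) y) \<and> C1_field_on S (\<lambda>y. \<Sum>p\<in>P. Xp p y)"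
        by (rule surface_div_sum[OF S c(1) Xp_C True])
      have "surface_div S X y = surface_div S (\<lambda>y. \<Sum>p\<in>P. Xp p y) y"
        by (rule surface_div_cong[OF S X True open_UNIV]) (simp_all add: Xp_sum)
      then show ?thesis using * True by simp
    qed simp
  qed
  also have "\<dots> = (\<Sum>p\<in>P. LINT y|?H. indicator S y *\<^sub>R surface_div S (Xp p) y)"
  proof (rule Bochner_Integration.integral_sum)
    show "integrable ?H (\<lambda>y. indicator S y *\<^sub>R surface_div S (Xp p) y)" for p
      by (rule integ[OF Xp_C]) (simp add: Xp_def K(3))
  qed
  also have "\<dots> = 0" using Xp0 by simp
  finally show "(LINT y|?H. indicator S y *\<^sub>R surface_div S X y) = 0" .
qed

section \<open>The Jacobi operator of the weight\<close>

lemma mixed_partials_commute: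
  assumes f: "Ck_on (Suc (Suc 0)) U f" and U: "open U" "p \<in> U"
  shows "frechet_derivative (\<lambda>y. frechet_derivative f (at y) h) (at p) k
       = frechet_derivative (\<lambda>y. frechet_derivative f (at y) k) (at p) h"
proof -
  have d: "f differentiable (at y)" if "y \<in> U" for y using f that by simp
  have gd: "(grad f has_derivative frechet_derivative (grad f) (at p)) (at p)"
    by (rule has_derivative_frechet[OF Ck_field_differentiable[OF Ck_field_grad[OF f] U(2)]])
  have e: "frechet_derivative (\<lambda>y. frechet_derivative f (at y) h) (at p) k = frechet_derivative (grad f) (at p) k \<bullet> h" for h k
  proof -
    have "((\<lambda>y. frechet_derivative f (at y) h) has_derivative (\<lambda>k. frechet_derivative (grad f) (at p) k \<bullet> h)) (at p)"
      by (rule has_derivative_transform_within_open[OF has_derivative_inner_left[OF gd] U])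
        (simp add: frechet_derivative_grad[OF d])
    then show ?thesis by (simp add: frechet_derivative_eq)
  qed
  show ?thesis unfolding e
    by (rule hessian_symmetric[OF U has_derivative_grad[OF d] gd])
qed


lemma trace_square:
  fixes M :: "'a::euclidean_space \<Rightarrow> 'a"
  assumes "linear M"
  shows "(\<Sum>b\<in>Basis. \<Sum>c\<in>Basis. (M b \<bullet> c) * (M c \<bullet> b)) = (\<Sum>b\<in>Basis. M (M b) \<bullet> b)"
proof (rule sum.cong[OF refl])
  fix b :: 'a
  have "M (M b) = (\<Sum>c\<in>Basis. (M b \<bullet> c) *\<^sub>R M c)" by (rule linear_Basis_sum[OF assms])
  then show "(\<Sum>c\<in>Basis. (M b \<bullet> c) * (M c \<bullet> b)) = M (M b) \<bullet> b" by (simp add: inner_sum_left)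
qed

context hypersurface_point
begin

abbreviation "w \<equiv> weight G"

text \<open>The acceleration \<open>\<nabla>\<^sub>\<nu>\<nu>\<close> of the normal field, through which the weight enters the
  second-order identities.\<close>

definition Z :: "'a \<Rightarrow> 'a" where "Z y = (\<Sum>c\<in>Basis. (\<nu> y \<bullet> c) *\<^sub>R frechet_derivative \<nu> (at y) c)"

lemma Z_eq: "y \<in> W \<Longrightarrow> Z y = frechet_derivative \<nu> (at y) (\<nu> y)"
  unfolding Z_def by (rule linear_Basis_sum[OF linear_normal_deriv, symmetric])

lemma Ck_Z: "Ck_field k W Z"
  unfolding Ck_field_def
proof
  fix b :: 'a assume b: "b \<in> Basis"
  have "Ck_field k W (\<lambda>y. frechet_derivative \<nu> (at y) c)" if "c \<in> Basis" for c
    by (rule Ck_field_deriv[OF Ck_normal open_W that])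
  then show "Ck_on k W (\<lambda>y. Z y \<bullet> b)"
    unfolding Z_def inner_sum_left inner_scaleR_left using b Ck_normal[of k]
    by (intro Ck_on_sum Ck_on_mult open_W) (auto simp: Ck_field_def)
qed

lemma Z_orth: "y \<in> W \<Longrightarrow> Z y \<bullet> \<nu> y = 0"
  by (simp add: Z_eq normal_deriv_orth)

lemma Z_differentiable: "y \<in> W \<Longrightarrow> Z differentiable (at y)"
  by (rule Ck_field_differentiable[OF Ck_Z])

lemma weight_pos: "y \<in> W \<Longrightarrow> w y > 0"
  using grad_nonzero by (simp add: weight_def)

lemma Ck_w: "Ck_on k W w"
  using grad_nonzero by (intro Ck_on_weight open_W Ck_G)

lemma w_differentiable: "y \<in> W \<Longrightarrow> w differentiable (at y)"
  using Ck_w[of "Suc 0"] by simp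

lemma grad_G_deriv:
  assumes "y \<in> W"
  shows "(grad G has_derivative frechet_derivative (grad G) (at y)) (at y)"
  by (rule has_derivative_frechet[OF Ck_field_differentiable[OF Ck_field_grad[OF Ck_G] assms]])

lemma G_hessian_symmetric:
  "y \<in> W \<Longrightarrow> frechet_derivative (grad G) (at y) h \<bullet> k = frechet_derivative (grad G) (at y) k \<bullet> h"
  by (rule hessian_symmetric[OF open_W _ has_derivative_grad[OF smooth_on_differentiable[OF smooth_G]] grad_G_deriv])

lemma normal_deriv_eq:
  assumes y: "y \<in> W"
  shows "frechet_derivative \<nu> (at y) h = (grad w y \<bullet> h) *\<^sub>R grad G y + w y *\<^sub>R frechet_derivative (grad G) (at y) h"
proof -
  have "((\<lambda>y. w y *\<^sub>R grad G y) has_derivative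
      (\<lambda>h. w y *\<^sub>R frechet_derivative (grad G) (at y) h + (grad w y \<bullet> h) *\<^sub>R grad G y)) (at y)"
    by (rule has_derivative_scaleR[OF has_derivative_grad[OF w_differentiable[OF y]] grad_G_deriv[OF y]])
  moreover have "(\<lambda>y. w y *\<^sub>R grad G y) = \<nu>" by (simp add: weight_def unit_grad_def fun_eq_iff)
  ultimately have "(\<nu> has_derivative (\<lambda>h. w y *\<^sub>R frechet_derivative (grad G) (at y) h + (grad w y \<bullet> h) *\<^sub>R grad G y)) (at y)"
    by simp
  from frechet_derivative_eq[OF this] show ?thesis by (simp add: add.commute)
qed

lemma norm_grad_eq: "norm (grad G y) = inverse (w y)"
  by (simp add: weight_def)

lemma norm_grad_deriv:
  assumes y: "y \<in> W"
  shows "((\<lambda>y. norm (grad G y)) has_derivative (\<lambda>h. frechet_derivative (grad G) (at y) h \<bullet> \<nu> y)) (at y)"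
    and "frechet_derivative (grad G) (at y) h \<bullet> \<nu> y = - (grad w y \<bullet> h) / (w y)\<^sup>2"
proof -
  show 1: "((\<lambda>y. norm (grad G y)) has_derivative (\<lambda>h. frechet_derivative (grad G) (at y) h \<bullet> \<nu> y)) (at y)"
    using has_derivative_compose[OF grad_G_deriv[OF y] has_derivative_norm[OF grad_nonzero[OF y]]]
    by (simp add: unit_grad_def sgn_div_norm inner_commute)
  have "((\<lambda>y. inverse (w y)) has_derivative (\<lambda>h. - (inverse (w y) * (grad w y \<bullet> h) * inverse (w y)))) (at y)"
    using weight_pos[OF y] by (intro Deriv.has_derivative_inverse has_derivative_grad w_differentiable y) auto
  then have "((\<lambda>y. norm (grad G y)) has_derivative (\<lambda>h. - (inverse (w y) * (grad w y \<bullet> h) * inverse (w y)))) (at y)"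
    by (simp add: norm_grad_eq[abs_def])
  from fun_cong[OF has_derivative_unique[OF 1 this], of h]
  show "frechet_derivative (grad G) (at y) h \<bullet> \<nu> y = - (grad w y \<bullet> h) / (w y)\<^sup>2"
    by (simp add: power2_eq_square divide_inverse)
qed

text \<open>Differentiating \<open>|\<nabla>G| = 1 / w\<close> and using the symmetry of the Hessian identifies \<open>Z\<close> with the
  tangential logarithmic gradient of the weight.\<close>

lemma P_grad_weight:
  assumes y: "y \<in> W"
  shows "P y (grad w y) = - (w y *\<^sub>R Z y)"
proof -
  have w0: "w y \<noteq> 0" using weight_pos[OF y] by simp
  have "Z y \<bullet> k = - (P y (grad w y) \<bullet> k) / w y" for k
  proof -
    let ?L = "frechet_derivative (grad G) (at y)"
    have "Z y \<bullet> k = (grad w y \<bullet> \<nu> y) * (grad G y \<bullet> k) + w y * (?L (\<nu> y) \<bullet> k)"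
      unfolding Z_eq[OF y] normal_deriv_eq[OF y] by (simp add: inner_add_left)
    also have "?L (\<nu> y) \<bullet> k = - (grad w y \<bullet> k) / (w y)\<^sup>2"
      unfolding G_hessian_symmetric[OF y, of "\<nu> y"] by (rule norm_grad_deriv(2)[OF y])
    also have "grad G y \<bullet> k = (\<nu> y \<bullet> k) / w y"
      by (subst grad_eq_normal[OF y]) (simp add: norm_grad_eq divide_inverse mult.commute)
    finally have "Z y \<bullet> k = (grad w y \<bullet> \<nu> y) * ((\<nu> y \<bullet> k) / w y) + w y * (- (grad w y \<bullet> k) / (w y)\<^sup>2)" .
    also have "\<dots> = - (P y (grad w y) \<bullet> k) / w y"
      using w0 by (simp add: P_def inner_diff_left field_simps power2_eq_square)
    finally show ?thesis .
  qed
  from this[of "Z y + P y (grad w y) /\<^sub>R w y"]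
  have "(Z y + P y (grad w y) /\<^sub>R w y) \<bullet> (Z y + P y (grad w y) /\<^sub>R w y) = 0"
    by (subst inner_add_left) (simp add: divide_inverse)
  then have "Z y = - (P y (grad w y) /\<^sub>R w y)" by (simp add: eq_neg_iff_add_eq_0)
  then show ?thesis using w0 by simp
qed

lemma surface_grad_weight: "y \<in> S \<inter> W \<Longrightarrow> surface_grad S w y = - (w y *\<^sub>R Z y)"
proof -
  assume y: "y \<in> S \<inter> W"
  interpret y: hypersurface_point S y W G by (rule at_point[OF y])
  have "surface_grad S w y = y.P y (grad w y)"
    by (rule y.surface_grad_eq[OF y.open_W y.p_W w_differentiable]) (use y in auto)
  then show ?thesis using P_grad_weight[of y] y by simp
qed

lemma Z_deriv_normal:
  assumes y: "y \<in> W"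
  shows "frechet_derivative Z (at y) (\<nu> y) \<bullet> \<nu> y = - (Z y \<bullet> Z y)"
proof -
  have "((\<lambda>y. Z y \<bullet> \<nu> y) has_derivative (\<lambda>h. Z y \<bullet> frechet_derivative \<nu> (at y) h + frechet_derivative Z (at y) h \<bullet> \<nu> y)) (at y)"
    by (intro has_derivative_inner has_derivative_frechet Z_differentiable normal_differentiable y)
  moreover have "((\<lambda>y. Z y \<bullet> \<nu> y) has_derivative (\<lambda>h. 0)) (at y)"
    by (rule has_derivative_transform_within_open[OF has_derivative_const[of 0] open_W y]) (simp add: Z_orth)
  ultimately have "(\<lambda>h. Z y \<bullet> frechet_derivative \<nu> (at y) h + frechet_derivative Z (at y) h \<bullet> \<nu> y) = (\<lambda>h. 0)"
    by (rule has_derivative_unique)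
  from fun_cong[OF this, of "\<nu> y"] show ?thesis by (simp add: Z_eq[OF y, symmetric])
qed

lemma surface_div_scaled_Z:
  assumes V: "open V" "p \<in> V" and f: "f differentiable (at p)" and X: "\<And>y. y \<in> S \<inter> V \<Longrightarrow> X y = f y *\<^sub>R Z y"
  shows "surface_div S X p = f p * divergence Z p + grad f p \<bullet> Z p + f p * (Z p \<bullet> Z p)"
proof -
  have fd: "frechet_derivative (\<lambda>y. f y *\<^sub>R Z y) (at p)
      = (\<lambda>h. f p *\<^sub>R frechet_derivative Z (at p) h + frechet_derivative f (at p) h *\<^sub>R Z p)"
    by (intro frechet_derivative_eq has_derivative_scaleR has_derivative_frechet f Z_differentiable p_W)
  have dZ: "(\<lambda>y. f y *\<^sub>R Z y) differentiable (at p)"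
    by (intro differentiable_scaleR f Z_differentiable p_W)
  show ?thesis
    unfolding surface_div_eq[OF V dZ X, simplified] divergence_scaleR[OF f Z_differentiable[OF p_W]] fd
    using Z_deriv_normal[OF p_W] Z_orth[OF p_W] by (simp add: inner_add_left)
qed

text \<open>By the preceding lemmas \<open>\<nabla>\<^sub>Sw = - w Z\<close>; in its divergence the terms quadratic in \<open>Z\<close> cancel.\<close>

lemma surface_laplacian_weight: "surface_laplacian S w p = - (w p * divergence Z p)"
proof -
  have wd: "w differentiable (at p)" by (rule w_differentiable[OF p_W])
  have grad_minus: "grad (\<lambda>y. - w y) p = - grad w p"
    by (rule gradI) (use has_derivative_minus[OF has_derivative_grad[OF wd]] in \<open>simp\<close>)
  have "surface_laplacian S w p = - w p * divergence Z p + grad (\<lambda>y. - w y) p \<bullet> Z p + - w p * (Z p \<bullet> Z p)"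
    unfolding surface_laplacian_def
    by (rule surface_div_scaled_Z[OF open_W p_W]) (use wd surface_grad_weight in \<open>auto intro!: differentiable_minus\<close>)
  moreover have "grad w p \<bullet> Z p = - w p * (Z p \<bullet> Z p)"
  proof -
    have "grad w p \<bullet> Z p = P p (grad w p) \<bullet> Z p"
      using P_inner(1)[OF p_W, of "grad w p" "Z p"] P_self[OF Z_orth[OF p_W]] by simp
    then show ?thesis unfolding P_grad_weight[OF p_W] by simp
  qed
  ultimately show ?thesis unfolding grad_minus by simp
qed

text \<open>The matrix of \<open>D\<nu>\<close> is \<open>A + Z \<otimes> \<nu>\<close> with \<open>A\<close> symmetric and tangential, so the trace of its
  square is \<open>|A|\<^sup>2\<close>.\<close>

lemma trace_square_normal_deriv:
  "(\<Sum>b\<in>Basis. \<Sum>c\<in>Basis. (frechet_derivative \<nu> (at p) b \<bullet> c) * (frechet_derivative \<nu> (at p) c \<bullet> b)) = sff_norm_sq S p"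
proof -
  let ?M = "frechet_derivative \<nu> (at p)"
  define N where "N h = ?M (P p h)" for h
  interpret M: linear ?M by (rule linear_normal_deriv[OF p_W])
  have MP: "P p (?M h) = ?M h" for h by (rule P_self[OF normal_deriv_orth[OF p_W]])
  have M_P: "?M h \<bullet> P p k = ?M h \<bullet> k" for h k
    using P_inner(1)[OF p_W, of "?M h" k] MP by simp
  have M_hess: "?M h \<bullet> P p k = w p * (frechet_derivative (grad G) (at p) h \<bullet> P p k)" for h k
  proof -
    have "grad G p \<bullet> P p k = 0" using grad_orth_iff[OF p_W] P_orth(2)[OF p_W] by blast
    then show ?thesis unfolding normal_deriv_eq[OF p_W] by (simp add: inner_add_left)
  qed
  have N_sym: "N h \<bullet> k = N k \<bullet> h" for h k
  proof -
    have "N h \<bullet> k = w p * (frechet_derivative (grad G) (at p) (P p h) \<bullet> P p k)"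
      unfolding N_def M_P[of "P p h" k, symmetric] M_hess ..
    also have "\<dots> = w p * (frechet_derivative (grad G) (at p) (P p k) \<bullet> P p h)"
      by (simp add: G_hessian_symmetric[OF p_W])
    also have "\<dots> = N k \<bullet> h" unfolding N_def M_P[of "P p k" h, symmetric] M_hess ..
    finally show ?thesis .
  qed
  have Mb: "?M b = N b + (b \<bullet> \<nu> p) *\<^sub>R ?M (\<nu> p)" for b
    unfolding N_def P_def by (simp add: M.diff M.scale)
  have NN: "?M (?M b) = N (?M b)" for b unfolding N_def MP ..
  have "?M (?M b) \<bullet> b = N b \<bullet> N b + (b \<bullet> \<nu> p) * (N (?M (\<nu> p)) \<bullet> b)" for b
  proof -
    have "?M (?M b) \<bullet> b = N b \<bullet> ?M b" unfolding NN by (rule N_sym)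
    also have "\<dots> = N b \<bullet> N b + (b \<bullet> \<nu> p) * (N b \<bullet> ?M (\<nu> p))"
      by (subst (1) Mb) (simp add: inner_add_right)
    finally show ?thesis by (simp add: N_sym)
  qed
  then have "(\<Sum>b\<in>Basis. ?M (?M b) \<bullet> b) = (\<Sum>b\<in>Basis. N b \<bullet> N b) + (\<Sum>b\<in>Basis. (b \<bullet> \<nu> p) * (N (?M (\<nu> p)) \<bullet> b))"
    by (simp add: sum.distrib)
  also have "(\<Sum>b\<in>Basis. (b \<bullet> \<nu> p) * (N (?M (\<nu> p)) \<bullet> b)) = N (?M (\<nu> p)) \<bullet> \<nu> p"
    unfolding euclidean_inner[of "N (?M (\<nu> p))" "\<nu> p"] by (intro sum.cong) (auto simp: inner_commute)
  also have "\<dots> = 0" unfolding N_def by (rule normal_deriv_orth[OF p_W])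
  finally have "(\<Sum>b\<in>Basis. ?M (?M b) \<bullet> b) = (\<Sum>b\<in>Basis. N b \<bullet> N b)" by simp
  also have "\<dots> = sff_norm_sq S p"
    unfolding sff_norm_sq_eq N_def[symmetric] by (simp add: euclidean_inner[of "N _" "N _"] power2_eq_square)
  finally show ?thesis unfolding trace_square[OF linear_normal_deriv[OF p_W]] .
qed

text \<open>Commuting derivatives in \<open>div \<nabla>\<^sub>\<nu>\<nu>\<close> yields the derivative of \<open>div \<nu>\<close> along \<open>\<nu>\<close> and the trace of the square
  of \<open>D\<nu>\<close>.\<close>

lemma divergence_Z: "divergence Z p = sff_norm_sq S p + frechet_derivative (divergence \<nu>) (at p) (\<nu> p)"
proof -
  let ?M = "frechet_derivative \<nu> (at p)"
  define \<nu>' where "\<nu>' c = frechet_derivative (\<lambda>y. frechet_derivative \<nu> (at y) c) (at p)" for c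
  have d': "(\<lambda>y. frechet_derivative \<nu> (at y) c) differentiable (at p)" if "c \<in> Basis" for c
    by (rule Ck_field_differentiable[OF Ck_field_deriv[OF Ck_normal open_W that] p_W])
  have \<nu>': "((\<lambda>y. frechet_derivative \<nu> (at y) c) has_derivative \<nu>' c) (at p)" if "c \<in> Basis" for c
    unfolding \<nu>'_def by (rule has_derivative_frechet[OF d'[OF that]])
  have dn: "(\<nu> has_derivative ?M) (at p)" by (rule has_derivative_frechet[OF normal_differentiable[OF p_W]])
  have dZ: "frechet_derivative Z (at p) = (\<lambda>h. \<Sum>c\<in>Basis. (\<nu> p \<bullet> c) *\<^sub>R \<nu>' c h + (?M h \<bullet> c) *\<^sub>R ?M c)"
    unfolding Z_def[abs_def]
    by (intro frechet_derivative_eq has_derivative_sum has_derivative_scaleR has_derivative_inner_left dn \<nu>')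
  have ddiv: "frechet_derivative (divergence \<nu>) (at p) = (\<lambda>h. \<Sum>b\<in>Basis. \<nu>' b h \<bullet> b)"
    unfolding divergence_def[abs_def]
    by (intro frechet_derivative_eq has_derivative_sum has_derivative_inner_left \<nu>')
  have comm: "\<nu>' c b \<bullet> b = \<nu>' b c \<bullet> b" if bc: "b \<in> Basis" "c \<in> Basis" for b c
  proof -
    have Cb: "Ck_on (Suc (Suc 0)) W (\<lambda>y. \<nu> y \<bullet> b)"
      using Ck_normal[of "Suc (Suc 0)"] bc(1) unfolding Ck_field_def by blast
    have e: "\<nu>' c h \<bullet> b = frechet_derivative (\<lambda>y. frechet_derivative (\<lambda>z. \<nu> z \<bullet> b) (at y) c) (at p) h"
      if "c \<in> Basis" for c h
    proof -
      have "((\<lambda>y. frechet_derivative (\<lambda>z. \<nu> z \<bullet> b) (at y) c) has_derivative (\<lambda>h. \<nu>' c h \<bullet> b)) (at p)"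
        by (rule has_derivative_transform_within_open[OF has_derivative_inner_left[OF \<nu>'[OF that]] open_W p_W])
          (simp add: frechet_derivative_inner normal_differentiable)
      then show ?thesis by (simp add: frechet_derivative_eq)
    qed
    show ?thesis unfolding e[OF bc(2)] e[OF bc(1)] by (rule mixed_partials_commute[OF Cb open_W p_W])
  qed
  have "divergence Z p = (\<Sum>b\<in>Basis. \<Sum>c\<in>Basis. (\<nu> p \<bullet> c) * (\<nu>' c b \<bullet> b)) + sff_norm_sq S p"
    unfolding divergence_def dZ trace_square_normal_deriv[symmetric]
    by (simp add: inner_sum_left inner_add_left sum.distrib)
  also have "(\<Sum>b\<in>Basis. \<Sum>c\<in>Basis. (\<nu> p \<bullet> c) * (\<nu>' c b \<bullet> b)) = (\<Sum>b\<in>Basis. \<nu>' b (\<nu> p) \<bullet> b)"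
  proof (rule sum.cong[OF refl])
    fix b :: 'a assume b: "b \<in> Basis"
    have "\<nu>' b (\<nu> p) = (\<Sum>c\<in>Basis. (\<nu> p \<bullet> c) *\<^sub>R \<nu>' b c)"
      by (rule linear_Basis_sum[OF has_derivative_linear[OF \<nu>'[OF b]]])
    then show "(\<Sum>c\<in>Basis. (\<nu> p \<bullet> c) * (\<nu>' c b \<bullet> b)) = \<nu>' b (\<nu> p) \<bullet> b"
      using comm[OF b] by (simp add: inner_sum_left)
  qed
  finally show ?thesis unfolding ddiv by simp
qed

text \<open>The variation of the mean curvature of the level sets of \<open>G\<close> across \<open>S\<close> is governed by the
  Jacobi operator, the speed of the variation being the weight.\<close>

theorem jacobi_weight_eq_normal_derivative:
  "- jacobi_op S w p / w p = frechet_derivative (divergence \<nu>) (at p) (\<nu> p)"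
  "frechet_derivative (divergence \<nu>) (at p) (\<nu> p) = divergence Z p - sff_norm_sq S p"
proof -
  show "frechet_derivative (divergence \<nu>) (at p) (\<nu> p) = divergence Z p - sff_norm_sq S p"
    using divergence_Z by simp
  show "- jacobi_op S w p / w p = frechet_derivative (divergence \<nu>) (at p) (\<nu> p)"
    using weight_pos[OF p_W] unfolding jacobi_op_def surface_laplacian_weight divergence_Z by (simp add: field_simps)
qed

text \<open>In \<open>\<Delta>G = div (|\<nabla>G| \<nu>)\<close> the derivative of \<open>|\<nabla>G|\<close> along \<open>\<nu>\<close> is what the second term of the level operator
  removes.\<close>

lemma level_op_eq:
  assumes y: "y \<in> W"
  shows "level_op G y = norm (grad G y) ^ 3 * divergence \<nu> y"
proof -
  define g where "g y = norm (grad G y)" for y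
  have gd: "g differentiable (at y)" using norm_grad_deriv(1)[OF y] by (auto simp: g_def[abs_def] differentiable_def)
  have gG: "grad G y = g y *\<^sub>R \<nu> y" if "y \<in> W" for y unfolding g_def by (rule grad_eq_normal[OF that])
  have "laplacian G y = divergence (\<lambda>y. g y *\<^sub>R \<nu> y) y"
    unfolding laplacian_def
    by (rule divergence_cong_open(1)[OF open_W y gG Ck_field_differentiable[OF Ck_field_grad[OF Ck_G] y]])
  also have "\<dots> = g y * divergence \<nu> y + grad g y \<bullet> \<nu> y"
    by (rule divergence_scaleR[OF gd normal_differentiable[OF y]])
  finally have lap: "laplacian G y = g y * divergence \<nu> y + grad g y \<bullet> \<nu> y" .
  have "((\<lambda>y. (g y)\<^sup>2) has_derivative (\<lambda>h. 2 * g y * (grad g y \<bullet> h))) (at y)"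
    using has_derivative_power[OF has_derivative_grad[OF gd], of 2] by (simp add: mult_ac)
  then have gg: "grad (\<lambda>y. (g y)\<^sup>2) y = (2 * g y) *\<^sub>R grad g y" by (intro gradI) simp
  have "level_op G y = (g y)\<^sup>2 * laplacian G y - 1/2 * (grad (\<lambda>y. (g y)\<^sup>2) y \<bullet> grad G y)"
    by (simp add: level_op_def g_def)
  also have "\<dots> = (g y)\<^sup>2 * (g y * divergence \<nu> y + grad g y \<bullet> \<nu> y) - 1/2 * (((2 * g y) *\<^sub>R grad g y) \<bullet> (g y *\<^sub>R \<nu> y))"
    by (simp only: lap gg gG[OF y])
  also have "\<dots> = g y ^ 3 * divergence \<nu> y"
    by (simp add: power2_eq_square power3_eq_cube algebra_simps)
  finally show ?thesis by (simp add: g_def)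
qed

text \<open>Where \<open>div \<nu>\<close> vanishes, the derivative of its factor \<open>|\<nabla>G|\<^sup>3\<close> does not contribute.\<close>

lemma level_op_normal_derivative:
  assumes "mean_curvature S p = 0"
  shows "level_op G p = 0"
    and "frechet_derivative (level_op G) (at p) (\<nu> p) = norm (grad G p) ^ 3 * frechet_derivative (divergence \<nu>) (at p) (\<nu> p)"
proof -
  have H0: "divergence \<nu> p = 0" using assms mean_curvature_zero_iff by simp
  then show "level_op G p = 0" by (simp add: level_op_eq[OF p_W])
  have "divergence \<nu> differentiable (at p)"
    using Ck_on_divergence[OF Ck_normal[of "Suc (Suc 0)"] open_W] p_W by simp
  then have 1: "(divergence \<nu> has_derivative frechet_derivative (divergence \<nu>) (at p)) (at p)"
    by (rule has_derivative_frechet)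
  have "(level_op G has_derivative (\<lambda>h. norm (grad G p) ^ 3 * frechet_derivative (divergence \<nu>) (at p) h
      + (of_nat 3 * (frechet_derivative (grad G) (at p) h \<bullet> \<nu> p) * norm (grad G p) ^ (3 - 1)) * divergence \<nu> p)) (at p)"
    by (rule has_derivative_transform_within_open[OF has_derivative_mult[OF has_derivative_power[OF norm_grad_deriv(1)[OF p_W]] 1] open_W p_W])
      (simp add: level_op_eq)
  then show "frechet_derivative (level_op G) (at p) (\<nu> p) = norm (grad G p) ^ 3 * frechet_derivative (divergence \<nu>) (at p) (\<nu> p)"
    using H0 by (simp add: frechet_derivative_eq)
qed

end

section \<open>Division by a defining function\<close>

text \<open>Weighted mean of \<open>k\<close> over the segment from \<open>y\<close> to the foot point \<open>y - t y e\<close>.  The weights \<open>s\<^sup>m\<close> make the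
  family closed under differentiation in \<open>y\<close>, from which smoothness of all its members follows.\<close>

definition segment_mean :: "'a::euclidean_space \<Rightarrow> ('a \<Rightarrow> real) \<Rightarrow> nat \<Rightarrow> ('a \<Rightarrow> real) \<Rightarrow> 'a \<Rightarrow> real" where
  "segment_mean e t m k y = integral {0..1} (\<lambda>s. s ^ m * k (y - (s * t y) *\<^sub>R e))"

lemma segment_mean_has_derivative:
  fixes k :: "'a::euclidean_space \<Rightarrow> real"
  assumes V: "open V" "y \<in> V" and B: "open B" "\<And>x s. x \<in> V \<Longrightarrow> 0 \<le> s \<Longrightarrow> s \<le> 1 \<Longrightarrow> x - (s * t x) *\<^sub>R e \<in> B"
    and k: "Ck_on (Suc 0) B k" and t: "Ck_on (Suc 0) V t"
  shows "(segment_mean e t m k has_derivative (\<lambda>h. segment_mean e t m (\<lambda>z. grad k z \<bullet> h) y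
      - (grad t y \<bullet> h) * segment_mean e t (Suc m) (\<lambda>z. grad k z \<bullet> e) y)) (at y)"
proof -
  obtain r where r: "r > 0" "ball y r \<subseteq> V" using V open_contains_ball by blast
  let ?U = "ball y r"
  define \<gamma> where "\<gamma> x s = x - (s * t x) *\<^sub>R e" for x s
  define v where "v x s = s ^ m *\<^sub>R (grad k (\<gamma> x s) - (s * (grad k (\<gamma> x s) \<bullet> e)) *\<^sub>R grad t x)" for x s
  have td: "t differentiable (at x)" if "x \<in> V" for x using t that by simp
  have kd: "k differentiable (at x)" if "x \<in> B" for x using k that by simp
  have \<gamma>B: "\<gamma> x s \<in> B" if "x \<in> V" "s \<in> {0..1}" for x s using B(2) that by (simp add: \<gamma>_def)
  have cont_t: "continuous_on V t" by (rule Ck_on_continuous[OF t])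
  have cont_gt: "continuous_on V (grad t)" by (rule Ck_field_continuous[OF Ck_field_grad[OF t]])
  have cont_k: "continuous_on B k" by (rule Ck_on_continuous[OF k])
  have cont_gk: "continuous_on B (grad k)" by (rule Ck_field_continuous[OF Ck_field_grad[OF k]])
  have cont_\<gamma>: "continuous_on (?U \<times> {0..1}) (\<lambda>(x, s). \<gamma> x s)"
    unfolding \<gamma>_def case_prod_beta using r(2)
    by (intro continuous_intros continuous_on_compose2[OF cont_t]) auto
  have cont_gk\<gamma>: "continuous_on (?U \<times> {0..1}) (\<lambda>p. grad k (\<gamma> (fst p) (snd p)))"
    by (rule continuous_on_compose2[OF cont_gk cont_\<gamma>[unfolded case_prod_beta]]) (use r(2) \<gamma>B in auto)
  have cont_v: "continuous_on (?U \<times> {0..1}) (\<lambda>(x, s). blinfun_inner_right (v x s))"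
    unfolding v_def case_prod_beta using r(2)
    by (intro bounded_linear.continuous_on[OF bounded_linear_blinfun_inner_right] continuous_intros cont_gk\<gamma>
        continuous_on_compose2[OF cont_gt]) auto
  have lz: "((\<lambda>x. integral (cbox 0 1) (\<lambda>s. s ^ m * k (\<gamma> x s))) has_derivative
      blinfun_apply (integral (cbox 0 1) (\<lambda>s. blinfun_inner_right (v y s)))) (at y within ?U)"
  proof (rule leibniz_rule[where f = "\<lambda>x s. s ^ m * k (\<gamma> x s)" and fx = "\<lambda>x s. blinfun_inner_right (v x s)"])
    fix x s assume x: "x \<in> ?U" and s: "s \<in> cbox 0 (1::real)"
    have xV: "x \<in> V" using x r by auto
    have "((\<lambda>x. \<gamma> x s) has_derivative (\<lambda>h. h - (s * (grad t x \<bullet> h)) *\<^sub>R e)) (at x)"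
      unfolding \<gamma>_def by (intro has_derivative_diff has_derivative_ident has_derivative_scaleR_left
        has_derivative_mult_right has_derivative_grad td xV)
    from has_derivative_compose[OF this has_derivative_grad[OF kd[OF \<gamma>B[OF xV]]]] s
    have "((\<lambda>x. k (\<gamma> x s)) has_derivative (\<lambda>h. grad k (\<gamma> x s) \<bullet> (h - (s * (grad t x \<bullet> h)) *\<^sub>R e))) (at x)" by simp
    from has_derivative_mult_right[OF this, of "s ^ m"]
    have "((\<lambda>x. s ^ m * k (\<gamma> x s)) has_derivative (\<lambda>h. s ^ m * (grad k (\<gamma> x s) \<bullet> (h - (s * (grad t x \<bullet> h)) *\<^sub>R e)))) (at x)" .
    moreover have "(\<lambda>h. s ^ m * (grad k (\<gamma> x s) \<bullet> (h - (s * (grad t x \<bullet> h)) *\<^sub>R e))) = blinfun_apply (blinfun_inner_right (v x s))"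
      by (simp add: v_def fun_eq_iff inner_diff_right inner_diff_left algebra_simps)
    ultimately show "((\<lambda>x. s ^ m * k (\<gamma> x s)) has_derivative blinfun_apply (blinfun_inner_right (v x s))) (at x within ?U)"
      by (metis has_derivative_at_withinI)
  next
    fix x assume x: "x \<in> ?U"
    have "continuous_on {0..1} (\<lambda>s. s ^ m * k (\<gamma> x s))"
      using x r(2) \<gamma>B unfolding \<gamma>_def
      by (intro continuous_intros continuous_on_compose2[OF cont_k]) auto
    then show "(\<lambda>s. s ^ m * k (\<gamma> x s)) integrable_on cbox 0 1" by (simp add: integrable_continuous_interval)
  qed (use r cont_v in auto)
  have vy: "continuous_on {0..1} (\<lambda>s. blinfun_inner_right (v y s))"
    by (rule continuous_on_compose2[OF cont_v[unfolded case_prod_beta], of "{0..1}" "\<lambda>s. (y, s)", simplified])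
      (use r in \<open>auto intro!: continuous_intros\<close>)
  have app: "blinfun_apply (integral {0..1} (\<lambda>s. blinfun_inner_right (v y s))) h
      = segment_mean e t m (\<lambda>z. grad k z \<bullet> h) y - (grad t y \<bullet> h) * segment_mean e t (Suc m) (\<lambda>z. grad k z \<bullet> e) y" for h
  proof -
    have gy: "continuous_on {0..1} (\<lambda>s. grad k (\<gamma> y s))"
      by (rule continuous_on_compose2[OF cont_gk\<gamma>, of "{0..1}" "\<lambda>s. (y, s)", simplified])
        (use r in \<open>auto intro!: continuous_intros\<close>)
    have i1: "(\<lambda>s. s ^ m * (grad k (\<gamma> y s) \<bullet> h)) integrable_on {0..1}"
      by (intro integrable_continuous_interval continuous_intros gy)
    have "blinfun_apply (integral {0..1} (\<lambda>s. blinfun_inner_right (v y s))) h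
        = integral {0..1} (\<lambda>s. blinfun_apply (blinfun_inner_right (v y s)) h)"
      by (rule blinfun_apply_integral) (rule integrable_continuous_interval[OF vy])
    also have "\<dots> = integral {0..1} (\<lambda>s. s ^ m * (grad k (\<gamma> y s) \<bullet> h) - (grad t y \<bullet> h) * (s ^ Suc m * (grad k (\<gamma> y s) \<bullet> e)))"
      by (simp add: v_def inner_diff_left algebra_simps)
    also have "\<dots> = integral {0..1} (\<lambda>s. s ^ m * (grad k (\<gamma> y s) \<bullet> h)) - (grad t y \<bullet> h) * integral {0..1} (\<lambda>s. s ^ Suc m * (grad k (\<gamma> y s) \<bullet> e))"
    proof -
      have i3: "(\<lambda>s. (grad t y \<bullet> h) * (s ^ Suc m * (grad k (\<gamma> y s) \<bullet> e))) integrable_on {0..1}"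
        by (intro integrable_continuous_interval continuous_intros gy)
      show ?thesis by (simp only: integral_diff[OF i1 i3] integral_mult_right)
    qed
    finally show ?thesis unfolding segment_mean_def \<gamma>_def .
  qed
  have "at y within ?U = at y" using r by (intro at_within_open) auto
  moreover have "segment_mean e t m k = (\<lambda>x. integral (cbox 0 1) (\<lambda>s. s ^ m * k (\<gamma> x s)))"
    by (simp add: segment_mean_def \<gamma>_def fun_eq_iff)
  moreover have "blinfun_apply (integral (cbox 0 1) (\<lambda>s. blinfun_inner_right (v y s)))
      = (\<lambda>h. segment_mean e t m (\<lambda>z. grad k z \<bullet> h) y - (grad t y \<bullet> h) * segment_mean e t (Suc m) (\<lambda>z. grad k z \<bullet> e) y)"
    using app by (simp add: fun_eq_iff)
  ultimately show ?thesis using lz by simp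
qed


lemma Ck_segment_mean:
  assumes V: "open V" and B: "open B" "\<And>x s. x \<in> V \<Longrightarrow> 0 \<le> s \<Longrightarrow> s \<le> 1 \<Longrightarrow> x - (s * t x) *\<^sub>R e \<in> B"
    and k: "smooth_on B k" and t: "smooth_on V t"
  shows "Ck_on j V (segment_mean e t m k)"
  using k
proof (induction j arbitrary: m k)
  case 0
  show ?case
    using segment_mean_has_derivative[OF V _ B, of _ k m] 0 t
    by (auto intro!: continuous_at_imp_continuous_on has_derivative_continuous simp: smooth_on_def simp del: Ck_on.simps(2))
next
  case (Suc j)
  have k1: "Ck_on (Suc 0) B k" and t1: "Ck_on (Suc 0) V t" using Suc.prems t by (auto simp: smooth_on_def simp del: Ck_on.simps)
  have kh: "smooth_on B (\<lambda>z. grad k z \<bullet> h)" for h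
    using Suc.prems unfolding smooth_on_def by (intro allI Ck_on_inner B(1) Ck_field_grad Ck_field_const) blast
  show ?case
  proof (rule Ck_on_SucI[OF segment_mean_has_derivative[OF V _ B k1 t1] V])
    fix b :: 'a assume b: "b \<in> Basis"
    have "Ck_on j V (\<lambda>x. grad t x \<bullet> b)"
      using t unfolding smooth_on_def by (intro Ck_on_inner V Ck_field_grad Ck_field_const) blast
    then show "Ck_on j V (\<lambda>x. segment_mean e t m (\<lambda>z. grad k z \<bullet> b) x - (grad t x \<bullet> b) * segment_mean e t (Suc m) (\<lambda>z. grad k z \<bullet> e) x)"
      using Suc.IH[OF kh] by (intro Ck_on_diff Ck_on_mult V) auto
  qed
qed

lemma segment_mean_fundamental:
  fixes k :: "'a::euclidean_space \<Rightarrow> real"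
  assumes B: "\<And>s. 0 \<le> s \<Longrightarrow> s \<le> 1 \<Longrightarrow> y - (s * t y) *\<^sub>R e \<in> B" and k: "Ck_on (Suc 0) B k"
  shows "k y - k (y - t y *\<^sub>R e) = t y * segment_mean e t 0 (\<lambda>z. grad k z \<bullet> e) y"
proof -
  have der: "((\<lambda>s. k (y - (s * t y) *\<^sub>R e)) has_vector_derivative - (t y * (grad k (y - (s * t y) *\<^sub>R e) \<bullet> e))) (at s within {0..1})"
    if "s \<in> {0..1}" for s
  proof -
    have kd: "k differentiable (at (y - (s * t y) *\<^sub>R e))" using k B[of s] that by simp
    have "((\<lambda>s. y - (s * t y) *\<^sub>R e) has_derivative (\<lambda>r. - (r * t y) *\<^sub>R e)) (at s)"
      by (auto intro!: derivative_eq_intros)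
    from has_derivative_compose[OF this has_derivative_grad[OF kd]]
    have "((\<lambda>s. k (y - (s * t y) *\<^sub>R e)) has_derivative (\<lambda>r. r *\<^sub>R - (t y * (grad k (y - (s * t y) *\<^sub>R e) \<bullet> e)))) (at s)"
      by (simp add: mult_ac)
    then show ?thesis unfolding has_vector_derivative_def by (rule has_derivative_at_withinI)
  qed
  have "((\<lambda>s. - (t y * (grad k (y - (s * t y) *\<^sub>R e) \<bullet> e))) has_integral k (y - (1 * t y) *\<^sub>R e) - k (y - (0 * t y) *\<^sub>R e)) {0..1}"
    by (rule fundamental_theorem_of_calculus) (auto intro: der)
  then have "integral {0..1} (\<lambda>s. - (t y * (grad k (y - (s * t y) *\<^sub>R e) \<bullet> e))) = k (y - (1 * t y) *\<^sub>R e) - k (y - (0 * t y) *\<^sub>R e)"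
    by (rule integral_unique)
  then show ?thesis by (simp add: segment_mean_def)
qed

text \<open>Along \<open>e\<close> both functions are the height times the mean of their \<open>e\<close>-derivative over the
  segment down to the surface, and for the defining function this mean does not vanish.\<close>

lemma smooth_division:
  assumes ld: "local_defining S p W G" and p: "p \<in> S"
    and h: "smooth_on W h" "\<And>y. y \<in> S \<inter> W \<Longrightarrow> h y = 0"
  obtains V q where "open V" "p \<in> V" "V \<subseteq> W" "smooth_on V q" "\<forall>y\<in>V. h y = G y * q y"
proof -
  obtain e D t W1 where c: "graph_chart e D t" "open W1" "p \<in> W1" "W1 \<subseteq> W" "p \<in> graph_chart.graph D t"
    "graph_chart.graph D t = S \<inter> W1" "\<And>y. y \<in> W1 \<Longrightarrow> grad G y \<bullet> e > 0"
    using graph_chart_exists[OF ld p] by metis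
  interpret graph_chart e D t by fact
  obtain r where r: "r > 0" "ball p r \<subseteq> W1" using c(2,3) open_contains_ball by blast
  let ?B = "ball p r"
  define V where "V = (D \<inter> pr -` ?B) \<inter> ?B"
  have V: "open V" unfolding V_def
    by (intro open_Int continuous_open_preimage[OF continuous_pr open_D] open_ball)
  have pV: "p \<in> V" using c(5) graph_subset r(1) by (auto simp: V_def)
  have VW: "V \<subseteq> W" using r(2) c(4) by (auto simp: V_def)
  have seg: "y - (s * t y) *\<^sub>R e \<in> ?B" if y: "y \<in> V" and s: "0 \<le> s" "s \<le> 1" for y s
  proof -
    have "(1 - s) *\<^sub>R y + s *\<^sub>R pr y \<in> ?B"
      using y s by (intro convexD[OF convex_ball]) (auto simp: V_def)
    moreover have "(1 - s) *\<^sub>R y + s *\<^sub>R pr y = y - (s * t y) *\<^sub>R e"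
      by (simp add: pr_def algebra_simps)
    ultimately show ?thesis by simp
  qed
  have sm: "smooth_on ?B f" if "smooth_on W f" for f
    using that r(2) c(4) unfolding smooth_on_def by (blast intro: Ck_on_subset)
  have G: "smooth_on W G" using ld by (simp add: local_defining_def)
  have tV: "smooth_on V t" using t_smooth unfolding smooth_on_def V_def by (blast intro: Ck_on_subset)
  define I where "I k = segment_mean e t 0 (\<lambda>z. grad k z \<bullet> e)" for k
  have I_C: "Ck_on j V (I k)" if "smooth_on W k" for k j
    unfolding I_def
  proof (rule Ck_segment_mean[OF V open_ball seg _ tV])
    show "smooth_on ?B (\<lambda>z. grad k z \<bullet> e)"
      using sm[OF that] unfolding smooth_on_def by (intro allI Ck_on_inner open_ball Ck_field_grad Ck_field_const) blast
  qed
  have I_eq: "k y = t y * I k y" if "smooth_on W k" "\<And>y. y \<in> S \<inter> W \<Longrightarrow> k y = 0" "y \<in> V" for k y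
  proof -
    have "pr y \<in> S \<inter> W" using that(3) pr_in_graph[of y] c(4,6) by (auto simp: V_def)
    then have "k (pr y) = 0" by (rule that(2))
    moreover have "k y - k (y - t y *\<^sub>R e) = t y * I k y"
      unfolding I_def using sm[OF that(1)] that(3) by (intro segment_mean_fundamental[where B = ?B] seg) (auto simp: smooth_on_def simp del: Ck_on.simps)
    ultimately show ?thesis by (simp add: pr_def)
  qed
  have I_pos: "I G y > 0" if y: "y \<in> V" for y
  proof -
    have gc: "continuous_on ?B (grad G)"
      using sm[OF G] by (intro Ck_field_continuous[of 0] Ck_field_grad) (simp add: smooth_on_def del: Ck_on.simps)
    have cont: "continuous_on {0..1} (\<lambda>s. grad G (y - (s * t y) *\<^sub>R e) \<bullet> e)"
      by (intro continuous_intros continuous_on_compose2[OF gc]) (use seg[OF y] in auto)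
    have pos: "grad G (y - (s * t y) *\<^sub>R e) \<bullet> e > 0" if "s \<in> {0..1}" for s
      using c(7) seg[OF y] that r(2) by (meson atLeastAtMost_iff subsetD)
    have int: "((\<lambda>s. grad G (y - (s * t y) *\<^sub>R e) \<bullet> e) has_integral I G y) {0..1}"
      unfolding I_def segment_mean_def using integrable_integral[OF integrable_continuous_interval[OF cont]] by simp
    have "I G y \<ge> 0" by (rule has_integral_nonneg[OF int]) (use pos in \<open>auto intro: less_imp_le\<close>)
    moreover have "I G y \<noteq> 0"
    proof
      assume "I G y = 0"
      then have "grad G (y - (0 * t y) *\<^sub>R e) \<bullet> e = 0"
        using has_integral_0_cbox_imp_0[of 0 1 "\<lambda>s. grad G (y - (s * t y) *\<^sub>R e) \<bullet> e" 0] cont pos int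
        by (auto intro: less_imp_le)
      then show False using pos[of 0] by simp
    qed
    ultimately show ?thesis by simp
  qed
  show ?thesis
  proof (rule that[OF V pV VW])
    show "smooth_on V (\<lambda>y. I h y / I G y)"
      unfolding smooth_on_def using I_C[OF h(1)] I_C[OF G] I_pos
      by (intro allI Ck_on_divide V) (auto dest: order_less_imp_not_eq2)
    show "\<forall>y\<in>V. h y = G y * (I h y / I G y)"
    proof
      fix y assume y: "y \<in> V"
      have "G z = 0" if "z \<in> S \<inter> W" for z using ld that by (auto simp: local_defining_def)
      then show "h y = G y * (I h y / I G y)"
        using I_eq[OF h(1) h(2) y] I_eq[OF G _ y] I_pos[OF y] by (simp add: field_simps)
    qed
  qed
qed

lemma grad_product_zero:
  assumes "f differentiable (at x)" "g differentiable (at x)" "f x = 0"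
    "open V" "x \<in> V" "\<forall>y\<in>V. h y = f y * g y"
  shows "grad h x = g x *\<^sub>R grad f x"
proof (rule gradI)
  have "((\<lambda>y. f y * g y) has_derivative (\<lambda>k. f x * (grad g x \<bullet> k) + (grad f x \<bullet> k) * g x)) (at x)"
    by (intro has_derivative_mult has_derivative_grad assms)
  then have "((\<lambda>y. f y * g y) has_derivative (\<lambda>k. (g x *\<^sub>R grad f x) \<bullet> k)) (at x)"
    using assms(3) by (simp add: mult.commute)
  then show "(h has_derivative (\<lambda>k. (g x *\<^sub>R grad f x) \<bullet> k)) (at x)"
    by (rule has_derivative_transform_within_open[OF _ assms(4,5)]) (use assms(6) in simp)
qed

text \<open>At a zero of \<open>F\<close> the quotient is read off from the gradients, since \<open>h = F q\<close> gives
  \<open>\<nabla>h = q \<nabla>F\<close> there.\<close>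

lemma smooth_quotient_exists:
  assumes U: "open U" and F: "smooth_on U F" "\<And>x. x \<in> U \<Longrightarrow> F x = 0 \<Longrightarrow> grad F x \<noteq> 0"
    and h: "smooth_on U h" "\<And>x. x \<in> U \<Longrightarrow> F x = 0 \<Longrightarrow> h x = 0"
  shows "\<exists>q. smooth_on U q \<and> (\<forall>x\<in>U. F x \<noteq> 0 \<longrightarrow> q x = h x / F x)"
proof -
  define q where "q x = (if F x \<noteq> 0 then h x / F x else (grad h x \<bullet> grad F x) / (grad F x \<bullet> grad F x))" for x
  have contF: "continuous_on U F" using F(1) Ck_on_continuous unfolding smooth_on_def by blast
  have "smooth_on U q" unfolding smooth_on_def
  proof (intro allI Ck_on_local)
    fix k x assume x: "x \<in> U"
    show "\<exists>V. open V \<and> x \<in> V \<and> Ck_on k V q"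
    proof (cases "F x = 0")
      case False
      define V where "V = U \<inter> F -` (- {0})"
      have V: "open V" unfolding V_def by (rule continuous_open_preimage[OF contF U]) auto
      have "Ck_on k V (\<lambda>x. h x / F x)"
        using F(1) h(1) unfolding smooth_on_def V_def by (intro Ck_on_divide V[unfolded V_def]) (auto intro: Ck_on_subset)
      then have "Ck_on k V q" by (rule Ck_on_cong[OF V, rotated]) (auto simp: q_def V_def)
      then show ?thesis using V x False by (intro exI[of _ V]) (auto simp: V_def)
    next
      case True
      have contg: "continuous_on U (grad F)"
        using F(1) by (intro Ck_field_continuous[of 0] Ck_field_grad) (simp add: smooth_on_def del: Ck_on.simps)
      define W where "W = U \<inter> grad F -` (- {0})"
      have W: "open W" unfolding W_def by (rule continuous_open_preimage[OF contg U]) auto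
      have xW: "x \<in> W" using x F(2)[OF x True] by (simp add: W_def)
      define S where "S = {y\<in>W. F y = 0}"
      have "local_defining S x W F" unfolding local_defining_def
        using W xW F(1) by (auto simp: S_def W_def smooth_on_def intro: Ck_on_subset)
      moreover have "x \<in> S" using xW True by (simp add: S_def)
      moreover have "smooth_on W h" using h(1) unfolding smooth_on_def W_def by (blast intro: Ck_on_subset)
      ultimately obtain V q' where V: "open V" "x \<in> V" "V \<subseteq> W" "smooth_on V q'" "\<forall>y\<in>V. h y = F y * q' y"
        using smooth_division[of S x W F h] h(2) by (auto simp: S_def W_def)
      have "q' y = q y" if y: "y \<in> V" for y
      proof (cases "F y = 0")
        case True
        have yU: "y \<in> U" using y V(3) by (auto simp: W_def)
        have "grad h y = q' y *\<^sub>R grad F y"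
          by (rule grad_product_zero[OF smooth_on_differentiable[OF F(1) yU] smooth_on_differentiable[OF V(4) y] True V(1) y V(5)])
        then show ?thesis using True F(2)[OF yU True] by (simp add: q_def)
      next
        case False
        then show ?thesis using V(5) y by (simp add: q_def)
      qed
      then have eq: "\<forall>y\<in>V. q' y = q y" by simp
      have "Ck_on k V q'" using V(4) unfolding smooth_on_def by blast
      then have "Ck_on k V q" by (rule Ck_on_cong[OF V(1) eq])
      then show ?thesis using V by blast
    qed
  qed
  then show ?thesis by (intro exI[of _ q]) (simp add: q_def)
qed

section \<open>Pointwise identities for test functions\<close>

context hypersurface_point
begin

lemma P_linear: "P y (a + b) = P y a + P y b" "P y (c *\<^sub>R a) = c *\<^sub>R P y a"
  by (simp_all add: P_def inner_add_left algebra_simps)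

text \<open>The second identity is why \<open>Z\<close> is convenient: the gradient of \<open>u / w\<close>, scaled by \<open>w\<close>, involves neither
  \<open>w\<close> nor its derivatives.\<close>

lemma surface_grad_quotient_weight:
  assumes V: "open V" "p \<in> V" "f differentiable (at p)" "\<And>y. y \<in> S \<inter> V \<Longrightarrow> u y = f y"
  shows "surface_grad S u p = P p (grad f p)"
    and "w p *\<^sub>R surface_grad S (\<lambda>y. u y / w y) p = P p (grad f p) + f p *\<^sub>R Z p"
proof -
  show "surface_grad S u p = P p (grad f p)" by (rule surface_grad_eq[OF V])
  have w0: "w p \<noteq> 0" using weight_pos[OF p_W] by simp
  have "((\<lambda>y. f y * inverse (w y)) has_derivative
      (\<lambda>h. f p * - (inverse (w p) * (grad w p \<bullet> h) * inverse (w p)) + (grad f p \<bullet> h) * inverse (w p))) (at p)"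
    using w0 by (intro has_derivative_mult Deriv.has_derivative_inverse has_derivative_grad V(3) w_differentiable p_W) auto
  moreover have "(\<lambda>h. f p * - (inverse (w p) * (grad w p \<bullet> h) * inverse (w p)) + (grad f p \<bullet> h) * inverse (w p))
      = (\<lambda>h. (inverse (w p) *\<^sub>R grad f p + (- (f p * inverse (w p) * inverse (w p))) *\<^sub>R grad w p) \<bullet> h)"
    by (simp add: fun_eq_iff inner_add_left algebra_simps)
  ultimately have d: "((\<lambda>y. f y / w y) has_derivative
      (\<lambda>h. (inverse (w p) *\<^sub>R grad f p + (- (f p * inverse (w p) * inverse (w p))) *\<^sub>R grad w p) \<bullet> h)) (at p)"
    by (simp add: divide_inverse)
  have "surface_grad S (\<lambda>y. u y / w y) p = P p (grad (\<lambda>y. f y / w y) p)"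
    by (rule surface_grad_eq[OF V(1,2)]) (use d V(4) in \<open>auto simp: differentiable_def\<close>)
  also have "\<dots> = inverse (w p) *\<^sub>R P p (grad f p) + (- (f p * inverse (w p) * inverse (w p))) *\<^sub>R P p (grad w p)"
    unfolding gradI[OF d] P_linear ..
  also have "\<dots> = inverse (w p) *\<^sub>R P p (grad f p) + (f p * inverse (w p)) *\<^sub>R Z p"
    unfolding P_grad_weight[OF p_W] using w0 by simp
  finally have e: "surface_grad S (\<lambda>y. u y / w y) p = inverse (w p) *\<^sub>R P p (grad f p) + (f p * inverse (w p)) *\<^sub>R Z p" .
  show "w p *\<^sub>R surface_grad S (\<lambda>y. u y / w y) p = P p (grad f p) + f p *\<^sub>R Z p"
    unfolding e using w0 by (simp add: scaleR_add_right)
qed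

lemma norm_surface_grad_quotient_weight:
  assumes V: "open V" "p \<in> V" "f differentiable (at p)" "\<And>y. y \<in> S \<inter> V \<Longrightarrow> u y = f y"
  shows "(w p)\<^sup>2 * (norm (surface_grad S (\<lambda>y. u y / w y) p))\<^sup>2
    = (P p (grad f p) + f p *\<^sub>R Z p) \<bullet> (P p (grad f p) + f p *\<^sub>R Z p)"
proof -
  have e: "P p (grad f p) + f p *\<^sub>R Z p = w p *\<^sub>R surface_grad S (\<lambda>y. u y / w y) p"
    by (rule surface_grad_quotient_weight(2)[OF V, symmetric])
  show ?thesis unfolding e power2_norm_eq_inner[symmetric] by (simp add: power_mult_distrib)
qed

text \<open>Substituting \<open>u = w v\<close> and completing the square leaves the divergence of \<open>(u\<^sup>2 / w) \<nabla>w\<close>, which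
  equals \<open>- u\<^sup>2 Z\<close>.\<close>

lemma ground_state_identity:
  assumes V: "open V" "p \<in> V" "f differentiable (at p)" "\<And>y. y \<in> S \<inter> V \<Longrightarrow> u y = f y"
  shows "(norm (surface_grad S u p))\<^sup>2 - sff_norm_sq S p * (u p)\<^sup>2
    = (w p)\<^sup>2 * (norm (surface_grad S (\<lambda>y. u y / w y) p))\<^sup>2
      + frechet_derivative (divergence \<nu>) (at p) (\<nu> p) * (u p)\<^sup>2
      + surface_div S (\<lambda>y. - (u y)\<^sup>2 *\<^sub>R Z y) p"
proof -
  let ?T = "P p (grad f p) + f p *\<^sub>R Z p"
  have up: "u p = f p" using V(2,4) p_in by auto
  have wv: "(w p)\<^sup>2 * (norm (surface_grad S (\<lambda>y. u y / w y) p))\<^sup>2 = ?T \<bullet> ?T"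
    by (rule norm_surface_grad_quotient_weight[OF V])
  have gf2: "((\<lambda>y. - (f y)\<^sup>2) has_derivative (\<lambda>h. (- (2 * f p)) *\<^sub>R grad f p \<bullet> h)) (at p)"
    using has_derivative_minus[OF has_derivative_power[OF has_derivative_grad[OF V(3)], of 2]] by (simp add: mult_ac)
  have div: "surface_div S (\<lambda>y. - (u y)\<^sup>2 *\<^sub>R Z y) p
      = - (f p)\<^sup>2 * divergence Z p + (- (2 * f p)) *\<^sub>R grad f p \<bullet> Z p + - (f p)\<^sup>2 * (Z p \<bullet> Z p)"
    unfolding gradI[OF gf2, symmetric]
    by (rule surface_div_scaled_Z[OF V(1,2)]) (use gf2 V(4) in \<open>auto simp: differentiable_def\<close>)
  have su: "surface_grad S u p = P p (grad f p)" by (rule surface_grad_quotient_weight(1)[OF V])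
  have PZ: "P p (grad f p) \<bullet> Z p = grad f p \<bullet> Z p"
    using P_inner(1)[OF p_W, of "grad f p" "Z p"] P_self[OF Z_orth[OF p_W]] by simp
  have TT: "?T \<bullet> ?T = P p (grad f p) \<bullet> P p (grad f p) + 2 * f p * (grad f p \<bullet> Z p) + (f p)\<^sup>2 * (Z p \<bullet> Z p)"
    by (simp add: inner_add_left inner_add_right PZ inner_commute[of "Z p" "P p (grad f p)"] power2_eq_square algebra_simps)
  show ?thesis
    unfolding wv TT div jacobi_weight_eq_normal_derivative(2) su up
    by (simp add: power2_norm_eq_inner algebra_simps)
qed

text \<open>The Hardy inequality follows from a further completed square, whose cross term is the
  divergence of \<open>u\<^sup>2 x / |x|\<^sup>2\<close>.\<close>

lemma hardy_identity:
  assumes V: "open V" "p \<in> V" "f differentiable (at p)" "\<And>y. y \<in> S \<inter> V \<Longrightarrow> u y = f y"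
    and p: "p \<noteq> 0" "p \<bullet> \<nu> p = 0" and Zp: "Z p \<bullet> p = l - 1" and dim: "DIM('a) = n + 1"
  defines "\<alpha> \<equiv> l - real n / 2"
  shows "(w p)\<^sup>2 * (norm (surface_grad S (\<lambda>y. u y / w y) p))\<^sup>2
    \<ge> \<alpha>\<^sup>2 * ((u p)\<^sup>2 / (norm p)\<^sup>2) + \<alpha> * surface_div S (\<lambda>y. ((u y)\<^sup>2 / (norm y)\<^sup>2) *\<^sub>R y) p"
proof -
  let ?T = "P p (grad f p) + f p *\<^sub>R Z p"
  define r2 where "r2 = p \<bullet> p"
  have r2: "r2 > 0" "(norm p)\<^sup>2 = r2" using p(1) by (auto simp: r2_def power2_norm_eq_inner)
  have up: "u p = f p" using V(2,4) p_in by auto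
  have wv: "(w p)\<^sup>2 * (norm (surface_grad S (\<lambda>y. u y / w y) p))\<^sup>2 = ?T \<bullet> ?T"
    by (rule norm_surface_grad_quotient_weight[OF V])
  define s where "s y = (f y)\<^sup>2 * inverse (y \<bullet> y)" for y
  have sd: "(s has_derivative (\<lambda>h. (f p)\<^sup>2 * - (inverse r2 * (2 * (p \<bullet> h)) * inverse r2) + (2 * f p * (grad f p \<bullet> h)) * inverse r2)) (at p)"
  proof -
    have 1: "((\<lambda>y. (f y)\<^sup>2) has_derivative (\<lambda>h. 2 * f p * (grad f p \<bullet> h))) (at p)"
      using has_derivative_power[OF has_derivative_grad[OF V(3)], of 2] by (simp add: mult_ac)
    have "((\<lambda>y. y \<bullet> y) has_derivative (\<lambda>h. p \<bullet> h + h \<bullet> p)) (at p)"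
      by (intro has_derivative_inner has_derivative_ident)
    then have 2: "((\<lambda>y. y \<bullet> y) has_derivative (\<lambda>h. 2 * (p \<bullet> h))) (at p)" by (simp add: inner_commute)
    have "((\<lambda>y. inverse (y \<bullet> y)) has_derivative (\<lambda>h. - (inverse r2 * (2 * (p \<bullet> h)) * inverse r2))) (at p)"
      unfolding r2_def by (rule Deriv.has_derivative_inverse[OF _ 2]) (use p(1) in simp)
    from has_derivative_mult[OF 1 this] show ?thesis unfolding s_def[abs_def] r2_def .
  qed
  then have sdiff: "s differentiable (at p)" by (auto simp: differentiable_def)
  have Xd: "((\<lambda>y. s y *\<^sub>R y) has_derivative (\<lambda>h. s p *\<^sub>R h + (grad s p \<bullet> h) *\<^sub>R p)) (at p)"
    by (intro has_derivative_scaleR has_derivative_grad sdiff has_derivative_ident)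
  have div_id: "divergence (\<lambda>y. y) p = real n + 1"
    using dim by (simp add: divergence_def frechet_derivative_eq[OF has_derivative_ident])
  have "surface_div S (\<lambda>y. ((u y)\<^sup>2 / (norm y)\<^sup>2) *\<^sub>R y) p
      = divergence (\<lambda>y. s y *\<^sub>R y) p - frechet_derivative (\<lambda>y. s y *\<^sub>R y) (at p) (\<nu> p) \<bullet> \<nu> p"
    by (rule surface_div_eq[OF V(1,2)])
      (use Xd V(4) in \<open>auto simp: differentiable_def s_def power2_norm_eq_inner divide_inverse\<close>)
  also have "\<dots> = s p * (real n + 1) + grad s p \<bullet> p - s p"
    unfolding divergence_scaleR[OF sdiff differentiable_ident] div_id frechet_derivative_eq[OF Xd]
    using p(2) p_W by (simp add: inner_add_left)
  also have "grad s p \<bullet> p = 2 * f p * (grad f p \<bullet> p) / r2 - 2 * (f p)\<^sup>2 / r2"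
    unfolding frechet_derivative_grad[OF sdiff, symmetric] frechet_derivative_eq[OF sd]
    using r2(1) by (simp add: r2_def[symmetric] field_simps power2_eq_square)
  also have "s p = (f p)\<^sup>2 / r2" by (simp add: s_def r2_def divide_inverse)
  finally have div: "surface_div S (\<lambda>y. ((u y)\<^sup>2 / (norm y)\<^sup>2) *\<^sub>R y) p
      = (real n - 2) * ((f p)\<^sup>2 / r2) + 2 * f p * (grad f p \<bullet> p) / r2"
    by (simp add: algebra_simps add_divide_distrib diff_divide_distrib)
  have Tp: "?T \<bullet> p = grad f p \<bullet> p + f p * (l - 1)"
    using P_inner(1)[OF p_W, of "grad f p" p] P_self[OF p(2)] Zp by (simp add: inner_add_left)
  \<comment> \<open>The radial vector subtracted has the factor for which the cross term becomes \<open>\<alpha>\<close> times the divergence.\<close>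
  define c where "c = \<alpha> * f p / r2"
  have "0 \<le> (?T - c *\<^sub>R p) \<bullet> (?T - c *\<^sub>R p)" by simp
  also have "\<dots> = ?T \<bullet> ?T - 2 * c * (?T \<bullet> p) + c\<^sup>2 * r2"
    unfolding r2_def inner_diff_left inner_diff_right inner_scaleR_left inner_scaleR_right inner_commute[of p ?T]
    by (simp add: power2_eq_square algebra_simps)
  also have "c\<^sup>2 * r2 = \<alpha>\<^sup>2 * ((f p)\<^sup>2 / r2)"
    using r2(1) by (simp add: c_def field_simps power2_eq_square)
  also have "2 * c * (?T \<bullet> p) = \<alpha> * (2 * f p * (grad f p \<bullet> p) / r2) + 2 * \<alpha> * (l - 1) * ((f p)\<^sup>2 / r2)"
    unfolding Tp c_def using r2(1) by (simp add: field_simps power2_eq_square)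
  finally have "\<alpha> * (2 * f p * (grad f p \<bullet> p) / r2) + 2 * \<alpha> * (l - 1) * ((f p)\<^sup>2 / r2) - \<alpha>\<^sup>2 * ((f p)\<^sup>2 / r2) \<le> ?T \<bullet> ?T"
    by linarith
  moreover have "\<alpha>\<^sup>2 * ((f p)\<^sup>2 / r2) + \<alpha> * ((real n - 2) * ((f p)\<^sup>2 / r2) + 2 * f p * (grad f p \<bullet> p) / r2)
      = \<alpha> * (2 * f p * (grad f p \<bullet> p) / r2) + 2 * \<alpha> * (l - 1) * ((f p)\<^sup>2 / r2) - \<alpha>\<^sup>2 * ((f p)\<^sup>2 / r2)"
  proof -
    have n: "real n = 2 * l - 2 * \<alpha>" by (simp add: \<alpha>_def)
    have "\<alpha>\<^sup>2 * A + \<alpha> * ((real n - 2) * A + B) = \<alpha> * B + 2 * \<alpha> * (l - 1) * A - \<alpha>\<^sup>2 * A" for A B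
      unfolding n by (simp add: algebra_simps power2_eq_square)
    then show ?thesis .
  qed
  ultimately show ?thesis unfolding wv div up r2(2) by linarith
qed

end

section \<open>Homogeneity\<close>

lemma has_derivative_dilation:
  fixes f :: "'a::real_normed_vector \<Rightarrow> 'b::real_normed_vector"
  assumes U: "open U" "x \<in> U" and "t > 0" and f: "\<And>y. y \<in> U \<Longrightarrow> f (t *\<^sub>R y) = c *\<^sub>R f y"
    and F: "(f has_derivative F) (at x)"
  shows "(f has_derivative (\<lambda>h. (c / t) *\<^sub>R F h)) (at (t *\<^sub>R x))"
proof -
  let ?g = "\<lambda>y. (1 / t) *\<^sub>R y"
  have "(?g has_derivative ?g) (at (t *\<^sub>R x))" by (intro has_derivative_scaleR_right has_derivative_ident)
  moreover have "(f has_derivative F) (at (?g (t *\<^sub>R x)))" using F \<open>t > 0\<close> by simp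
  ultimately have "((\<lambda>y. f (?g y)) has_derivative (\<lambda>h. F (?g h))) (at (t *\<^sub>R x))"
    by (rule has_derivative_compose)
  then have "((\<lambda>y. c *\<^sub>R f (?g y)) has_derivative (\<lambda>h. c *\<^sub>R F (?g h))) (at (t *\<^sub>R x))"
    by (rule has_derivative_scaleR_right)
  moreover have "(\<lambda>h. c *\<^sub>R F (?g h)) = (\<lambda>h. (c / t) *\<^sub>R F h)"
    using linear_scale[OF has_derivative_linear[OF F]] by simp
  ultimately have *: "((\<lambda>y. c *\<^sub>R f (?g y)) has_derivative (\<lambda>h. (c / t) *\<^sub>R F h)) (at (t *\<^sub>R x))" by simp
  have "open (?g -` U)" by (intro open_vimage U continuous_intros)
  then show ?thesis
  proof (rule has_derivative_transform_within_open[OF *])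
    show "t *\<^sub>R x \<in> ?g -` U" using U(2) \<open>t > 0\<close> by simp
    show "c *\<^sub>R f (?g y) = f y" if "y \<in> ?g -` U" for y
      using f[of "?g y"] that \<open>t > 0\<close> by simp
  qed
qed

lemma euler_homogeneous:
  fixes f :: "'a::euclidean_space \<Rightarrow> real"
  assumes f: "f differentiable (at x)" and hom: "\<And>t. t > 0 \<Longrightarrow> f (t *\<^sub>R x) = t powr k * f x"
  shows "grad f x \<bullet> x = k * f x"
proof -
  have "((\<lambda>t. t *\<^sub>R x) has_derivative (\<lambda>s. s *\<^sub>R x)) (at 1)" by (auto intro!: derivative_eq_intros)
  moreover have "(f has_derivative (\<lambda>h. grad f x \<bullet> h)) (at (1 *\<^sub>R x))"
    using has_derivative_grad[OF f] by simp
  ultimately have 1: "((\<lambda>t. f (t *\<^sub>R x)) has_derivative (\<lambda>s. grad f x \<bullet> (s *\<^sub>R x))) (at 1)"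
    by (rule has_derivative_compose)
  have "((\<lambda>t. t powr k * f x) has_real_derivative k * f x) (at 1)"
    by (auto intro!: derivative_eq_intros)
  then have "((\<lambda>t. t powr k * f x) has_derivative (\<lambda>s. (k * f x) * s)) (at 1)"
    by (simp add: has_field_derivative_def)
  then have 2: "((\<lambda>t. f (t *\<^sub>R x)) has_derivative (\<lambda>s. (k * f x) * s)) (at 1)"
    by (rule has_derivative_transform_within_open[of _ _ _ _ "{0<..}"]) (auto simp: hom)
  from fun_cong[OF has_derivative_unique[OF 1 2], of 1] show ?thesis by simp
qed

text \<open>A local defining function of \<open>C\<close> at one point makes all points of \<open>C\<close> in its domain regular.\<close>

lemma hypersurface_regular_part: "hypersurface (regular_part C)"
  unfolding hypersurface_def
proof
  fix p assume "p \<in> regular_part C"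
  then obtain W f where ld: "local_defining C p W f" and "p \<in> C" by (auto simp: regular_part_def)
  have "regular_part C \<inter> W = C \<inter> W"
    using ld by (auto simp: regular_part_def local_defining_def)
  then have "local_defining (regular_part C) p W f" using ld by (simp add: local_defining_def)
  then show "\<exists>W G. local_defining (regular_part C) p W G" by blast
qed

lemma zero_in_tangent_space [simp]: "0 \<in> tangent_space S y"
  by (simp add: tangent_space_def)

lemma continuous_on_locally_agree:
  fixes K S :: "'a::euclidean_space set" and g :: "'a \<Rightarrow> real"
  assumes "K \<subseteq> S" and loc: "\<And>p. p \<in> K \<Longrightarrow> \<exists>V F. open V \<and> p \<in> V \<and> continuous_on V F \<and> (\<forall>y\<in>S \<inter> V. g y = F y)"
  shows "continuous_on K g"
  unfolding continuous_on_eq_continuous_within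
proof
  fix p assume p: "p \<in> K"
  obtain V F where V: "open V" "p \<in> V" "continuous_on V F" "\<forall>y\<in>S \<inter> V. g y = F y" using loc[OF p] by blast
  have "continuous (at p within K) F"
    using V by (simp add: continuous_on_eq_continuous_at continuous_at_imp_continuous_at_within)
  moreover have "eventually (\<lambda>y. F y = g y) (at p within K)"
    unfolding eventually_at_topological using V assms(1) by (intro exI[of _ V]) auto
  ultimately show "continuous (at p within K) g"
    using V p assms(1) unfolding continuous_within by (simp add: tendsto_cong subset_eq)
qed

locale weighted_cone =
  fixes C U :: "'a::euclidean_space set" and G :: "'a \<Rightarrow> real" and l :: real
  assumes nbhd: "conical_nbhd C U" and defining: "defining_function C U G" and homogeneous: "homogeneous_on U l G"
begin

abbreviation "R \<equiv> regular_part C"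
abbreviation "normal \<equiv> unit_grad G"
text \<open>The vertex is removed as it may be a regular point of \<open>C\<close>, where \<open>G\<close> need not define \<open>C\<close>.\<close>

definition U1 :: "'a set" where "U1 = {x \<in> U. grad G x \<noteq> 0} \<inter> - {0}"

lemma open_U: "open U" and scale_U: "x \<in> U \<Longrightarrow> t > 0 \<Longrightarrow> t *\<^sub>R x \<in> U"
  using nbhd by (auto simp: conical_nbhd_def)

lemma R_iff: "x \<in> R - {0} \<longleftrightarrow> x \<in> U \<and> G x = 0"
  using defining unfolding defining_function_def by blast

lemma smooth_G: "smooth_on U G"
  using defining by (simp add: defining_function_def)

lemma G_scale: "x \<in> U \<Longrightarrow> t > 0 \<Longrightarrow> G (t *\<^sub>R x) = t powr l * G x"
  using homogeneous by (simp add: homogeneous_on_def)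

lemma open_U1: "open U1"
proof -
  have "continuous_on U (grad G)"
    using smooth_G by (intro Ck_field_continuous[of 0] Ck_field_grad) (simp add: smooth_on_def del: Ck_on.simps)
  from continuous_open_preimage[OF this open_U open_Compl[OF closed_singleton], of 0]
  have "open {x \<in> U. grad G x \<noteq> 0}" by (simp add: vimage_def Int_def)
  then show ?thesis unfolding U1_def by (intro open_Int) auto
qed

lemma R_U1: "x \<in> R - {0} \<Longrightarrow> x \<in> U1"
  using defining R_iff unfolding U1_def defining_function_def by auto

lemma point: "x \<in> R - {0} \<Longrightarrow> hypersurface_point R x U1 G"
proof
  assume x: "x \<in> R - {0}"
  show "local_defining R x U1 G" unfolding local_defining_def
  proof (intro conjI ballI)
    show "smooth_on U1 G" using smooth_G unfolding smooth_on_def U1_def by (blast intro: Ck_on_subset)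
    show "R \<inter> U1 = {y \<in> U1. G y = 0}" using R_iff by (auto simp: U1_def)
  qed (use x R_U1 open_U1 in \<open>auto simp: U1_def\<close>)
qed auto

lemma grad_scale:
  assumes x: "x \<in> U" and t: "t > 0"
  shows "grad G (t *\<^sub>R x) = (t powr l / t) *\<^sub>R grad G x"
proof (rule gradI)
  have "(G has_derivative (\<lambda>h. (t powr l / t) *\<^sub>R (grad G x \<bullet> h))) (at (t *\<^sub>R x))"
    by (rule has_derivative_dilation[OF open_U x t _ has_derivative_grad[OF smooth_on_differentiable[OF smooth_G x]]])
      (simp add: G_scale t)
  then show "(G has_derivative (\<lambda>h. (t powr l / t) *\<^sub>R grad G x \<bullet> h)) (at (t *\<^sub>R x))" by simp
qed

lemma normal_scale: "x \<in> U \<Longrightarrow> t > 0 \<Longrightarrow> normal (t *\<^sub>R x) = normal x"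
  by (simp add: unit_grad_def grad_scale inverse_eq_divide)

lemma weight_scale: "x \<in> U \<Longrightarrow> t > 0 \<Longrightarrow> weight G (t *\<^sub>R x) = t powr (1 - l) * weight G x"
proof -
  assume x: "x \<in> U" and t: "t > 0"
  have "norm (grad G (t *\<^sub>R x)) = (t powr l / t) * norm (grad G x)" using t by (simp add: grad_scale[OF x t])
  moreover have "t powr (1 - l) = inverse (t powr l / t)" using t by (simp add: powr_diff)
  ultimately show ?thesis by (simp only: weight_def inverse_mult_distrib)
qed

lemma Ck_normal: "Ck_field k U1 normal"
  using smooth_G by (intro Ck_field_unit_grad open_U1) (auto simp: U1_def smooth_on_def simp del: Ck_on.simps intro: Ck_on_subset)

lemma Ck_div_normal: "Ck_on k U1 (divergence normal)"
  by (rule Ck_on_divergence[OF Ck_normal open_U1])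

lemma div_normal_scale:
  assumes x: "x \<in> U1" and t: "t > 0"
  shows "divergence normal (t *\<^sub>R x) = (1 / t) *\<^sub>R divergence normal x"
proof -
  have "(normal has_derivative (\<lambda>h. (1 / t) *\<^sub>R frechet_derivative normal (at x) h)) (at (t *\<^sub>R x))"
    by (rule has_derivative_dilation[OF open_U1 x t _ has_derivative_frechet[OF Ck_field_differentiable[OF Ck_normal x]]])
      (use normal_scale t in \<open>auto simp: U1_def\<close>)
  then show ?thesis by (simp add: divergence_def frechet_derivative_eq sum_distrib_left divide_inverse)
qed

lemma normal_derivative_scale:
  assumes x: "x \<in> U1" and t: "t > 0"
  shows "frechet_derivative (divergence normal) (at (t *\<^sub>R x)) (normal (t *\<^sub>R x)) = frechet_derivative (divergence normal) (at x) (normal x) / t\<^sup>2"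
proof -
  have d: "divergence normal differentiable (at x)" using Ck_div_normal[of "Suc 0"] x by simp
  have "(divergence normal has_derivative (\<lambda>h. (1 / t / t) *\<^sub>R frechet_derivative (divergence normal) (at x) h)) (at (t *\<^sub>R x))"
    by (rule has_derivative_dilation[OF open_U1 x t div_normal_scale[OF _ t] has_derivative_frechet[OF d]])
  then show ?thesis using normal_scale x t by (simp add: frechet_derivative_eq U1_def power2_eq_square)
qed

lemma potential_eq:
  assumes "x \<in> R - {0}"
  shows "potential C G x = frechet_derivative (divergence normal) (at x) (normal x)"
proof -
  interpret hypersurface_point R x U1 G by (rule point[OF assms])
  show ?thesis unfolding potential_def by (rule jacobi_weight_eq_normal_derivative(1))
qed

text \<open>The unit normal is homogeneous of degree \<open>0\<close>, so its divergence has degree \<open>-1\<close> and the derivative of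
  the divergence degree \<open>-2\<close>.\<close>

lemma potential_radial:
  assumes x: "x \<in> R - {0}"
  shows "potential C G x = angular_potential C G (x /\<^sub>R norm x) / (norm x)\<^sup>2" "x /\<^sub>R norm x \<in> regular_link C"
proof -
  let ?y = "x /\<^sub>R norm x"
  have n: "norm x > 0" using x by simp
  have xU: "x \<in> U" "G x = 0" using x R_iff by auto
  then have "?y \<in> U" "G ?y = 0" using n by (auto simp: scale_U G_scale)
  then have y: "?y \<in> R - {0}" using R_iff by blast
  then show link: "?y \<in> regular_link C" using n by (simp add: regular_link_def)
  have "potential C G ?y = potential C G x / (1 / norm x)\<^sup>2"
    unfolding potential_eq[OF y] potential_eq[OF x]
    using normal_derivative_scale[OF R_U1[OF x], of "1 / norm x"] n by (simp add: divide_inverse)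
  then show "potential C G x = angular_potential C G ?y / (norm x)\<^sup>2"
    using link n by (simp add: angular_potential_def power_divide)
qed

abbreviation "ZG \<equiv> hypersurface_point.Z G"

text \<open>Both are Euler relations, for \<open>G\<close>, which vanishes on the cone, and for the weight, which has degree
  \<open>1 - l\<close>.\<close>

lemma radial_tangential:
  assumes x: "x \<in> R - {0}"
  shows "x \<bullet> normal x = 0" "ZG x \<bullet> x = l - 1"
proof -
  have xU: "x \<in> U" "G x = 0" using x R_iff by auto
  note G_diff = smooth_on_differentiable[OF smooth_G xU(1)]
  interpret hypersurface_point R x U1 G by (rule point[OF x])
  have "grad G x \<bullet> x = l * G x"
    by (rule euler_homogeneous[OF G_diff]) (simp add: G_scale xU)
  then have "normal x \<bullet> x = 0" using xU grad_orth_iff[OF p_W] by simp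
  then show 1: "x \<bullet> normal x = 0" by (simp add: inner_commute)
  have "grad w x \<bullet> x = (1 - l) * w x"
    by (rule euler_homogeneous[OF w_differentiable[OF p_W]]) (simp add: weight_scale xU)
  moreover have "grad w x \<bullet> x = P x (grad w x) \<bullet> x"
    using P_inner(1)[OF p_W, of "grad w x" x] P_self[OF 1] by simp
  ultimately have "w x * (ZG x \<bullet> x) = w x * (l - 1)"
    unfolding P_grad_weight[OF p_W] by (simp add: algebra_simps)
  then show "ZG x \<bullet> x = l - 1" using weight_pos[OF p_W] by simp
qed

lemma test_function_extension:
  assumes u: "u \<in> test_functions (R - {0})"
  obtains K where "compact K" "K \<subseteq> R - {0}" "\<And>x. x \<notin> K \<Longrightarrow> u x = 0"
    "\<forall>x\<in>R - {0}. \<exists>V f. open V \<and> x \<in> V \<and> V \<subseteq> U1 \<and> smooth_on V f \<and> (\<forall>y\<in>R \<inter> V. u y = f y)"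
proof -
  obtain K where K: "compact K" "K \<subseteq> R - {0}" "\<And>x. x \<notin> K \<Longrightarrow> u x = 0" and s: "smooth_on_surface (R - {0}) u"
    using u unfolding test_functions_def by blast
  have "\<exists>V f. open V \<and> x \<in> V \<and> V \<subseteq> U1 \<and> smooth_on V f \<and> (\<forall>y\<in>R \<inter> V. u y = f y)" if x: "x \<in> R - {0}" for x
  proof -
    obtain W f where W: "open W" "x \<in> W" "smooth_on W f" "\<forall>y\<in>(R - {0}) \<inter> W. u y = f y"
      using s x unfolding smooth_on_surface_def by blast
    have "smooth_on (W \<inter> U1) f" using W(3) unfolding smooth_on_def by (blast intro: Ck_on_subset)
    then show ?thesis using W open_U1 R_U1[OF x]
      by (intro exI[of _ "W \<inter> U1"] exI[of _ f]) (auto simp: U1_def)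
  qed
  then have "\<forall>x\<in>R - {0}. \<exists>V f. open V \<and> x \<in> V \<and> V \<subseteq> U1 \<and> smooth_on V f \<and> (\<forall>y\<in>R \<inter> V. u y = f y)"
    by (rule ballI)
  then show ?thesis by (rule that[OF K(1,2), rotated]) (rule K(3))
qed

lemma surface_grad_locally_zero:
  assumes "p \<in> R" "open V" "p \<in> V" "\<And>y. y \<in> V \<Longrightarrow> u y = 0"
  shows "surface_grad R u p = 0"
proof -
  obtain W F where "hypersurface_point R p W F"
    using hypersurface_pointI[OF hypersurface_regular_part assms(1)] .
  then interpret q: hypersurface_point R p W F .
  have "grad (\<lambda>y. 0 :: real) p = 0" by (rule gradI) simp
  moreover have "surface_grad R u p = q.P p (grad (\<lambda>y. 0 :: real) p)"
    by (rule q.surface_grad_eq[OF assms(2,3)]) (use assms(4) in auto)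
  ultimately show ?thesis by (simp add: q.P_def)
qed

lemma cone_integral_eq: "cone_integral C f = (LINT x|hausdorff_measure (DIM('a) - 1). indicator R x *\<^sub>R f x)"
  by (simp add: cone_integral_def set_lebesgue_integral_def)

text \<open>Integrating the two pointwise identities.  The divergence theorem is applied on the whole regular
  part; the test functions vanish near the vertex, where the fields are extended by zero.\<close>

lemma test_function_integrals:
  assumes u: "u \<in> test_functions (R - {0})" and dim: "DIM('a) = n + 1"
  defines "g \<equiv> \<lambda>x. (weight G x)\<^sup>2 * (norm (surface_grad R (\<lambda>y. u y / weight G y) x))\<^sup>2"
    and "H \<equiv> hausdorff_measure (DIM('a) - 1) :: 'a measure"
  shows "Q_form C u = cone_integral C g + cone_integral C (\<lambda>x. potential C G x * (u x)\<^sup>2)"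
    and "cone_integral C g \<ge> (l - real n / 2)\<^sup>2 * cone_integral C (\<lambda>x. (u x)\<^sup>2 / (norm x)\<^sup>2)"
    and "integrable H (\<lambda>x. indicator R x *\<^sub>R (potential C G x * (u x)\<^sup>2))"
    and "integrable H (\<lambda>x. indicator R x *\<^sub>R ((u x)\<^sup>2 / (norm x)\<^sup>2))"
proof -
  obtain K where K: "compact K" "K \<subseteq> R - {0}" "\<And>x. x \<notin> K \<Longrightarrow> u x = 0"
    and ext: "\<forall>x\<in>R - {0}. \<exists>V f. open V \<and> x \<in> V \<and> V \<subseteq> U1 \<and> smooth_on V f \<and> (\<forall>y\<in>R \<inter> V. u y = f y)"
    using test_function_extension[OF u] by metis
  have KR: "K \<subseteq> R" using K(2) by auto
  have openK: "open (- K)" using K(1) by (simp add: compact_imp_closed open_Compl)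
  define X1 where "X1 = (\<lambda>y. - (u y)\<^sup>2 *\<^sub>R ZG y)"
  define X2 where "X2 = (\<lambda>y. ((u y)\<^sup>2 / (norm y)\<^sup>2) *\<^sub>R y)"
  have X_out: "X1 y = 0" "X2 y = 0" if "y \<notin> K" for y
    using K(3)[OF that] by (auto simp: X1_def X2_def)
  have C1: "C1_field_on R X1 \<and> C1_field_on R X2"
    unfolding C1_field_on_def
  proof (intro conjI ballI)
    fix p assume p: "p \<in> R"
    have *: "\<exists>V Y Y'. open V \<and> p \<in> V \<and> Ck_field (Suc 0) V Y \<and> Ck_field (Suc 0) V Y' \<and> (\<forall>y\<in>R \<inter> V. X1 y = Y y \<and> X2 y = Y' y)"
    proof (cases "p = 0")
      case True
      then show ?thesis using openK K(2) X_out
        by (intro exI[of _ "- K"] exI[of _ "\<lambda>y. 0"]) auto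
    next
      case False
      then have p': "p \<in> R - {0}" using p by simp
      interpret hypersurface_point R p U1 G by (rule point[OF p'])
      obtain V f where V: "open V" "p \<in> V" "V \<subseteq> U1" "smooth_on V f" "\<forall>y\<in>R \<inter> V. u y = f y"
        using ext p' by metis
      have f: "Ck_on (Suc 0) V f" using V(4) unfolding smooth_on_def by blast
      have 1: "Ck_field (Suc 0) V (\<lambda>y. - (f y)\<^sup>2 *\<^sub>R Z y)"
        by (intro Ck_field_scaleR Ck_on_minus Ck_on_power V(1) f Ck_field_subset[OF Ck_Z V(3)])
      have "Ck_on (Suc 0) V (\<lambda>y. (f y)\<^sup>2 / (norm y)\<^sup>2)"
        unfolding power2_norm_eq_inner using V(3)
        by (intro Ck_on_divide Ck_on_power Ck_on_inner Ck_field_id V(1) f) (auto simp: U1_def)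
      then have 2: "Ck_field (Suc 0) V (\<lambda>y. ((f y)\<^sup>2 / (norm y)\<^sup>2) *\<^sub>R y)"
        by (intro Ck_field_scaleR Ck_field_id V(1))
      show ?thesis
        by (intro exI[of _ V] exI[of _ "\<lambda>y. - (f y)\<^sup>2 *\<^sub>R Z y"] exI[of _ "\<lambda>y. ((f y)\<^sup>2 / (norm y)\<^sup>2) *\<^sub>R y"])
          (use V 1 2 in \<open>auto simp: X1_def X2_def\<close>)
    qed
    then show "\<exists>V Y. open V \<and> p \<in> V \<and> Ck_field (Suc 0) V Y \<and> (\<forall>y\<in>R \<inter> V. X1 y = Y y)"
      by metis
    from * show "\<exists>V Y. open V \<and> p \<in> V \<and> Ck_field (Suc 0) V Y \<and> (\<forall>y\<in>R \<inter> V. X2 y = Y y)"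
      by metis
  qed
  have tang: "X1 y \<in> tangent_space R y \<and> X2 y \<in> tangent_space R y" if "y \<in> R" for y
  proof (cases "y \<in> K")
    case True
    then have y: "y \<in> R - {0}" using K(2) by auto
    interpret hypersurface_point R y U1 G by (rule point[OF y])
    show ?thesis
      using radial_tangential(1)[OF y] Z_orth[OF p_W]
      by (simp add: tangent_space_eq X1_def X2_def inner_commute)
  qed (simp add: X_out)
  note hyp = hypersurface_regular_part[of C]
  have div1: "integrable H (\<lambda>y. indicator R y *\<^sub>R surface_div R X1 y)" "(LINT y|H. indicator R y *\<^sub>R surface_div R X1 y) = 0"
    unfolding H_def using surface_divergence_theorem[OF hyp _ _ K(1) KR, of X1] C1 tang X_out by auto
  have div2: "integrable H (\<lambda>y. indicator R y *\<^sub>R surface_div R X2 y)" "(LINT y|H. indicator R y *\<^sub>R surface_div R X2 y) = 0"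
    unfolding H_def using surface_divergence_theorem[OF hyp _ _ K(1) KR, of X2] C1 tang X_out by auto
  have div_out: "surface_div R X1 y = 0 \<and> surface_div R X2 y = 0" if y: "y \<in> R" "y \<notin> K" for y
    using surface_div_cong[OF hyp _ y(1) openK, of X1 "\<lambda>y. 0"] surface_div_cong[OF hyp _ y(1) openK, of X2 "\<lambda>y. 0"]
      surface_div_zero[OF hyp y(1)] C1 X_out y by auto
  have grad_out: "surface_grad R u y = 0" "surface_grad R (\<lambda>y. u y / weight G y) y = 0" if "y \<in> R" "y \<notin> K" for y
    by (rule surface_grad_locally_zero[OF that(1) openK]; use that K(3) in simp)+
  have point_id: "(norm (surface_grad R u x))\<^sup>2 - sff_norm_sq R x * (u x)\<^sup>2
      = g x + potential C G x * (u x)\<^sup>2 + surface_div R X1 x" (is ?A)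
    and point_hardy: "g x \<ge> (l - real n / 2)\<^sup>2 * ((u x)\<^sup>2 / (norm x)\<^sup>2) + (l - real n / 2) * surface_div R X2 x" (is ?B)
    if x: "x \<in> R" for x
  proof -
    have "?A \<and> ?B" if "x \<in> K"
    proof -
      have x': "x \<in> R - {0}" using that K(2) by auto
      note pot = potential_eq[OF x'] and rad = radial_tangential[OF x']
      interpret hypersurface_point R x U1 G by (rule point[OF x'])
      obtain V f where V: "open V" "x \<in> V" "smooth_on V f" "\<forall>y\<in>R \<inter> V. u y = f y"
        using ext x' by metis
      have fd: "f differentiable (at x)" by (rule smooth_on_differentiable[OF V(3,2)])
      have uf: "u y = f y" if "y \<in> R \<inter> V" for y using V(4) that by blast
      show ?thesis
        unfolding g_def X1_def X2_def pot
        by (intro conjI ground_state_identity[OF V(1,2) fd uf] hardy_identity[OF V(1,2) fd uf _ rad dim])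
          (use x' in auto)
    qed
    moreover have "?A \<and> ?B" if "x \<notin> K"
      using grad_out[OF x that] div_out[OF x that] K(3)[OF that] by (simp add: g_def)
    ultimately show ?A ?B by blast+
  qed
  have int: "integrable H (\<lambda>x. indicator R x *\<^sub>R f x)" if "continuous_on K f" "\<And>y. y \<in> R \<Longrightarrow> y \<notin> K \<Longrightarrow> f y = 0" for f :: "'a \<Rightarrow> real"
    unfolding H_def by (rule integrable_on_hypersurface[OF hyp K(1) KR that])
  have cont: "\<exists>V F1 F2 F3. open V \<and> p \<in> V \<and> continuous_on V F1 \<and> continuous_on V F2 \<and> continuous_on V F3
      \<and> (\<forall>y\<in>R \<inter> V. g y = F1 y \<and> potential C G y * (u y)\<^sup>2 = F2 y \<and> (u y)\<^sup>2 / (norm y)\<^sup>2 = F3 y)"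
    if p: "p \<in> K" for p
  proof -
    have p': "p \<in> R - {0}" using p K(2) by auto
    interpret hypersurface_point R p U1 G by (rule point[OF p'])
    obtain V f where V: "open V" "p \<in> V" "V \<subseteq> U1" "smooth_on V f" "\<forall>y\<in>R \<inter> V. u y = f y"
      using ext p' by metis
    have f: "continuous_on V f" and gf: "continuous_on V (grad f)"
      using V(4) unfolding smooth_on_def
      by (auto intro: Ck_on_continuous[of 0] Ck_field_continuous[of 0] Ck_field_grad simp del: Ck_on.simps)
    have \<nu>: "continuous_on V \<nu>" and Zc: "continuous_on V Z"
      using Ck_field_continuous[OF Ck_normal[of 0]] Ck_field_continuous[OF Ck_Z[of 0]] V(3)
      by (auto intro: continuous_on_subset)
    define T where "T y = P y (grad f y) + f y *\<^sub>R Z y" for y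
    define F2 where "F2 y = (\<Sum>b\<in>Basis. (\<nu> y \<bullet> b) *\<^sub>R frechet_derivative (divergence \<nu>) (at y) b) * (f y)\<^sup>2" for y
    have "continuous_on V (\<lambda>y. T y \<bullet> T y)"
      unfolding T_def P_def by (intro continuous_intros f gf \<nu> Zc)
    moreover have "continuous_on V F2"
    proof -
      have "Ck_on (Suc 0) V (divergence \<nu>)"
        by (rule Ck_on_subset[OF Ck_on_divergence[OF Ck_normal open_W] V(3)])
      then have "continuous_on V (\<lambda>y. frechet_derivative (divergence \<nu>) (at y) b)" if "b \<in> Basis" for b
        using that by simp
      then show ?thesis unfolding F2_def by (intro continuous_intros f \<nu>)
    qed
    moreover have "continuous_on V (\<lambda>y. (f y)\<^sup>2 / (norm y)\<^sup>2)"
      using V(3) by (intro continuous_intros f) (auto simp: U1_def)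
    moreover have "g y = T y \<bullet> T y \<and> potential C G y * (u y)\<^sup>2 = F2 y \<and> (u y)\<^sup>2 / (norm y)\<^sup>2 = (f y)\<^sup>2 / (norm y)\<^sup>2"
      if y: "y \<in> R \<inter> V" for y
    proof (intro conjI)
      have y': "y \<in> R - {0}" using y V(3) by (auto simp: U1_def)
      interpret y: hypersurface_point R y U1 G by (rule point[OF y'])
      have yV: "y \<in> V" using y by simp
      have uf: "u z = f z" if "z \<in> R \<inter> V" for z using V(5) that by blast
      show "g y = T y \<bullet> T y"
        unfolding g_def T_def
        by (rule y.norm_surface_grad_quotient_weight[OF V(1) yV smooth_on_differentiable[OF V(4) yV] uf])
      have "divergence \<nu> differentiable (at y)"
        using Ck_on_divergence[OF Ck_normal[of "Suc (Suc 0)"] open_W] y.p_W by simp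
      from linear_Basis_sum[OF linear_frechet_derivative[OF this], of "\<nu> y"]
      show "potential C G y * (u y)\<^sup>2 = F2 y" using potential_eq[OF y'] uf[OF y] by (simp add: F2_def)
      show "(u y)\<^sup>2 / (norm y)\<^sup>2 = (f y)\<^sup>2 / (norm y)\<^sup>2" using uf[OF y] by simp
    qed
    ultimately show ?thesis using V(1,2) by blast
  qed
  have intg: "integrable H (\<lambda>x. indicator R x *\<^sub>R g x)"
  proof (rule int)
    show "continuous_on K g" by (rule continuous_on_locally_agree[OF KR]) (use cont in metis)
  qed (use grad_out in \<open>simp add: g_def\<close>)
  show intV: "integrable H (\<lambda>x. indicator R x *\<^sub>R (potential C G x * (u x)\<^sup>2))"
  proof (rule int)
    show "continuous_on K (\<lambda>x. potential C G x * (u x)\<^sup>2)"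
      by (rule continuous_on_locally_agree[OF KR]) (use cont in metis)
  qed (use K(3) in simp)
  show intr: "integrable H (\<lambda>x. indicator R x *\<^sub>R ((u x)\<^sup>2 / (norm x)\<^sup>2))"
  proof (rule int)
    show "continuous_on K (\<lambda>x. (u x)\<^sup>2 / (norm x)\<^sup>2)"
      by (rule continuous_on_locally_agree[OF KR]) (use cont in metis)
  qed (use K(3) in simp)
  have "Q_form C u = (LINT x|H. (indicator R x *\<^sub>R g x + indicator R x *\<^sub>R (potential C G x * (u x)\<^sup>2)) + indicator R x *\<^sub>R surface_div R X1 x)"
    unfolding Q_form_def cone_integral_eq H_def[symmetric] using point_id
    by (intro Bochner_Integration.integral_cong) (auto simp: indicator_def)
  also have "\<dots> = (LINT x|H. indicator R x *\<^sub>R g x) + (LINT x|H. indicator R x *\<^sub>R (potential C G x * (u x)\<^sup>2))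
      + (LINT x|H. indicator R x *\<^sub>R surface_div R X1 x)"
    by (simp only: Bochner_Integration.integral_add[OF Bochner_Integration.integrable_add[OF intg intV] div1(1)]
        Bochner_Integration.integral_add[OF intg intV])
  finally show "Q_form C u = cone_integral C g + cone_integral C (\<lambda>x. potential C G x * (u x)\<^sup>2)"
    unfolding cone_integral_eq H_def[symmetric] using div1(2) by simp
  have i1: "integrable H (\<lambda>x. (l - real n / 2)\<^sup>2 * (indicator R x *\<^sub>R ((u x)\<^sup>2 / (norm x)\<^sup>2)))"
    and i2: "integrable H (\<lambda>x. (l - real n / 2) * (indicator R x *\<^sub>R surface_div R X2 x))"
    by (intro integrable_mult_right intr div2(1))+
  have "(LINT x|H. (l - real n / 2)\<^sup>2 * (indicator R x *\<^sub>R ((u x)\<^sup>2 / (norm x)\<^sup>2)) + (l - real n / 2) * (indicator R x *\<^sub>R surface_div R X2 x))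
      \<le> (LINT x|H. indicator R x *\<^sub>R g x)"
    using point_hardy
    by (intro integral_mono intg Bochner_Integration.integrable_add i1 i2) (auto simp: indicator_def)
  also have "(LINT x|H. (l - real n / 2)\<^sup>2 * (indicator R x *\<^sub>R ((u x)\<^sup>2 / (norm x)\<^sup>2)) + (l - real n / 2) * (indicator R x *\<^sub>R surface_div R X2 x))
      = (l - real n / 2)\<^sup>2 * (LINT x|H. indicator R x *\<^sub>R ((u x)\<^sup>2 / (norm x)\<^sup>2)) + (l - real n / 2) * (LINT x|H. indicator R x *\<^sub>R surface_div R X2 x)"
    by (simp only: Bochner_Integration.integral_add[OF i1 i2] integral_mult_right_zero)
  finally show "cone_integral C g \<ge> (l - real n / 2)\<^sup>2 * cone_integral C (\<lambda>x. (u x)\<^sup>2 / (norm x)\<^sup>2)"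
    unfolding cone_integral_eq H_def[symmetric] using div2(2) by simp
qed

text \<open>Both sides of \<open>\<L>(aF) = F K\<close> vanish on the cone, so their normal derivatives there
  determine \<open>K\<close>.\<close>

lemma potential_boundary_defect:
  assumes minimal: "minimal_surface R" and a: "smooth_on U a" "\<forall>x\<in>U. a x > 0"
    and F: "defining_function C U F" and GaF: "\<forall>x\<in>U. G x = a x * F x" and x: "x \<in> R - {0}"
  shows "potential C G x = boundary_defect U F a x / ((a x)^3 * (norm (grad F x))\<^sup>2)"
proof -
  have F': "smooth_on U F" "\<And>y. y \<in> U \<Longrightarrow> F y = 0 \<longleftrightarrow> y \<in> R - {0}" "\<And>y. y \<in> R - {0} \<Longrightarrow> grad F y \<noteq> 0"
    using F unfolding defining_function_def by blast+
  define L where "L = level_op (\<lambda>y. a y * F y)"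
  have aF: "smooth_on U (\<lambda>y. a y * F y)"
    using a(1) F'(1) unfolding smooth_on_def by (intro allI Ck_on_mult open_U) auto
  have L_smooth: "smooth_on U L" unfolding smooth_on_def L_def by (intro allI Ck_on_level_op open_U aF)
  have grad_eq: "grad (\<lambda>y. a y * F y) y = grad G y" if "y \<in> U" for y
  proof (rule gradI)
    show "((\<lambda>y. a y * F y) has_derivative (\<lambda>h. grad G y \<bullet> h)) (at y)"
      by (rule has_derivative_transform_within_open[OF has_derivative_grad[OF smooth_on_differentiable[OF smooth_G that]] open_U that])
        (use GaF in simp)
  qed
  have LG: "L y = level_op G y" if y: "y \<in> U" for y
  proof -
    have gC: "Ck_field (Suc 0) U (grad G)" using smooth_G unfolding smooth_on_def by (intro Ck_field_grad) blast
    have "laplacian G y = laplacian (\<lambda>y. a y * F y) y"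
      unfolding laplacian_def
      by (rule divergence_cong_open(1)[OF open_U y _ Ck_field_differentiable[OF gC y]]) (simp add: grad_eq)
    moreover have "grad (\<lambda>z. (norm (grad (\<lambda>y. a y * F y) z))\<^sup>2) y = grad (\<lambda>z. (norm (grad G z))\<^sup>2) y"
    proof (rule gradI)
      have "(\<lambda>z. grad G z \<bullet> grad G z) differentiable (at y)"
        using Ck_on_inner[OF open_U gC gC] y by simp
      then have "((\<lambda>z. (norm (grad G z))\<^sup>2) has_derivative (\<lambda>h. grad (\<lambda>z. (norm (grad G z))\<^sup>2) y \<bullet> h)) (at y)"
        by (intro has_derivative_grad) (simp add: power2_norm_eq_inner)
      then show "((\<lambda>z. (norm (grad (\<lambda>y. a y * F y) z))\<^sup>2) has_derivative (\<lambda>h. grad (\<lambda>z. (norm (grad G z))\<^sup>2) y \<bullet> h)) (at y)"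
        by (rule has_derivative_transform_within_open[OF _ open_U y]) (simp add: grad_eq)
    qed
    ultimately show ?thesis unfolding L_def level_op_def grad_eq[OF y] by simp
  qed
  have LG_zero: "level_op G y = 0" if y: "y \<in> R - {0}" for y
  proof -
    interpret hypersurface_point R y U1 G by (rule point[OF y])
    show ?thesis using minimal y by (intro level_op_normal_derivative(1)) (simp add: minimal_surface_def)
  qed
  define K where "K = boundary_defect U F a"
  have "\<exists>q. smooth_on U q \<and> (\<forall>y\<in>U. F y \<noteq> 0 \<longrightarrow> q y = L y / F y)"
  proof (rule smooth_quotient_exists[OF open_U F'(1) _ L_smooth])
    show "grad F y \<noteq> 0" if "y \<in> U" "F y = 0" for y using F'(2,3) that by blast
    show "L y = 0" if "y \<in> U" "F y = 0" for y using F'(2) that LG[OF that(1)] LG_zero by simp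
  qed
  then have K: "smooth_on U K \<and> (\<forall>y\<in>U. F y \<noteq> 0 \<longrightarrow> K y = L y / F y)"
    unfolding K_def boundary_defect_def L_def by (rule someI_ex)
  have xU: "x \<in> U" "F x = 0" using x R_iff F'(2) by auto
  have LFK: "\<forall>y\<in>U. L y = F y * K y"
  proof
    fix y assume y: "y \<in> U"
    show "L y = F y * K y"
    proof (cases "F y = 0")
      case True
      then show ?thesis using F'(2)[OF y] LG[OF y] LG_zero[of y] by simp
    qed (use K y in auto)
  qed
  have gL: "grad L x = K x *\<^sub>R grad F x"
    by (rule grad_product_zero[OF smooth_on_differentiable[OF F'(1) xU(1)] smooth_on_differentiable[OF conjunct1[OF K] xU(1)] xU(2) open_U xU(1) LFK])
  have gG: "grad G x = a x *\<^sub>R grad F x"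
    by (rule grad_product_zero[OF smooth_on_differentiable[OF F'(1) xU(1)] smooth_on_differentiable[OF a(1) xU(1)] xU(2) open_U xU(1)])
      (use GaF in \<open>simp add: mult.commute\<close>)
  have ax: "a x > 0" using a(2) xU by auto
  note pot = potential_eq[OF x]
  interpret hypersurface_point R x U1 G by (rule point[OF x])
  have Ld: "L differentiable (at x)" by (rule smooth_on_differentiable[OF L_smooth xU(1)])
  have "(level_op G has_derivative (\<lambda>h. grad L x \<bullet> h)) (at x)"
    by (rule has_derivative_transform_within_open[OF has_derivative_grad[OF Ld] open_U xU(1)]) (rule LG)
  then have "grad L x \<bullet> \<nu> x = norm (grad G x) ^ 3 * potential C G x"
    unfolding pot using level_op_normal_derivative(2) minimal p_in
    by (simp add: frechet_derivative_eq minimal_surface_def)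
  moreover have "grad F x \<bullet> \<nu> x = norm (grad F x)"
  proof -
    have "\<nu> x = grad F x /\<^sub>R norm (grad F x)"
      unfolding unit_grad_def gG using ax by simp
    then show ?thesis using F'(3)[OF x] by (simp add: dot_square_norm power2_eq_square)
  qed
  ultimately have "K x * norm (grad F x) = (a x * norm (grad F x)) ^ 3 * potential C G x"
    unfolding gL gG using ax by simp
  then have "norm (grad F x) * K x = norm (grad F x) * ((a x)^3 * (norm (grad F x))\<^sup>2 * potential C G x)"
    by (simp add: power_mult_distrib power2_eq_square power3_eq_cube mult_ac)
  then have "K x = (a x)^3 * (norm (grad F x))\<^sup>2 * potential C G x" using F'(3)[OF x] by simp
  then show ?thesis using F'(3)[OF x] ax by (simp add: K_def)
qed

end

theorem theorem4p8:
  fixes C U :: "'a::euclidean_space set" and G :: "'a \<Rightarrow> real" and l :: real and n :: nat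
  assumes dim: "DIM('a) = n + 1" and n: "n \<ge> 2"
    and cone: "cone C"
    and two_sided: "two_sided (regular_part C)"
    and minimal: "minimal_surface (regular_part C)"
    and nbhd: "conical_nbhd C U"
    and defining: "defining_function C U G"
    and homogeneous: "homogeneous_on U l G"
  shows
    "(\<forall>x \<in> regular_part C - {0}. weight G x > 0 \<and>
        potential C G x = angular_potential C G (x /\<^sub>R norm x) / (norm x)\<^sup>2)
     \<and> (\<forall>u \<in> test_functions (regular_part C - {0}).
          Q_form C u =
            cone_integral C (\<lambda>x. (weight G x)\<^sup>2 *
               (norm (surface_grad (regular_part C) (\<lambda>y. u y / weight G y) x))\<^sup>2)
            + cone_integral C (\<lambda>x. potential C G x * (u x)\<^sup>2))
     \<and> (\<forall>\<beta>\<^sub>0::real. (\<forall>\<theta> \<in> regular_link C. angular_potential C G \<theta> \<ge> \<beta>\<^sub>0) \<longrightarrow>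
          (\<forall>u \<in> test_functions (regular_part C - {0}).
             Q_form C u \<ge>
               ((l - real n / 2)\<^sup>2 + \<beta>\<^sub>0) * cone_integral C (\<lambda>x. (u x)\<^sup>2 / (norm x)\<^sup>2)))
     \<and> (\<forall>F a. smooth_on U a \<longrightarrow> (\<forall>x\<in>U. a x > 0) \<longrightarrow> defining_function C U F \<longrightarrow>
          (\<forall>x\<in>U. G x = a x * F x) \<longrightarrow>
          (\<forall>x \<in> regular_part C - {0}.
             potential C G x = boundary_defect U F a x / ((a x)^3 * (norm (grad F x))\<^sup>2) \<and>
             potential C G x =
               frechet_derivative (divergence (unit_grad G)) (at x) (unit_grad G x))
          \<and> ((\<forall>x \<in> regular_part C - {0}. boundary_defect U F a x \<ge> 0) \<longrightarrow>
               stable_cone C \<and>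
               (l \<noteq> real n / 2 \<longrightarrow> strictly_stable_cone C ((l - real n / 2)\<^sup>2))))"
proof -
  interpret weighted_cone C U G l
    using nbhd defining homogeneous by unfold_locales
  let ?R = "regular_part C"
  let ?\<alpha> = "(l - real n / 2)\<^sup>2"
  have lower: "Q_form C u \<ge> (?\<alpha> + \<beta>) * cone_integral C (\<lambda>x. (u x)\<^sup>2 / (norm x)\<^sup>2)"
    if \<beta>: "\<forall>\<theta> \<in> regular_link C. angular_potential C G \<theta> \<ge> \<beta>" and u: "u \<in> test_functions (?R - {0})" for \<beta> u
  proof -
    note ints = test_function_integrals[OF u dim]
    have "\<beta> * cone_integral C (\<lambda>x. (u x)\<^sup>2 / (norm x)\<^sup>2) \<le> cone_integral C (\<lambda>x. potential C G x * (u x)\<^sup>2)"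
      unfolding cone_integral_eq integral_mult_right_zero[symmetric]
    proof (rule integral_mono[OF integrable_mult_right[OF ints(4)] ints(3)])
      fix x
      show "\<beta> * (indicat_real ?R x *\<^sub>R ((u x)\<^sup>2 / (norm x)\<^sup>2)) \<le> indicat_real ?R x *\<^sub>R (potential C G x * (u x)\<^sup>2)"
      proof (cases "x \<in> ?R \<and> u x \<noteq> 0")
        case True
        have "x \<noteq> 0"
          using u True unfolding test_functions_def by blast
        then have x: "x \<in> ?R - {0}" using True by simp
        have "\<beta> / (norm x)\<^sup>2 \<le> potential C G x"
          unfolding potential_radial(1)[OF x] using \<beta> potential_radial(2)[OF x] by (intro divide_right_mono) auto
        from mult_right_mono[OF this, of "(u x)\<^sup>2"] show ?thesis using True by simp
      qed auto
    qed
    then show ?thesis using ints(1,2) by (simp add: distrib_right)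
  qed
  have Q0: "Q_form C u \<ge> ?\<alpha> * cone_integral C (\<lambda>x. (u x)\<^sup>2 / (norm x)\<^sup>2)"
    if pot: "\<forall>x\<in>?R - {0}. 0 \<le> potential C G x" and u: "u \<in> test_functions (?R - {0})" for u
  proof -
    have "\<forall>\<theta> \<in> regular_link C. angular_potential C G \<theta> \<ge> 0"
      using pot by (auto simp: angular_potential_def regular_link_def)
    from lower[OF this u] show ?thesis by simp
  qed
  have nonneg: "cone_integral C (\<lambda>x. (u x)\<^sup>2 / (norm x)\<^sup>2) \<ge> 0" for u
    unfolding cone_integral_eq by (intro Bochner_Integration.integral_nonneg) simp
  have defect: "potential C G x = boundary_defect U F a x / ((a x)^3 * (norm (grad F x))\<^sup>2)"
    if "smooth_on U a" "\<forall>x\<in>U. a x > 0" "defining_function C U F" "\<forall>x\<in>U. G x = a x * F x" "x \<in> ?R - {0}" for F a x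
    by (rule potential_boundary_defect[OF minimal that])
  have stable: "stable_cone C \<and> (l \<noteq> real n / 2 \<longrightarrow> strictly_stable_cone C ?\<alpha>)"
    if aF: "smooth_on U a" "\<forall>x\<in>U. a x > 0" "defining_function C U F" "\<forall>x\<in>U. G x = a x * F x"
      and bd: "\<forall>x\<in>?R - {0}. boundary_defect U F a x \<ge> 0" for F a
  proof -
    have pot: "\<forall>x\<in>?R - {0}. 0 \<le> potential C G x"
    proof
      fix x assume x: "x \<in> ?R - {0}"
      then have "a x > 0" using aF(2) R_iff by blast
      then show "0 \<le> potential C G x"
        unfolding defect[OF aF x] using bd x by (intro divide_nonneg_nonneg mult_nonneg_nonneg) auto
    qed
    have "0 \<le> Q_form C u" if "u \<in> test_functions (?R - {0})" for u
      using Q0[OF pot that] nonneg[of u] mult_nonneg_nonneg[of ?\<alpha>] by (meson order_trans zero_le_power2)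
    then show ?thesis
      using Q0[OF pot] by (auto simp: stable_cone_def strictly_stable_cone_def)
  qed
  show ?thesis
  proof (intro conjI ballI allI impI)
    fix x assume x: "x \<in> ?R - {0}"
    show "weight G x > 0" by (rule hypersurface_point.weight_pos[OF point[OF x] R_U1[OF x]])
    show "potential C G x = angular_potential C G (x /\<^sub>R norm x) / (norm x)\<^sup>2" by (rule potential_radial(1)[OF x])
  next
    fix u assume u: "u \<in> test_functions (?R - {0})"
    show "Q_form C u = cone_integral C (\<lambda>x. (weight G x)\<^sup>2 * (norm (surface_grad ?R (\<lambda>y. u y / weight G y) x))\<^sup>2)
        + cone_integral C (\<lambda>x. potential C G x * (u x)\<^sup>2)"
      by (rule test_function_integrals(1)[OF u dim])
  qed (use lower defect stable potential_eq in blast)+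
qed

end
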